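(* Fix $\theta>0$. For $\sigma$ drawn from the Ewens measure $\mathbb{P}_{\theta,n}$ on $\mathfrak{S}_n$, as $n\to\infty$, \[\mathbb{E}_{\theta,n}\,\mathsf{invol}(\sigma) = \frac{\theta^{\frac{1 - \theta^2}{4}}\Gamma(\theta)}{2^{\frac{\theta^2}{2} + 1}e^{\frac{\theta}{2}}\sqrt{\pi}}\,e^{2\sqrt{\theta n}}\,n^{\frac{\theta^2}{4} - \theta + \frac{1}{4}}\left(1 + O(n^{-\frac{1}{2}})\right).\]
   Context: For a permutation $\sigma\in\mathfrak{S}_n$, $\mathsf{invol}(\sigma)$ is the number of ordered pairs $(\tau_1,\tau_2)$ of involutions in $\mathfrak{S}_n$ (permutations with $\tau^2=\mathrm{id}$) such that $\sigma=\tau_2\circ\tau_1$. For $\theta>0$, the Ewens measure (ESF$(\theta)$) on $\mathfrak{S}_n$ is $\mathbb{P}_{\theta,n}(\sigma=\sigma_0)=\theta^{K(\sigma_0)}/\theta^{(n)}$, where $K(\sigma_0)$ is the number of cycles of $\sigma_0$ and $\theta^{(n)}=\theta(\theta+1)\cdots(\theta+n-1)$; $\mathbb{E}_{\theta,n}$ is the corresponding expectation. *)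

theory Defs
  imports "HOL-Analysis.Analysis" "HOL-Combinatorics.Combinatorics" "HOL-Library.Landau_Symbols"
begin

definition num_cycles :: "nat \<Rightarrow> (nat \<Rightarrow> nat) \<Rightarrow> nat" where
  "num_cycles n \<sigma> = card ((\<lambda>x. orbit \<sigma> x) ` {1..n})"

definition invol :: "nat \<Rightarrow> (nat \<Rightarrow> nat) \<Rightarrow> nat" where
  "invol n \<sigma> = card {(\<tau>1, \<tau>2). \<tau>1 permutes {1..n} \<and> \<tau>2 permutes {1..n} \<and>
       \<tau>1 \<circ> \<tau>1 = id \<and> \<tau>2 \<circ> \<tau>2 = id \<and> \<sigma> = \<tau>2 \<circ> \<tau>1}"

definition ewens_expectation :: "real \<Rightarrow> nat \<Rightarrow> ((nat \<Rightarrow> nat) \<Rightarrow> real) \<Rightarrow> real" where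
  "ewens_expectation \<theta> n f =
     (\<Sum>\<sigma>\<in>{\<sigma>. \<sigma> permutes {1..n}}. \<theta> ^ num_cycles n \<sigma> * f \<sigma>) / pochhammer \<theta> n"

end

theory Submission
  imports Defs "HOL-Real_Asymp.Real_Asymp"
begin

text \<open>
  A pair of involutions is a graph whose components are paths and cycles with alternating colours.
  A path is a single cycle of \<open>\<tau>2 \<circ> \<tau>1\<close> (weight \<open>\<theta>\<close>), a cycle contributes two of them
  (weight \<open>\<theta>\<^sup>2\<close>). Deleting one or two vertices at the end of a component gives a recurrence
  for the weighted number of pairs; it says that their exponential generating function is
  \<open>(1 - z\<^sup>2) powr (-\<theta>\<^sup>2/2) * exp (\<theta> z / (1 - z))\<close>.

  The coefficients \<open>e\<^sub>n\<close> of \<open>exp (\<theta> z / (1 - z))\<close> obey a three-term recurrence. Their ratios satisfy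
  a Riccati recurrence that contracts, so \<open>e\<^sub>n = C * n powr (-3/4) * exp (2 * sqrt (\<theta> n)) * (1 + O(n powr (-1/2)))\<close>
  with an unknown constant. Near \<open>j \<approx> sqrt n\<close> the shifted coefficients \<open>e\<^sub>n\<^sub>-\<^sub>d\<^sub>j\<close> are nearly
  geometric in \<open>j\<close>, so convolution with the positive coefficients of \<open>(1 - z\<^sup>d) powr (-b)\<close> amounts to
  evaluating that binomial series. For \<open>d = 2\<close>, \<open>b = \<theta>\<^sup>2/2\<close> this is the theorem up to \<open>C\<close>.
  For \<open>d = 1\<close>, \<open>b = 1/2\<close> the convolution is a Laguerre polynomial that is explicitly a perturbed
  hyperbolic cosine series, and Chebyshev's inequality yields \<open>C\<close>.
\<close>

section \<open>Cycles of products of involutions\<close>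

text \<open>A linear recurrence fixes the growth of its solutions only up to a scalar, and no
  contour integral is used, so the scalar must be read off from a sequence whose size is known
  independently. This is why the convolution estimate is proved for arbitrary \<open>d\<close> and
  \<open>b\<close>: one statement serves both for the wanted coefficients and for the calibration.
  As the scalar does not depend on n, the calibration may be a bare limit; its natural error, of
  order n^(-1/4), does no harm to the final rate. On the combinatorial side, deleting one end of a
  path leaves pairs in which one involution lives on one point fewer than the other. The recurrence
  closes only when such lopsided pairs are counted too; they contribute partial sums, that is, the
  factor 1 / (1 - z). The powers of n in the result are -3/4 from the exponential factor,
  \<theta>^2/4 from the binomial series evaluated at distance about 2 * sqrt (\<theta> / n) from its
  singularity, and 1 - \<theta> from \<open>fact n / pochhammer \<theta> n\<close>.\<close>

definition cycles_on :: "'a set \<Rightarrow> ('a \<Rightarrow> 'a) \<Rightarrow> nat" where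
  "cycles_on A \<sigma> = card (orbit \<sigma> ` A)"

abbreviation transposition :: "'a \<Rightarrow> 'a \<Rightarrow> 'a \<Rightarrow> 'a" where
  "transposition \<equiv> Transposition.transpose"

definition involutions :: "'a set \<Rightarrow> ('a \<Rightarrow> 'a) set" where
  "involutions A = {\<tau>. \<tau> permutes A \<and> \<tau> \<circ> \<tau> = id}"

lemma orbit_eq_if_mem:
  assumes "permutation \<sigma>" "y \<in> orbit \<sigma> z"
  shows "orbit \<sigma> y = orbit \<sigma> z"
  using orbit_cyclic_eq3[OF cyclic_on_orbit'[OF assms(1)] assms(2)] .

lemma permutation_if_permutes: "finite A \<Longrightarrow> \<sigma> permutes A \<Longrightarrow> permutation \<sigma>"
  unfolding permutation_permutes by blast

lemma orbit_closed_subset: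
  assumes "z \<in> S" "\<And>y. y \<in> S \<Longrightarrow> f y \<in> S"
  shows "orbit f z \<subseteq> S"
proof
  fix y assume "y \<in> orbit f z"
  then show "y \<in> S" by induction (use assms in auto)
qed

text \<open>Composing with the transposition inserts \<open>x\<close> into a cycle of \<sigma>
  immediately before \<open>w\<close>: the predecessor of \<open>w\<close> is sent to
  \<open>x\<close>, and \<open>x\<close> to \<open>w\<close>. All other arrows stay, so forgetting
  \<open>x\<close> gives back the old orbit. Both inclusions are closure arguments.\<close>

lemma orbit_transpose_comp:
  assumes fin: "finite A" and \<sigma>: "\<sigma> permutes A" and "x \<notin> A" "w \<in> A" "z \<in> A"
  shows "orbit (transposition x w \<circ> \<sigma>) z \<inter> A = orbit \<sigma> z"
proof -
  let ?\<rho> = "transposition x w \<circ> \<sigma>"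
  have pA: "permutation \<sigma>" using fin \<sigma> by (rule permutation_if_permutes)
  have \<rho>: "?\<rho> permutes insert x A"
    by (rule permutes_compose)
      (use assms in \<open>auto intro: permutes_subset permutes_swap_id\<close>)
  have pB: "permutation ?\<rho>" using permutation_if_permutes[OF _ \<rho>] fin by simp
  have x: "\<sigma> x = x" using \<sigma> \<open>x \<notin> A\<close> by (simp add: permutes_not_in)
  have inA: "\<sigma> y \<in> A \<longleftrightarrow> y \<in> A" for y using \<sigma> by (simp add: permutes_in_image)
  have "orbit \<sigma> z \<subseteq> orbit ?\<rho> z \<inter> A"
  proof (rule orbit_closed_subset)
    show "z \<in> orbit ?\<rho> z \<inter> A" using permutation_self_in_orbit[OF pB] \<open>z \<in> A\<close> by simp
  next
    fix y assume y: "y \<in> orbit ?\<rho> z \<inter> A"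
    have 1: "?\<rho> y \<in> orbit ?\<rho> z" using y orbit.step[of y ?\<rho> z] by blast
    show "\<sigma> y \<in> orbit ?\<rho> z \<inter> A"
    proof (cases "\<sigma> y = w")
      case True
      then have "x \<in> orbit ?\<rho> z" using 1 by simp
      then have "?\<rho> x \<in> orbit ?\<rho> z" by (rule orbit.step)
      then show ?thesis using True x \<open>w \<in> A\<close> by (simp add: Transposition.transpose_def)
    next
      case False
      moreover have "\<sigma> y \<noteq> x" using inA[of y] y \<open>x \<notin> A\<close> by auto
      ultimately show ?thesis using 1 inA y by (simp add: Transposition.transpose_def)
    qed
  qed
  \<comment> \<open>The bound admits \<open>x\<close> only together with \<open>w\<close>: since
    \<open>x\<close> is mapped to \<open>w\<close>, the set would not be closed otherwise.\<close>
  moreover have "orbit ?\<rho> z \<subseteq> orbit \<sigma> z \<union> (if w \<in> orbit \<sigma> z then {x} else {})"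
  proof (rule orbit_closed_subset)
    show "z \<in> orbit \<sigma> z \<union> (if w \<in> orbit \<sigma> z then {x} else {})"
      using permutation_self_in_orbit[OF pA] by simp
  next
    fix y assume "y \<in> orbit \<sigma> z \<union> (if w \<in> orbit \<sigma> z then {x} else {})"
    then consider "y \<in> orbit \<sigma> z" | "y = x" "w \<in> orbit \<sigma> z" by (auto split: if_splits)
    then show "?\<rho> y \<in> orbit \<sigma> z \<union> (if w \<in> orbit \<sigma> z then {x} else {})"
    proof cases
      case 1
      then have s: "\<sigma> y \<in> orbit \<sigma> z" by (rule orbit.step)
      have "\<sigma> y \<noteq> x" using s permutes_orbit_subset[OF \<sigma> \<open>z \<in> A\<close>] \<open>x \<notin> A\<close> by auto
      then show ?thesis using s by (cases "\<sigma> y = w") auto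
    next
      case 2 then show ?thesis using x by simp
    qed
  qed
  ultimately show ?thesis using permutes_orbit_subset[OF \<sigma> \<open>z \<in> A\<close>] \<open>x \<notin> A\<close> by (auto split: if_splits)
qed

text \<open>Inserting a point creates no cycle: intersection with \<open>A\<close> matches new
  cycles with old ones, and the cycle of \<open>x\<close> is among them because it contains
  \<open>w\<close>.\<close>

lemma cycles_on_transpose_comp:
  assumes fin: "finite A" and \<sigma>: "\<sigma> permutes A" and "x \<notin> A" "w \<in> A"
  shows "cycles_on (insert x A) (transposition x w \<circ> \<sigma>) = cycles_on A \<sigma>"
proof -
  let ?\<rho> = "transposition x w \<circ> \<sigma>"
  have pA: "permutation \<sigma>" using fin \<sigma> by (rule permutation_if_permutes)
  have \<rho>: "?\<rho> permutes insert x A"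
    by (rule permutes_compose)
      (use assms in \<open>auto intro: permutes_subset permutes_swap_id\<close>)
  have pB: "permutation ?\<rho>" using permutation_if_permutes[OF _ \<rho>] fin by simp
  have "\<sigma> x = x" using \<sigma> \<open>x \<notin> A\<close> by (simp add: permutes_not_in)
  then have "w \<in> orbit ?\<rho> x" using orbit.base[of ?\<rho> x] by simp
  then have "orbit ?\<rho> w = orbit ?\<rho> x" by (rule orbit_eq_if_mem[OF pB])
  then have eq: "orbit ?\<rho> ` insert x A = orbit ?\<rho> ` A" using \<open>w \<in> A\<close> by auto
  have "bij_betw (\<lambda>O'. O' \<inter> A) (orbit ?\<rho> ` A) (orbit \<sigma> ` A)"
    unfolding bij_betw_def
  proof
    show "(\<lambda>O'. O' \<inter> A) ` orbit ?\<rho> ` A = orbit \<sigma> ` A"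
      using orbit_transpose_comp[OF fin \<sigma> \<open>x \<notin> A\<close> \<open>w \<in> A\<close>] by (auto simp: image_iff)
    show "inj_on (\<lambda>O'. O' \<inter> A) (orbit ?\<rho> ` A)"
    proof (rule inj_onI)
      fix P Q assume "P \<in> orbit ?\<rho> ` A" "Q \<in> orbit ?\<rho> ` A" and PQ: "P \<inter> A = Q \<inter> A"
      then obtain y z where yz: "y \<in> A" "z \<in> A" "P = orbit ?\<rho> y" "Q = orbit ?\<rho> z" by auto
      have "y \<in> P" using yz permutation_self_in_orbit[OF pB] by simp
      then have "y \<in> Q" using PQ yz(1) by auto
      then show "P = Q" using orbit_eq_if_mem[OF pB] yz by simp
    qed
  qed
  then show ?thesis unfolding cycles_on_def eq by (rule bij_betw_same_card)
qed

lemma cycles_on_insert_fixed: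
  assumes fin: "finite A" and \<sigma>: "\<sigma> permutes A" and "x \<notin> A"
  shows "cycles_on (insert x A) \<sigma> = Suc (cycles_on A \<sigma>)"
proof -
  have "\<sigma> x = x" using \<sigma> \<open>x \<notin> A\<close> by (simp add: permutes_not_in)
  then have "orbit \<sigma> x = {x}" by (simp add: orbit_eq_singleton_iff)
  moreover have "orbit \<sigma> z \<noteq> {x}" if "z \<in> A" for z
    using permutes_orbit_subset[OF \<sigma> that] \<open>x \<notin> A\<close> by auto
  then have "{x} \<notin> orbit \<sigma> ` A" by force
  ultimately show ?thesis unfolding cycles_on_def using fin by simp
qed

lemma cycles_on_inv:
  assumes "finite A" "\<sigma> permutes A"
  shows "cycles_on A (inv \<sigma>) = cycles_on A \<sigma>"
  using orbit_inv_eq[OF permutation_if_permutes[OF assms]] by (simp add: cycles_on_def)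

text \<open>The inverse of this composite has the transposition on the left, and a permutation has
  the same orbits as its inverse.\<close>

lemma cycles_on_comp_transpose:
  assumes fin: "finite A" and \<sigma>: "\<sigma> permutes A" and "x \<notin> A" "w \<in> A"
  shows "cycles_on (insert x A) (\<sigma> \<circ> transposition x w) = cycles_on A \<sigma>"
proof -
  have \<rho>: "\<sigma> \<circ> transposition x w permutes insert x A"
    by (rule permutes_compose)
      (use assms in \<open>auto intro: permutes_subset permutes_swap_id\<close>)
  have "inv (\<sigma> \<circ> transposition x w) = transposition x w \<circ> inv \<sigma>"
    using \<sigma> by (simp add: o_inv_distrib permutes_bij)
  then have "cycles_on (insert x A) (\<sigma> \<circ> transposition x w) = cycles_on (insert x A) (transposition x w \<circ> inv \<sigma>)"
    using cycles_on_inv[OF _ \<rho>] fin by simp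
  also have "\<dots> = cycles_on A (inv \<sigma>)"
    using cycles_on_transpose_comp[OF fin permutes_inv[OF \<sigma>]] assms by simp
  also have "\<dots> = cycles_on A \<sigma>" using cycles_on_inv[OF fin \<sigma>] .
  finally show ?thesis .
qed

section \<open>Splitting an involution at a point\<close>

lemma finite_involutions: "finite A \<Longrightarrow> finite (involutions A)"
  unfolding involutions_def by (rule finite_subset[OF _ finite_permutations]) auto

lemma involutions_permutes: "\<tau> \<in> involutions A \<Longrightarrow> \<tau> permutes A"
  by (simp add: involutions_def)

lemma involutions_empty: "involutions {} = {id}"
  by (auto simp: involutions_def)

lemma involution_apply: "\<tau> \<in> involutions A \<Longrightarrow> \<tau> (\<tau> x) = x"
  by (auto simp: involutions_def fun_eq_iff)

lemma inv_involution: "\<tau> \<in> involutions A \<Longrightarrow> inv \<tau> = \<tau>"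
  by (auto simp: involutions_def intro: inv_unique_comp)

lemma involution_comp_transpose_commute:
  assumes "\<tau> permutes B" "x \<notin> B" "y \<notin> B"
  shows "\<tau> \<circ> transposition x y = transposition x y \<circ> \<tau>"
proof -
  have "\<tau> x = x" "\<tau> y = y" using assms by (simp_all add: permutes_not_in)
  moreover have "\<tau> z \<noteq> x \<and> \<tau> z \<noteq> y" if "z \<noteq> x" "z \<noteq> y" for z
    using that calculation permutes_inj[OF assms(1)] by (metis injD)
  ultimately show ?thesis
    by (intro ext) (simp add: Transposition.transpose_def)
qed

text \<open>Either \<open>x\<close> is fixed, or it is swapped with some \<open>y\<close>; that
  2-cycle is split off on the right, and what remains moves neither of the two points.\<close>

lemma involutions_insert:
  assumes "x \<notin> B"
  shows "involutions (insert x B) = involutions B \<union>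
    (\<Union>y\<in>B. (\<lambda>\<tau>. \<tau> \<circ> transposition x y) ` involutions (B - {y}))" (is "_ = _ \<union> ?R")
proof (intro equalityI subsetI)
  fix \<tau> assume t: "\<tau> \<in> involutions (insert x B)"
  then have p: "\<tau> permutes insert x B" and i: "\<And>z. \<tau> (\<tau> z) = z" and bij: "bij \<tau>"
    by (auto simp: involution_apply dest: involutions_permutes intro: permutes_bij)
  show "\<tau> \<in> involutions B \<union> ?R"
  proof (cases "\<tau> x = x")
    case True
    then have "\<tau> permutes B" using p assms
      by (auto intro: permutes_superset)
    then show ?thesis using t by (simp add: involutions_def)
  next
    case False
    define y where "y = \<tau> x"
    have y: "\<tau> x = y" "\<tau> y = x" "y \<noteq> x" using False i by (auto simp: y_def)
    have "y \<in> B" using y(1,3) permutes_in_image[OF p, of x] by auto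
    define \<tau>' where "\<tau>' = \<tau> \<circ> transposition x y"
    have ne: "\<tau> z \<noteq> x \<and> \<tau> z \<noteq> y" if "z \<noteq> x" "z \<noteq> y" for z
      using that y i by metis
    have e: "\<tau>' z = (if z = x then x else if z = y then y else \<tau> z)" for z
      using y by (simp add: \<tau>'_def Transposition.transpose_def)
    have ii: "\<tau>' (\<tau>' z) = z" for z
      using e ne i by (cases "z = x"; cases "z = y") auto
    have "\<tau>' permutes B - {y}"
      unfolding permutes_def
    proof (intro conjI allI impI)
      fix z assume "z \<notin> B - {y}"
      then show "\<tau>' z = z" using e permutes_not_in[OF p, of z] by auto
    next
      fix z show "\<exists>!v. \<tau>' v = z" by (metis ii)
    qed
    then have "\<tau>' \<in> involutions (B - {y})" using ii by (auto simp: involutions_def)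
    moreover have "\<tau> = \<tau>' \<circ> transposition x y" by (simp add: \<tau>'_def comp_assoc)
    ultimately show ?thesis using \<open>y \<in> B\<close> by blast
  qed
next
  fix \<tau> assume "\<tau> \<in> involutions B \<union> ?R"
  then show "\<tau> \<in> involutions (insert x B)"
  proof
    assume "\<tau> \<in> involutions B"
    then show ?thesis by (auto simp: involutions_def intro: permutes_subset)
  next
    assume "\<tau> \<in> ?R"
    then obtain y \<tau>' where y: "y \<in> B" "\<tau>' \<in> involutions (B - {y})" "\<tau> = \<tau>' \<circ> transposition x y" by auto
    have p: "\<tau>' permutes B - {y}" using y(2) by (rule involutions_permutes)
    have c: "\<tau>' \<circ> transposition x y = transposition x y \<circ> \<tau>'"
      by (rule involution_comp_transpose_commute[OF p]) (use assms in auto)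
    have "\<tau> permutes insert x B" unfolding y(3)
      by (rule permutes_compose)
        (use y(1) in \<open>auto intro: permutes_subset[OF p] permutes_swap_id\<close>)
    moreover have "\<tau> \<circ> \<tau> = (\<tau>' \<circ> \<tau>') \<circ> (transposition x y \<circ> transposition x y)"
      unfolding y(3) using c by (metis comp_assoc)
    then have "\<tau> \<circ> \<tau> = id" using y(2) by (simp add: involutions_def)
    ultimately show ?thesis by (simp add: involutions_def)
  qed
qed

text \<open>The pieces of \<open>involutions_insert\<close> are disjoint because the image of
  \<open>x\<close> tells them apart.\<close>

lemma sum_involutions_insert:
  assumes fin: "finite B" and "x \<notin> B"
  shows "sum f (involutions (insert x B)) = sum f (involutions B) +
    (\<Sum>y\<in>B. \<Sum>\<tau>\<in>involutions (B - {y}). f (\<tau> \<circ> transposition x y))"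
proof -
  let ?g = "\<lambda>y. (\<lambda>\<tau>. \<tau> \<circ> transposition x y) ` involutions (B - {y})"
  have apx: "(\<tau> \<circ> transposition x y) x = y" if "\<tau> \<in> involutions (B - {y})" for \<tau> y
    using involutions_permutes[OF that] by (simp add: permutes_not_in)
  have apx0: "\<tau> x = x" if "\<tau> \<in> involutions B" for \<tau>
    using involutions_permutes[OF that] \<open>x \<notin> B\<close> by (simp add: permutes_not_in)
  have finI: "finite (involutions (B - {y}))" for y using fin by (simp add: finite_involutions)
  have "sum f (involutions (insert x B)) = sum f (involutions B) + sum f (\<Union>y\<in>B. ?g y)"
    unfolding involutions_insert[OF \<open>x \<notin> B\<close>]
  proof (rule sum.union_disjoint)
    show "involutions B \<inter> (\<Union>y\<in>B. ?g y) = {}"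
      using apx apx0 \<open>x \<notin> B\<close> by fastforce
  qed (use fin finI in \<open>auto simp: finite_involutions\<close>)
  also have "sum f (\<Union>y\<in>B. ?g y) = (\<Sum>y\<in>B. sum f (?g y))"
  proof (rule sum.UNION_disjoint[OF fin])
    show "\<forall>y\<in>B. \<forall>z\<in>B. y \<noteq> z \<longrightarrow> ?g y \<inter> ?g z = {}"
    proof (intro ballI impI)
      fix y z :: 'a assume "y \<noteq> z"
      have "s x = v" if "s \<in> ?g v" for s v using that apx by auto
      then show "?g y \<inter> ?g z = {}" using \<open>y \<noteq> z\<close> by (metis (no_types, lifting) disjoint_iff)
    qed
  qed (use finI in auto)
  also have "\<dots> = (\<Sum>y\<in>B. \<Sum>\<tau>\<in>involutions (B - {y}). f (\<tau> \<circ> transposition x y))"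
  proof (rule sum.cong[OF refl])
    fix y
    have "inj_on (\<lambda>\<tau>. \<tau> \<circ> transposition x y) (involutions (B - {y}))"
      by (rule inj_onI) (metis comp_assoc comp_id transpose_comp_involutory)
    then show "sum f (?g y) = (\<Sum>\<tau>\<in>involutions (B - {y}). f (\<tau> \<circ> transposition x y))"
      by (simp add: sum.reindex)
  qed
  finally show ?thesis .
qed

text \<open>Two ground sets, because shortening a path leaves one involution on fewer points. The
  cases that occur are \<open>B = A\<close> and \<open>B\<close> equal to \<open>A\<close> without
  one point; in the latter \<tau>1 fixes that point, which is thus an end of a path.\<close>

definition involution_pair_sum :: "real \<Rightarrow> 'a set \<Rightarrow> 'a set \<Rightarrow> real" where
  "involution_pair_sum \<theta> B A =
     (\<Sum>\<tau>1\<in>involutions B. \<Sum>\<tau>2\<in>involutions A. \<theta> ^ cycles_on A (\<tau>2 \<circ> \<tau>1))"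

lemma involutions_mono: "B \<subseteq> A \<Longrightarrow> involutions B \<subseteq> involutions A"
  by (auto simp: involutions_def intro: permutes_subset)

lemma permutes_comp_involutions:
  "\<tau>1 \<in> involutions A \<Longrightarrow> \<tau>2 \<in> involutions A \<Longrightarrow> \<tau>2 \<circ> \<tau>1 permutes A"
  by (auto simp: involutions_def intro: permutes_compose)

text \<open>Inverting a product of involutions reverses it. This exchanges the roles of \<tau>1 and
  \<tau>2 when the other one has become the short one.\<close>

lemma cycles_on_involutions_swap:
  assumes "finite A" "\<tau>1 \<in> involutions A" "\<tau>2 \<in> involutions A"
  shows "cycles_on A (\<tau>2 \<circ> \<tau>1) = cycles_on A (\<tau>1 \<circ> \<tau>2)"
proof -
  have "inv (\<tau>2 \<circ> \<tau>1) = inv \<tau>1 \<circ> inv \<tau>2"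
    using assms(2,3) by (intro o_inv_distrib) (auto dest: involutions_permutes permutes_bij)
  then have "inv (\<tau>2 \<circ> \<tau>1) = \<tau>1 \<circ> \<tau>2" using assms(2,3) by (simp add: inv_involution)
  then show ?thesis using cycles_on_inv[OF assms(1) permutes_comp_involutions[OF assms(2,3)]] by simp
qed

lemma involution_pair_sum_empty: "involution_pair_sum \<theta> {} {} = 1"
  by (simp add: involution_pair_sum_def involutions_empty cycles_on_def)

text \<open>Look at \<tau>2 on the end vertex \<open>x\<close>. If it fixes \<open>x\<close>, then
  \<open>x\<close> is a component by itself and one cycle. If it joins \<open>x\<close> to
  \<open>w\<close>, deleting \<open>x\<close> keeps the number of cycles and makes \<open>w\<close>
  an end vertex, now unmatched by \<tau>2 instead of \<tau>1; inversion restores the order of the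
  arguments.\<close>

lemma involution_pair_sum_half_insert:
  assumes fin: "finite B" and x: "x \<notin> B"
  shows "involution_pair_sum \<theta> B (insert x B) =
    \<theta> * involution_pair_sum \<theta> B B + (\<Sum>w\<in>B. involution_pair_sum \<theta> (B - {w}) B)"
proof -
  have 1: "\<theta> ^ cycles_on (insert x B) (\<tau>2 \<circ> \<tau>1) = \<theta> * \<theta> ^ cycles_on B (\<tau>2 \<circ> \<tau>1)"
    if "\<tau>1 \<in> involutions B" "\<tau>2 \<in> involutions B" for \<tau>1 \<tau>2
    using cycles_on_insert_fixed[OF fin permutes_comp_involutions[OF that] x] by simp
  have 2: "cycles_on (insert x B) ((\<tau>2 \<circ> transposition x w) \<circ> \<tau>1) = cycles_on B (\<tau>1 \<circ> \<tau>2)"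
    if "\<tau>1 \<in> involutions B" "\<tau>2 \<in> involutions (B - {w})" "w \<in> B" for \<tau>1 \<tau>2 w
  proof -
    have t2: "\<tau>2 \<in> involutions B" using that involutions_mono[of "B - {w}" B] by auto
    have "\<tau>2 \<circ> transposition x w = transposition x w \<circ> \<tau>2"
      using involution_comp_transpose_commute[OF involutions_permutes[OF that(2)], of x w] x by simp
    then have "(\<tau>2 \<circ> transposition x w) \<circ> \<tau>1 = transposition x w \<circ> (\<tau>2 \<circ> \<tau>1)"
      by (simp add: comp_assoc)
    then have "cycles_on (insert x B) ((\<tau>2 \<circ> transposition x w) \<circ> \<tau>1) = cycles_on B (\<tau>2 \<circ> \<tau>1)"
      using cycles_on_transpose_comp[OF fin permutes_comp_involutions[OF that(1) t2] x that(3)] by simp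
    also have "\<dots> = cycles_on B (\<tau>1 \<circ> \<tau>2)" by (rule cycles_on_involutions_swap[OF fin that(1) t2])
    finally show ?thesis .
  qed
  have "involution_pair_sum \<theta> B (insert x B) = (\<Sum>\<tau>1\<in>involutions B.
      (\<Sum>\<tau>2\<in>involutions B. \<theta> * \<theta> ^ cycles_on B (\<tau>2 \<circ> \<tau>1)) +
      (\<Sum>w\<in>B. \<Sum>\<tau>2\<in>involutions (B - {w}). \<theta> ^ cycles_on B (\<tau>1 \<circ> \<tau>2)))"
    unfolding involution_pair_sum_def sum_involutions_insert[OF fin x]
    by (intro sum.cong arg_cong2[of _ _ _ _ "(+)"] refl arg_cong[of _ _ "\<lambda>k. \<theta> ^ k"] 1 2) auto
  also have "\<dots> = \<theta> * involution_pair_sum \<theta> B B +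
      (\<Sum>\<tau>1\<in>involutions B. \<Sum>w\<in>B. \<Sum>\<tau>2\<in>involutions (B - {w}). \<theta> ^ cycles_on B (\<tau>1 \<circ> \<tau>2))"
    by (simp add: involution_pair_sum_def sum.distrib sum_distrib_left)
  also have "(\<Sum>\<tau>1\<in>involutions B. \<Sum>w\<in>B. \<Sum>\<tau>2\<in>involutions (B - {w}). \<theta> ^ cycles_on B (\<tau>1 \<circ> \<tau>2))
     = (\<Sum>w\<in>B. involution_pair_sum \<theta> (B - {w}) B)"
    unfolding involution_pair_sum_def
    by (subst sum.swap, rule sum.cong[OF refl], subst sum.swap, rule refl)
  finally show ?thesis .
qed

text \<open>In graph terms, this conjugation shortens a path \<open>w, x, y, \<dots>\<close> by two vertices.\<close>

lemma involutions_conj_transposition: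
  assumes "w \<in> C" "y \<notin> C"
  shows "bij_betw (\<lambda>\<tau>. transposition w y \<circ> \<tau> \<circ> transposition w y)
    (involutions C) (involutions (insert y (C - {w})))"
proof -
  define g where "g = (\<lambda>\<tau>. transposition w y \<circ> \<tau> \<circ> transposition w y)"
  have gg: "g (g \<tau>) = \<tau>" for \<tau> by (simp add: g_def fun_eq_iff)
  have step: "g \<tau> \<in> involutions (transposition w y ` A)" if "\<tau> \<in> involutions A" for \<tau> A
  proof -
    have p: "\<tau> permutes A" and i: "\<And>z. \<tau> (\<tau> z) = z"
      using that by (auto simp: involution_apply dest: involutions_permutes)
    have ii: "g \<tau> (g \<tau> z) = z" for z by (simp add: g_def i)
    have "g \<tau> permutes transposition w y ` A"
      unfolding permutes_def
    proof (intro conjI allI impI)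
      fix z assume "z \<notin> transposition w y ` A"
      then have "transposition w y z \<notin> A" by (metis image_eqI transpose_involutory)
      then show "g \<tau> z = z" using permutes_not_in[OF p] by (simp add: g_def)
    next
      fix z show "\<exists>!v. g \<tau> v = z" by (metis ii)
    qed
    then show ?thesis using ii by (auto simp: involutions_def)
  qed
  have img: "transposition w y ` C = insert y (C - {w})"
    using assms by (auto simp: image_iff Transposition.transpose_def)
  have img': "transposition w y ` insert y (C - {w}) = C"
    using img by (metis image_comp transpose_comp_involutory image_id id_apply)
  show ?thesis
    unfolding g_def[symmetric]
  proof (rule bij_betw_byWitness[where f' = g])
    show "g ` involutions C \<subseteq> involutions (insert y (C - {w}))" using step[of _ C] img by auto
    show "g ` involutions (insert y (C - {w})) \<subseteq> involutions C"
      using step[of _ "insert y (C - {w})"] img' by auto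
  qed (use gg in auto)
qed

text \<open>The edge of \<tau>1 between \<open>x\<close> and \<open>y\<close> is given, and the
  terms are sorted by the image of \<open>x\<close> under \<tau>2. If \<tau>2 fixes
  \<open>x\<close>, deleting \<open>x\<close> makes \<open>y\<close> an end vertex. If \<tau>2 also
  joins \<open>x\<close> to \<open>y\<close>, the two form a closed component with two fixed points
  of the product, hence \<theta>^2. If \<tau>2 joins \<open>x\<close> to some \<open>w\<close> in
  \<open>C\<close>, then \<open>x\<close> and \<open>y\<close> are cut out and \<open>w\<close>
  inherits the \<tau>2-partner of \<open>y\<close>; every choice of \<open>w\<close> yields the same
  sum, hence \<open>card C\<close>.\<close>

lemma involution_pair_sum_fixed_edge:
  assumes fin: "finite C" and x: "x \<notin> C" and y: "y \<notin> C" and "x \<noteq> y"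
  shows "(\<Sum>\<tau>1\<in>involutions C. \<Sum>\<tau>2\<in>involutions (insert x (insert y C)).
      \<theta> ^ cycles_on (insert x (insert y C)) (\<tau>2 \<circ> (\<tau>1 \<circ> transposition x y)))
    = involution_pair_sum \<theta> C (insert y C) + (\<theta>\<^sup>2 + card C) * involution_pair_sum \<theta> C C"
proof -
  define D where "D = insert y C"
  let ?A = "insert x D"
  have finD: "finite D" and xD: "x \<notin> D" and yD: "y \<in> D" and Dy: "D - {y} = C"
    using fin x y \<open>x \<noteq> y\<close> by (auto simp: D_def)
  have fixed: "cycles_on ?A (\<tau>2 \<circ> (\<tau>1 \<circ> transposition x y)) = cycles_on D (\<tau>2 \<circ> \<tau>1)"
    if "\<tau>1 \<in> involutions C" "\<tau>2 \<in> involutions D" for \<tau>1 \<tau>2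
  proof -
    have "\<tau>1 \<in> involutions D" using that(1) involutions_mono[of C D] by (auto simp: D_def)
    from cycles_on_comp_transpose[OF finD permutes_comp_involutions[OF this that(2)] xD yD]
    show ?thesis by (simp add: comp_assoc)
  qed
  have closed: "cycles_on ?A ((\<tau>2 \<circ> transposition x y) \<circ> (\<tau>1 \<circ> transposition x y)) = cycles_on C (\<tau>2 \<circ> \<tau>1) + 2"
    if "\<tau>1 \<in> involutions C" "\<tau>2 \<in> involutions C" for \<tau>1 \<tau>2
  proof -
    have "\<tau>1 \<circ> transposition x y = transposition x y \<circ> \<tau>1"
      by (rule involution_comp_transpose_commute[OF involutions_permutes[OF that(1)] x y])
    then have "(\<tau>2 \<circ> transposition x y) \<circ> (\<tau>1 \<circ> transposition x y) = \<tau>2 \<circ> (transposition x y \<circ> transposition x y) \<circ> \<tau>1"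
      by (simp only: comp_assoc)
    then have e: "(\<tau>2 \<circ> transposition x y) \<circ> (\<tau>1 \<circ> transposition x y) = \<tau>2 \<circ> \<tau>1" by simp
    have p: "\<tau>2 \<circ> \<tau>1 permutes C" using that by (rule permutes_comp_involutions)
    then have pD: "\<tau>2 \<circ> \<tau>1 permutes D" by (rule permutes_subset) (auto simp: D_def)
    show ?thesis unfolding e
      using cycles_on_insert_fixed[OF finD pD xD] cycles_on_insert_fixed[OF fin p y] by (simp add: D_def)
  qed
  \<comment> \<open>The product turns out to be \<open>\<tau>2 \<circ> \<tau>1\<close> with
    \<open>x\<close> inserted before \<open>\<tau>2 w\<close> and then \<open>y\<close> inserted
    before \<open>w\<close>: two insertions, no new cycle.\<close>
  have extend: "cycles_on ?A ((transposition w y \<circ> \<tau>2 \<circ> transposition w y) \<circ> transposition x w \<circ> (\<tau>1 \<circ> transposition x y))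
      = cycles_on C (\<tau>2 \<circ> \<tau>1)"
    if t1: "\<tau>1 \<in> involutions C" and t2: "\<tau>2 \<in> involutions C" and w: "w \<in> C" for \<tau>1 \<tau>2 w
  proof -
    have wx: "w \<noteq> x" "w \<noteq> y" using w x y by auto
    have p2: "\<tau>2 permutes C" using t2 by (rule involutions_permutes)
    have c: "\<tau>1 \<circ> transposition x y = transposition x y \<circ> \<tau>1"
      by (rule involution_comp_transpose_commute[OF involutions_permutes[OF t1] x y])
    have tri: "transposition w y \<circ> (transposition x w \<circ> transposition x y) = transposition x w"
      using wx \<open>x \<noteq> y\<close> by (auto simp: fun_eq_iff Transposition.transpose_def)
    have conj: "\<tau>2 \<circ> transposition x w = transposition x (\<tau>2 w) \<circ> \<tau>2"
    proof
      fix z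
      have "\<tau>2 x = x" using p2 x by (simp add: permutes_not_in)
      moreover have "\<tau>2 z = \<tau>2 w \<longleftrightarrow> z = w" "\<tau>2 z = x \<longleftrightarrow> z = x"
        using permutes_inj[OF p2] \<open>\<tau>2 x = x\<close> by (metis injD)+
      ultimately show "(\<tau>2 \<circ> transposition x w) z = (transposition x (\<tau>2 w) \<circ> \<tau>2) z"
        by (simp add: Transposition.transpose_def)
    qed
    have uw: "\<tau>2 w \<in> C" using p2 w by (simp add: permutes_in_image)
    have "(transposition w y \<circ> \<tau>2 \<circ> transposition w y) \<circ> transposition x w \<circ> (\<tau>1 \<circ> transposition x y)
        = transposition w y \<circ> \<tau>2 \<circ> (transposition w y \<circ> (transposition x w \<circ> transposition x y)) \<circ> \<tau>1"
      by (simp only: c comp_assoc)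
    also have "\<dots> = transposition w y \<circ> (\<tau>2 \<circ> transposition x w) \<circ> \<tau>1" by (simp only: tri comp_assoc)
    also have "\<dots> = transposition y w \<circ> (transposition x (\<tau>2 w) \<circ> (\<tau>2 \<circ> \<tau>1))"
      by (simp only: conj comp_assoc transpose_commute[of w y])
    finally have e: "(transposition w y \<circ> \<tau>2 \<circ> transposition w y) \<circ> transposition x w \<circ> (\<tau>1 \<circ> transposition x y)
        = transposition y w \<circ> (transposition x (\<tau>2 w) \<circ> (\<tau>2 \<circ> \<tau>1))" .
    have p: "\<tau>2 \<circ> \<tau>1 permutes C" using t1 t2 by (rule permutes_comp_involutions)
    have p': "transposition x (\<tau>2 w) \<circ> (\<tau>2 \<circ> \<tau>1) permutes insert x C"
      by (rule permutes_compose)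
        (use p uw in \<open>auto intro: permutes_subset permutes_swap_id\<close>)
    have A: "?A = insert y (insert x C)" by (auto simp: D_def)
    show ?thesis unfolding e A
      using cycles_on_transpose_comp[OF _ p', of y w] cycles_on_transpose_comp[OF fin p x uw] fin y w \<open>x \<noteq> y\<close>
      by simp
  qed
  have inner: "(\<Sum>\<tau>2\<in>involutions ?A. \<theta> ^ cycles_on ?A (\<tau>2 \<circ> (\<tau>1 \<circ> transposition x y)))
     = (\<Sum>\<tau>2\<in>involutions D. \<theta> ^ cycles_on D (\<tau>2 \<circ> \<tau>1))
      + (\<theta>\<^sup>2 + card C) * (\<Sum>\<tau>2\<in>involutions C. \<theta> ^ cycles_on C (\<tau>2 \<circ> \<tau>1))" if t1: "\<tau>1 \<in> involutions C" for \<tau>1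
  proof -
    let ?f = "\<lambda>\<tau>2. \<theta> ^ cycles_on ?A (\<tau>2 \<circ> (\<tau>1 \<circ> transposition x y))"
    have "sum ?f (involutions ?A) = sum ?f (involutions D)
       + (\<Sum>w\<in>D. \<Sum>\<tau>\<in>involutions (D - {w}). ?f (\<tau> \<circ> transposition x w))"
      by (rule sum_involutions_insert[OF finD xD])
    also have "(\<Sum>w\<in>D. \<Sum>\<tau>\<in>involutions (D - {w}). ?f (\<tau> \<circ> transposition x w))
      = (\<Sum>\<tau>\<in>involutions C. ?f (\<tau> \<circ> transposition x y)) +
        (\<Sum>w\<in>C. \<Sum>\<tau>\<in>involutions (D - {w}). ?f (\<tau> \<circ> transposition x w))"
      using fin y Dy by (simp add: D_def)
    also have "sum ?f (involutions D) = (\<Sum>\<tau>2\<in>involutions D. \<theta> ^ cycles_on D (\<tau>2 \<circ> \<tau>1))"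
      by (intro sum.cong refl) (simp add: fixed[OF t1])
    also have "(\<Sum>\<tau>\<in>involutions C. ?f (\<tau> \<circ> transposition x y)) = (\<Sum>\<tau>2\<in>involutions C. \<theta>\<^sup>2 * \<theta> ^ cycles_on C (\<tau>2 \<circ> \<tau>1))"
      by (intro sum.cong refl) (simp add: closed[OF t1] power_add power2_eq_square)
    also have "(\<Sum>w\<in>C. \<Sum>\<tau>\<in>involutions (D - {w}). ?f (\<tau> \<circ> transposition x w))
      = (\<Sum>w\<in>C. \<Sum>\<tau>2\<in>involutions C. \<theta> ^ cycles_on C (\<tau>2 \<circ> \<tau>1))"
    proof (rule sum.cong[OF refl])
      fix w assume w: "w \<in> C"
      have Dw: "D - {w} = insert y (C - {w})" using w y by (auto simp: D_def)
      show "(\<Sum>\<tau>\<in>involutions (D - {w}). ?f (\<tau> \<circ> transposition x w)) = (\<Sum>\<tau>2\<in>involutions C. \<theta> ^ cycles_on C (\<tau>2 \<circ> \<tau>1))"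
        unfolding Dw sum.reindex_bij_betw[OF involutions_conj_transposition[OF w y], symmetric]
        by (intro sum.cong refl arg_cong[of _ _ "\<lambda>k. \<theta> ^ k"] extend[OF t1 _ w])
    qed
    finally show ?thesis by (simp only: sum_constant sum_distrib_left[symmetric] distrib_right)
  qed
  show ?thesis
    unfolding D_def[symmetric] involution_pair_sum_def
    by (simp add: inner sum.distrib sum_distrib_left)
qed

text \<open>Split by the image of \<open>x\<close> under \<tau>1: either \<open>x\<close> is an end
  vertex, or there is an edge to some \<open>y\<close>. The number \<open>real (card B) - 1\<close>
  is the size of \<open>B - {y}\<close>.\<close>

lemma involution_pair_sum_insert:
  assumes fin: "finite B" and x: "x \<notin> B"
  shows "involution_pair_sum \<theta> (insert x B) (insert x B) = involution_pair_sum \<theta> B (insert x B) +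
    (\<Sum>y\<in>B. involution_pair_sum \<theta> (B - {y}) B + (\<theta>\<^sup>2 + real (card B) - 1) * involution_pair_sum \<theta> (B - {y}) (B - {y}))"
proof -
  have "involution_pair_sum \<theta> (insert x B) (insert x B) = involution_pair_sum \<theta> B (insert x B) +
    (\<Sum>y\<in>B. \<Sum>\<tau>1\<in>involutions (B - {y}). \<Sum>\<tau>2\<in>involutions (insert x B).
      \<theta> ^ cycles_on (insert x B) (\<tau>2 \<circ> (\<tau>1 \<circ> transposition x y)))"
    unfolding involution_pair_sum_def
    by (subst sum_involutions_insert[OF fin x]) simp
  also have "(\<Sum>y\<in>B. \<Sum>\<tau>1\<in>involutions (B - {y}). \<Sum>\<tau>2\<in>involutions (insert x B).
      \<theta> ^ cycles_on (insert x B) (\<tau>2 \<circ> (\<tau>1 \<circ> transposition x y))) =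
    (\<Sum>y\<in>B. involution_pair_sum \<theta> (B - {y}) B + (\<theta>\<^sup>2 + real (card B) - 1) * involution_pair_sum \<theta> (B - {y}) (B - {y}))"
  proof (rule sum.cong[OF refl])
    fix y assume y: "y \<in> B"
    have B: "insert y (B - {y}) = B" using y by auto
    have "real (card (B - {y})) = real (card B) - 1"
      using fin y card_gt_0_iff[of B] by (auto simp: of_nat_diff)
    then show "(\<Sum>\<tau>1\<in>involutions (B - {y}). \<Sum>\<tau>2\<in>involutions (insert x B).
      \<theta> ^ cycles_on (insert x B) (\<tau>2 \<circ> (\<tau>1 \<circ> transposition x y)))
      = involution_pair_sum \<theta> (B - {y}) B + (\<theta>\<^sup>2 + real (card B) - 1) * involution_pair_sum \<theta> (B - {y}) (B - {y})"
      using involution_pair_sum_fixed_edge[of "B - {y}" x y \<theta>] fin x y unfolding B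
      by (auto simp: algebra_simps)
  qed
  finally show ?thesis .
qed

text \<open>Grouping the ordered pairs by their product absorbs the multiplicity
  \<open>invol\<close>.\<close>

lemma ewens_expectation_invol:
  "ewens_expectation \<theta> n (\<lambda>\<sigma>. real (invol n \<sigma>)) =
     involution_pair_sum \<theta> {1..n} {1..n} / pochhammer \<theta> n"
proof -
  let ?I = "involutions {1..n}" and ?S = "{\<sigma>. \<sigma> permutes {1..n}}"
  have finI: "finite ?I" by (simp add: finite_involutions)
  have inv: "real (invol n \<sigma>) = (\<Sum>p\<in>{p\<in>?I \<times> ?I. snd p \<circ> fst p = \<sigma>}. 1)" for \<sigma>
  proof -
    have "{(\<tau>1, \<tau>2). \<tau>1 permutes {1..n} \<and> \<tau>2 permutes {1..n} \<and>
       \<tau>1 \<circ> \<tau>1 = id \<and> \<tau>2 \<circ> \<tau>2 = id \<and> \<sigma> = \<tau>2 \<circ> \<tau>1} = {p\<in>?I \<times> ?I. snd p \<circ> fst p = \<sigma>}"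
      by (auto simp: involutions_def)
    then show ?thesis by (simp add: invol_def)
  qed
  have "(\<Sum>\<sigma>\<in>?S. \<theta> ^ num_cycles n \<sigma> * real (invol n \<sigma>)) =
    (\<Sum>\<sigma>\<in>?S. \<Sum>p\<in>{p\<in>?I \<times> ?I. snd p \<circ> fst p = \<sigma>}. \<theta> ^ cycles_on {1..n} (snd p \<circ> fst p))"
    unfolding inv sum_distrib_left
    by (intro sum.cong refl) (auto simp: num_cycles_def cycles_on_def)
  also have "\<dots> = (\<Sum>p\<in>?I \<times> ?I. \<theta> ^ cycles_on {1..n} (snd p \<circ> fst p))"
    using finI by (intro sum.group) (auto simp: finite_permutations permutes_comp_involutions)
  also have "\<dots> = involution_pair_sum \<theta> {1..n} {1..n}"
    unfolding involution_pair_sum_def by (simp add: sum.cartesian_product case_prod_unfold)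
  finally show ?thesis by (simp add: ewens_expectation_def)
qed

section \<open>The generating function\<close>

text \<open>In closed form these are the Laguerre polynomials L_n^(-1) at -\<theta>. The recurrence
  serves as definition because the differential equation and the study of the ratios both start from
  it.\<close>

fun exp_path_coeff :: "real \<Rightarrow> nat \<Rightarrow> real" where
  "exp_path_coeff \<theta> 0 = 1"
| "exp_path_coeff \<theta> (Suc 0) = \<theta>"
| "exp_path_coeff \<theta> (Suc (Suc n)) =
     ((2 * real n + 2 + \<theta>) * exp_path_coeff \<theta> (Suc n) - real n * exp_path_coeff \<theta> n) / real (Suc (Suc n))"

definition neg_binomial_coeff :: "real \<Rightarrow> nat \<Rightarrow> real" where
  "neg_binomial_coeff b n = pochhammer b n / fact n"

text \<open>The series (1 - z^2) powr (-b), padded with zeros so that \<open>invol_coeff\<close> is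
  an ordinary Cauchy product.\<close>

definition even_binomial_coeff :: "real \<Rightarrow> nat \<Rightarrow> real" where
  "even_binomial_coeff b n = (if even n then neg_binomial_coeff b (n div 2) else 0)"

definition invol_coeff :: "real \<Rightarrow> nat \<Rightarrow> real" where
  "invol_coeff \<theta> n = (\<Sum>i\<le>n. even_binomial_coeff (\<theta>\<^sup>2 / 2) i * exp_path_coeff \<theta> (n - i))"

lemma exp_path_coeff_recurrence:
  "real (Suc (Suc n)) * exp_path_coeff \<theta> (Suc (Suc n)) =
     (2 * real n + 2 + \<theta>) * exp_path_coeff \<theta> (Suc n) - real n * exp_path_coeff \<theta> n"
  by simp

declare exp_path_coeff.simps(3) [simp del]

lemma exp_path_ode:
  "(1 - fps_X)\<^sup>2 * fps_deriv (Abs_fps (exp_path_coeff \<theta>)) = fps_const \<theta> * Abs_fps (exp_path_coeff \<theta>)"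
    (is "?L = ?R")
proof (rule fps_ext)
  fix n
  have L: "?L = fps_deriv (Abs_fps (exp_path_coeff \<theta>)) - fps_const 2 * (fps_X * fps_deriv (Abs_fps (exp_path_coeff \<theta>)))
    + fps_X * (fps_X * fps_deriv (Abs_fps (exp_path_coeff \<theta>)))"
    by (simp add: power2_eq_square algebra_simps flip: numeral_fps_const)
  show "fps_nth ?L n = fps_nth ?R n"
  proof (cases n)
    case 0 then show ?thesis unfolding L by simp
  next
    case (Suc m)
    then show ?thesis unfolding L using exp_path_coeff_recurrence[of m \<theta>]
      by (cases m) (simp_all add: algebra_simps)
  qed
qed

lemma even_binomial_ode:
  "(1 - fps_X\<^sup>2) * fps_deriv (Abs_fps (even_binomial_coeff b)) = fps_const (2 * b) * fps_X * Abs_fps (even_binomial_coeff b)"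
    (is "?L = ?R")
proof (rule fps_ext)
  fix n
  have L: "?L = fps_deriv (Abs_fps (even_binomial_coeff b)) - fps_X * (fps_X * fps_deriv (Abs_fps (even_binomial_coeff b)))"
    by (simp add: power2_eq_square algebra_simps)
  show "fps_nth ?L n = fps_nth ?R n"
  proof (cases "even n")
    case True
    then show ?thesis unfolding L
      by (cases n; cases "n - 1") (auto simp: even_binomial_coeff_def neg_binomial_coeff_def mult.assoc)
  next
    case False
    then obtain k where k: "n = Suc (2 * k)" by (metis oddE Suc_eq_plus1)
    have "real (Suc n) * even_binomial_coeff b (Suc n) = 2 * (b + real k) * even_binomial_coeff b (2 * k)"
    proof -
      have "2 * r * (p * c / (r * f)) = 2 * c * (p / f)" if "r \<noteq> 0" for r p c f :: real
        using that by simp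
      from this[of "real k + 1" "pochhammer b k" "b + real k" "fact k"]
      show ?thesis unfolding k by (simp add: even_binomial_coeff_def neg_binomial_coeff_def pochhammer_Suc algebra_simps)
    qed
    moreover have "fps_nth ?L n = real (Suc n) * even_binomial_coeff b (Suc n) - real (2 * k) * even_binomial_coeff b (2 * k)"
      unfolding L k by (cases k) simp_all
    moreover have "fps_nth ?R n = 2 * b * even_binomial_coeff b (2 * k)"
      unfolding k by (simp add: mult.assoc)
    ultimately show ?thesis by (simp add: algebra_simps)
  qed
qed

text \<open>With F = Q E the logarithmic derivative is \<theta>^2 z / (1 - z^2) + \<theta> / (1 -
  z)^2. Multiplication by 1 - z^2 leaves a single factor 1 / (1 - z), called \<open>U\<close>, and
  \<open>U * F\<close> has the partial sums as coefficients. They match the lopsided sums of the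
  combinatorial recurrence.\<close>

lemma invol_coeff_recurrence:
  "invol_coeff \<theta> 0 = 1"
  "invol_coeff \<theta> (Suc 0) = \<theta> * invol_coeff \<theta> 0"
  "real (Suc (Suc n)) * invol_coeff \<theta> (Suc (Suc n)) =
    \<theta> * (\<Sum>j\<le>Suc n. invol_coeff \<theta> j) + \<theta> * (\<Sum>j\<le>n. invol_coeff \<theta> j) + (\<theta>\<^sup>2 + real n) * invol_coeff \<theta> n"
proof -
  define E where "E = Abs_fps (exp_path_coeff \<theta>)"
  define Q where "Q = Abs_fps (even_binomial_coeff (\<theta>\<^sup>2 / 2))"
  define F where "F = Abs_fps (invol_coeff \<theta>)"
  define U where "U = Abs_fps (\<lambda>_. 1 :: real)"
  have FQE: "F = Q * E"
    by (rule fps_ext) (simp add: F_def Q_def E_def fps_mult_nth invol_coeff_def atLeast0AtMost)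
  have U: "(1 - fps_X) * U = 1"
    by (rule fps_ext) (simp add: U_def left_diff_distrib)
  have SU: "fps_nth (U * F) n = (\<Sum>j\<le>n. invol_coeff \<theta> j)" for n
    by (subst mult.commute) (simp add: U_def F_def fps_mult_nth atLeast0AtMost)
  have 1: "(1 - fps_X)\<^sup>2 * fps_deriv E = fps_const \<theta> * E" unfolding E_def by (rule exp_path_ode)
  have 2: "(1 - fps_X\<^sup>2) * fps_deriv Q = fps_const (\<theta>\<^sup>2) * fps_X * Q"
    using even_binomial_ode[of "\<theta>\<^sup>2/2"] by (simp add: Q_def)
  have "U * ((1 - fps_X)\<^sup>2 * fps_deriv E) = ((1 - fps_X) * U) * ((1 - fps_X) * fps_deriv E)"
    by (simp only: power2_eq_square mult_ac)
  then have 3: "(1 - fps_X) * fps_deriv E = U * ((1 - fps_X)\<^sup>2 * fps_deriv E)" by (simp only: U mult_1)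
  have "(1 - fps_X\<^sup>2) * fps_deriv F = ((1 - fps_X\<^sup>2) * fps_deriv Q) * E
      + Q * ((1 + fps_X) * ((1 - fps_X) * fps_deriv E))"
    unfolding FQE by (simp add: algebra_simps power2_eq_square)
  also have "\<dots> = fps_const (\<theta>\<^sup>2) * fps_X * Q * E + Q * ((1 + fps_X) * (U * ((1 - fps_X)\<^sup>2 * fps_deriv E)))"
    unfolding 2 3 ..
  also have "\<dots> = fps_const (\<theta>\<^sup>2) * (fps_X * F) + fps_const \<theta> * (U * F) + fps_const \<theta> * (fps_X * (U * F))"
    unfolding 1 FQE by (simp add: algebra_simps)
  finally have "fps_deriv F - fps_X * (fps_X * fps_deriv F) =
      fps_const (\<theta>\<^sup>2) * (fps_X * F) + fps_const \<theta> * (U * F) + fps_const \<theta> * (fps_X * (U * F))"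
    by (simp add: algebra_simps power2_eq_square)
  then have *: "fps_nth (fps_deriv F - fps_X * (fps_X * fps_deriv F)) n =
     fps_nth (fps_const (\<theta>\<^sup>2) * (fps_X * F) + fps_const \<theta> * (U * F) + fps_const \<theta> * (fps_X * (U * F))) n" for n
    by simp
  show "invol_coeff \<theta> 0 = 1" by (simp add: invol_coeff_def even_binomial_coeff_def neg_binomial_coeff_def)
  show "invol_coeff \<theta> (Suc 0) = \<theta> * invol_coeff \<theta> 0" 
    by (simp add: invol_coeff_def even_binomial_coeff_def neg_binomial_coeff_def)
  show "real (Suc (Suc n)) * invol_coeff \<theta> (Suc (Suc n)) =
    \<theta> * (\<Sum>j\<le>Suc n. invol_coeff \<theta> j) + \<theta> * (\<Sum>j\<le>n. invol_coeff \<theta> j) + (\<theta>\<^sup>2 + real n) * invol_coeff \<theta> n"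
  proof -
    have Fn: "fps_nth F k = invol_coeff \<theta> k" for k by (simp add: F_def)
    have "fps_nth (fps_deriv F - fps_X * (fps_X * fps_deriv F)) (Suc n)
        = real (Suc (Suc n)) * invol_coeff \<theta> (Suc (Suc n)) - real n * invol_coeff \<theta> n"
      by (cases n) (simp_all add: Fn)
    moreover have "fps_nth (fps_const (\<theta>\<^sup>2) * (fps_X * F) + fps_const \<theta> * (U * F) + fps_const \<theta> * (fps_X * (U * F))) (Suc n)
        = \<theta>\<^sup>2 * invol_coeff \<theta> n + \<theta> * (\<Sum>j\<le>Suc n. invol_coeff \<theta> j) + \<theta> * (\<Sum>j\<le>n. invol_coeff \<theta> j)"
      by (simp add: SU Fn del: sum.atMost_Suc)
    ultimately show ?thesis using *[of "Suc n"] by (simp add: algebra_simps)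
  qed
qed

text \<open>Both sums are treated in one strong induction, since each recurrence refers to the
  other. Divided by the factorial, the lopsided one reads h_n = \<theta> z_n + h_(n-1), which is
  where the partial sums arise.\<close>

lemma involution_pair_sum_eq:
  assumes "finite A"
  shows "involution_pair_sum \<theta> A A = fact (card A) * invol_coeff \<theta> (card A) \<and>
    (\<forall>x. x \<notin> A \<longrightarrow> involution_pair_sum \<theta> A (insert x A) = \<theta> * fact (card A) * (\<Sum>j\<le>card A. invol_coeff \<theta> j))"
  using assms
proof (induction "card A" arbitrary: A rule: less_induct)
  case less
  define n where "n = card A"
  have half: "involution_pair_sum \<theta> (A - {w}) A = \<theta> * fact (n - 1) * (\<Sum>j\<le>n - 1. invol_coeff \<theta> j)"
    and full: "involution_pair_sum \<theta> (A - {w}) (A - {w}) = fact (n - 1) * invol_coeff \<theta> (n - 1)"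
    if "w \<in> A" for w
  proof -
    have c: "card (A - {w}) < card A" "card (A - {w}) = n - 1" "insert w (A - {w}) = A"
      using that less.prems card_Diff1_less[of A w] by (auto simp: n_def)
    have f: "finite (A - {w})" using less.prems by simp
    show "involution_pair_sum \<theta> (A - {w}) A = \<theta> * fact (n - 1) * (\<Sum>j\<le>n - 1. invol_coeff \<theta> j)"
      using less.hyps[OF c(1) f] c(2,3) by (metis DiffD2 singletonI)
    show "involution_pair_sum \<theta> (A - {w}) (A - {w}) = fact (n - 1) * invol_coeff \<theta> (n - 1)"
      using less.hyps[OF c(1) f] c(2) by simp
  qed
  have Z: "involution_pair_sum \<theta> A A = fact n * invol_coeff \<theta> n"
  proof (cases "A = {}")
    case True
    then show ?thesis by (simp add: n_def involution_pair_sum_empty invol_coeff_recurrence)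
  next
    case False
    then obtain x where x: "x \<in> A" by auto
    define B where "B = A - {x}"
    have B: "finite B" "x \<notin> B" "insert x B = A" "card B < card A" "card B = n - 1"
      using x less.prems card_Diff1_less[of A x] by (auto simp: B_def n_def)
    have n: "n \<ge> 1" using False less.prems by (simp add: n_def Suc_le_eq card_gt_0_iff)
    have sub: "involution_pair_sum \<theta> (B - {y}) B = \<theta> * fact (n - 2) * (\<Sum>j\<le>n - 2. invol_coeff \<theta> j) \<and>
      involution_pair_sum \<theta> (B - {y}) (B - {y}) = fact (n - 2) * invol_coeff \<theta> (n - 2)" if "y \<in> B" for y
    proof -
      have c: "card (B - {y}) < card A" "card (B - {y}) = n - 2" "insert y (B - {y}) = B"
        using that B card_Diff1_less[of B y] by auto
      have f: "finite (B - {y})" using B by simp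
      show ?thesis using less.hyps[OF c(1) f] c(2,3) by (metis DiffD2 singletonI)
    qed
    have H: "involution_pair_sum \<theta> B A = \<theta> * fact (n - 1) * (\<Sum>j\<le>n - 1. invol_coeff \<theta> j)"
      using half[OF x] by (simp add: B_def)
    have "involution_pair_sum \<theta> A A = involution_pair_sum \<theta> B A + (\<Sum>y\<in>B. \<theta> * fact (n - 2) * (\<Sum>j\<le>n - 2. invol_coeff \<theta> j)
       + (\<theta>\<^sup>2 + real (card B) - 1) * (fact (n - 2) * invol_coeff \<theta> (n - 2)))"
      using involution_pair_sum_insert[OF B(1,2), of \<theta>] sub unfolding B(3) by simp
    also have "\<dots> = \<theta> * fact (n - 1) * (\<Sum>j\<le>n - 1. invol_coeff \<theta> j) + real (n - 1) * (\<theta> * fact (n - 2) * (\<Sum>j\<le>n - 2. invol_coeff \<theta> j)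
       + (\<theta>\<^sup>2 + real (n - 1) - 1) * (fact (n - 2) * invol_coeff \<theta> (n - 2)))"
      by (simp add: H B(5))
    also have "\<dots> = fact n * invol_coeff \<theta> n"
    \<comment> \<open>For \<open>n = 1\<close> the factor \<open>real (n - 1)\<close> removes the
      terms with the truncated index \<open>n - 2\<close>.\<close>
    proof (cases "n = 1")
      case True then show ?thesis by (simp add: invol_coeff_recurrence(1,2))
    next
      case False
      then obtain m where m: "n = Suc (Suc m)" using n by (metis One_nat_def Suc_le_D Suc_le_mono not0_implies_Suc)
      have "fact n * invol_coeff \<theta> n = fact (Suc m) * (real (Suc (Suc m)) * invol_coeff \<theta> (Suc (Suc m)))"
        by (simp add: m)
      also have "\<dots> = fact (Suc m) * (\<theta> * (\<Sum>j\<le>Suc m. invol_coeff \<theta> j) + \<theta> * (\<Sum>j\<le>m. invol_coeff \<theta> j) + (\<theta>\<^sup>2 + real m) * invol_coeff \<theta> m)"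
        by (simp only: invol_coeff_recurrence(3))
      finally show ?thesis by (simp add: m algebra_simps)
    qed
    finally show ?thesis .
  qed
  have "involution_pair_sum \<theta> A (insert x A) = \<theta> * fact n * (\<Sum>j\<le>n. invol_coeff \<theta> j)" if "x \<notin> A" for x
  proof -
    have "involution_pair_sum \<theta> A (insert x A) = \<theta> * (fact n * invol_coeff \<theta> n) + real n * (\<theta> * fact (n - 1) * (\<Sum>j\<le>n - 1. invol_coeff \<theta> j))"
      unfolding involution_pair_sum_half_insert[OF less.prems that] by (simp add: Z half n_def)
    then show ?thesis by (cases n) (simp_all add: algebra_simps)
  qed
  then show ?case using Z by (simp add: n_def)
qed

lemma ewens_expectation_invol_eq:
  "ewens_expectation \<theta> n (\<lambda>\<sigma>. real (invol n \<sigma>)) = fact n * invol_coeff \<theta> n / pochhammer \<theta> n"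
  using involution_pair_sum_eq[of "{1..n}" \<theta>] by (simp add: ewens_expectation_invol)

section \<open>The exponential factor up to a constant\<close>

text \<open>n^(-3/2) is dominated by the differences of n^(-1/2), so the increments have a
  telescoping majorant. It yields the Cauchy property and, with the larger index sent to infinity,
  the rate.\<close>

lemma increments_powr_imp_LIMSEQ:
  fixes u :: "nat \<Rightarrow> real"
  assumes "(\<lambda>n. u (Suc n) - u n) \<in> O(\<lambda>n. real n powr (-3/2))"
  obtains l where "u \<longlonglongrightarrow> l" "(\<lambda>n. u n - l) \<in> O(\<lambda>n. real n powr (-1/2))"
proof -
  have "(\<lambda>n. real n powr (-3/2)) \<in> O(\<lambda>n. real n powr (-1/2) - real (Suc n) powr (-1/2))"
    by real_asymp
  then have "(\<lambda>n. u (Suc n) - u n) \<in> O(\<lambda>n. real n powr (-1/2) - real (Suc n) powr (-1/2))"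
    using assms landau_o.big_trans by blast
  then obtain c where c: "c > 0" "\<forall>\<^sub>F n in at_top. norm (u (Suc n) - u n) \<le> c * norm (real n powr (-1/2) - real (Suc n) powr (-1/2))"
    by (elim landau_o.bigE)
  have "\<forall>\<^sub>F n in at_top. real n powr (-1/2) - real (Suc n) powr (-1/2) \<ge> 0" by real_asymp
  with c(2) have "\<forall>\<^sub>F n in at_top. \<bar>u (Suc n) - u n\<bar> \<le> c * real n powr (-1/2) - c * real (Suc n) powr (-1/2)"
    by eventually_elim (simp add: algebra_simps)
  then obtain N where N: "\<And>n. n \<ge> N \<Longrightarrow> \<bar>u (Suc n) - u n\<bar> \<le> c * real n powr (-1/2) - c * real (Suc n) powr (-1/2)"
    by (auto simp: eventually_at_top_linorder)
  define v where "v = (\<lambda>n. c * real n powr (-1/2))"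
  have dist: "\<bar>u m - u n\<bar> \<le> v n - v m" if "N \<le> n" "n \<le> m" for n m
    using that(2)
  proof (induction rule: dec_induct)
    case (step k)
    then show ?case using N[of k] that(1) by (auto simp: v_def)
  qed simp
  have v0: "v \<longlonglongrightarrow> 0" unfolding v_def using c(1) by real_asymp
  have vpos: "v n \<ge> 0" for n using c(1) by (simp add: v_def)
  have "Cauchy u"
  proof (rule metric_CauchyI)
    fix e :: real assume "e > 0"
    then obtain M where M: "\<And>n. n \<ge> M \<Longrightarrow> v n < e"
      using order_tendstoD(2)[OF v0] by (auto simp: eventually_at_top_linorder)
    have *: "dist (u m) (u n) < e" if "n \<ge> max M N" "n \<le> m" for m n
      using dist[of n m] that vpos[of m] M[of n] by (simp add: dist_real_def)
    show "\<exists>M. \<forall>m\<ge>M. \<forall>n\<ge>M. dist (u m) (u n) < e"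
      using * by (intro exI[of _ "max M N"]) (metis dist_commute nle_le)
  qed
  then obtain l where l: "u \<longlonglongrightarrow> l" using Cauchy_convergent_iff convergent_def by blast
  have "\<bar>u n - l\<bar> \<le> v n" if "n \<ge> N" for n
  proof (rule tendsto_upperbound)
    show "(\<lambda>m. \<bar>u n - u m\<bar>) \<longlonglongrightarrow> \<bar>u n - l\<bar>" by (intro tendsto_intros l)
    show "\<forall>\<^sub>F m in sequentially. \<bar>u n - u m\<bar> \<le> v n"
      using eventually_ge_at_top[of n]
    proof eventually_elim
      case (elim m)
      then show ?case using dist[OF that elim] vpos[of m] by linarith
    qed
  qed simp
  then have "(\<lambda>n. u n - l) \<in> O(\<lambda>n. real n powr (-1/2))"
    by (intro bigoI[of _ c] eventually_mono[OF eventually_ge_at_top[of N]]) (simp add: v_def)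
  with l show ?thesis by (rule that)
qed

section \<open>The Riccati recurrence for the ratios of the coefficients\<close>

lemma exp_taylor_remainder_bigo:
  fixes f :: "nat \<Rightarrow> real"
  assumes "filterlim f (at 0) at_top"
  shows "(\<lambda>n. exp (f n) - (1 + f n + f n ^ 2 / 2 + f n ^ 3 / 6)) \<in> O(\<lambda>n. f n ^ 4)"
proof -
  have "(\<lambda>x::real. exp x - (1 + x + x^2/2 + x^3/6)) \<in> O[at 0](\<lambda>x. x^4)" by real_asymp
  from landau_o.big.compose[OF this assms] show ?thesis .
qed

text \<open>\<open>q n\<close> is the ratio of consecutive values of the model n^(-3/4) * exp (2 c
  sqrt n). Its exponentials are expanded in the increments \<open>d\<close>, \<open>d'\<close> of
  the square root, and the residual is collected by powers of \<open>c\<close>. As the increments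
  are about 1 / (2 sqrt n), fourth-order remainders times n are O(1 / n).\<close>

lemma model_riccati_residual:
  fixes c :: real
  assumes c: "c > 0"
  defines "q \<equiv> (\<lambda>n::nat. (real n / (real n - 1)) powr (-3/4) * exp (2 * c * (sqrt (real n) - sqrt (real n - 1))))"
  shows "(\<lambda>n. real n * q n - (2 * real n - 2 + c^2) + (real n - 2) / q (n - 1)) \<in> O(\<lambda>n. 1 / real n)"
proof -
  define r r' d d' where "r = (\<lambda>n::nat. (real n / (real n - 1)) powr (-3/4))"
    and "r' = (\<lambda>n::nat. ((real n - 1) / (real n - 2)) powr (-3/4))"
    and "d = (\<lambda>n::nat. sqrt (real n) - sqrt (real n - 1))"
    and "d' = (\<lambda>n::nat. sqrt (real n - 1) - sqrt (real n - 2))"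
  define R where "R = (\<lambda>x::real. exp x - (1 + x + x ^ 2 / 2 + x ^ 3 / 6))"
  have 0: "(\<lambda>n. real n * r n + (real n - 2) / r' n - (2 * real n - 2)) \<in> O(\<lambda>n. 1 / real n)"
    unfolding r_def r'_def by real_asymp
  \<comment> \<open>Here the exponent -3/4 is forced: any other one would leave a nonzero multiple
    of 1 / sqrt n.\<close>
  have 1: "(\<lambda>n. real n * r n * d n - (real n - 2) / r' n * d' n) \<in> O(\<lambda>n. 1 / real n)"
    unfolding r_def r'_def d_def d'_def by real_asymp
  \<comment> \<open>The two limits 1/4, multiplied by 2 c^2 below, produce the c^2 of the
    recurrence.\<close>
  have "(\<lambda>n. real n * r n * (d n * d n) - 1 / 4) \<in> O(\<lambda>n. 1 / real n)"
    "(\<lambda>n. (real n - 2) / r' n * (d' n * d' n) - 1 / 4) \<in> O(\<lambda>n. 1 / real n)"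
    unfolding r_def r'_def d_def d'_def by real_asymp+
  from sum_in_bigo(1)[OF this]
  have 2: "(\<lambda>n. (real n * r n * (d n * d n) - 1 / 4) + ((real n - 2) / r' n * (d' n * d' n) - 1 / 4)) \<in> O(\<lambda>n. 1 / real n)" .
  have 3: "(\<lambda>n. real n * r n * (d n * d n * d n) - (real n - 2) / r' n * (d' n * d' n * d' n)) \<in> O(\<lambda>n. 1 / real n)"
    unfolding r_def r'_def d_def d'_def by real_asymp
  have "filterlim (\<lambda>n. 2 * c * d n) (at 0) at_top" "filterlim (\<lambda>n. - 2 * c * d' n) (at 0) at_top"
    using c unfolding d_def d'_def by real_asymp+
  then have R: "(\<lambda>n. R (2 * c * d n)) \<in> O(\<lambda>n. (2 * c * d n) ^ 4)"
    "(\<lambda>n. R (- 2 * c * d' n)) \<in> O(\<lambda>n. (- 2 * c * d' n) ^ 4)"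
    unfolding R_def by (simp_all only: exp_taylor_remainder_bigo)
  have "(\<lambda>n. real n * r n * R (2 * c * d n)) \<in> O(\<lambda>n. real n * r n * (2 * c * d n) ^ 4)"
    by (intro landau_o.big.mult R landau_o.big_refl)
  also have "(\<lambda>n. real n * r n * (2 * c * d n) ^ 4) \<in> O(\<lambda>n. 1 / real n)"
    unfolding r_def d_def by (simp add: power_mult_distrib power4_eq_xxxx) real_asymp
  finally have 4: "(\<lambda>n. real n * r n * R (2 * c * d n)) \<in> O(\<lambda>n. 1 / real n)" .
  have "(\<lambda>n. (real n - 2) / r' n * R (- 2 * c * d' n)) \<in> O(\<lambda>n. (real n - 2) / r' n * (- 2 * c * d' n) ^ 4)"
    by (intro landau_o.big.mult R landau_o.big_refl)
  also have "(\<lambda>n. (real n - 2) / r' n * (- 2 * c * d' n) ^ 4) \<in> O(\<lambda>n. 1 / real n)"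
    unfolding r'_def d'_def by (simp add: power_mult_distrib power4_eq_xxxx) real_asymp
  finally have 5: "(\<lambda>n. (real n - 2) / r' n * R (- 2 * c * d' n)) \<in> O(\<lambda>n. 1 / real n)" .
  have "(\<lambda>n. (real n * r n + (real n - 2) / r' n - (2 * real n - 2))
      + (2 * c) * (real n * r n * d n - (real n - 2) / r' n * d' n)
      + (2 * c ^ 2) * ((real n * r n * (d n * d n) - 1 / 4) + ((real n - 2) / r' n * (d' n * d' n) - 1 / 4))
      + (4 * c ^ 3 / 3) * (real n * r n * (d n * d n * d n) - (real n - 2) / r' n * (d' n * d' n * d' n))
      + real n * r n * R (2 * c * d n) + (real n - 2) / r' n * R (- 2 * c * d' n)) \<in> O(\<lambda>n. 1 / real n)" (is "?S \<in> _")
    by (intro sum_in_bigo(1) landau_o.big.cmult_in_iff[THEN iffD2] 0 1 2 3 4 5) (use c in auto)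
  also have "?this \<longleftrightarrow> ?thesis"
  proof (rule landau_o.big.in_cong)
    show "\<forall>\<^sub>F n in at_top. ?S n = real n * q n - (2 * real n - 2 + c^2) + (real n - 2) / q (n - 1)"
      using eventually_ge_at_top[of 3]
    proof eventually_elim
      case (elim n)
      define W where "W = (real n - 2) / r' n"
      have 1: "q n = r n * (R (2 * c * d n) + (1 + 2 * c * d n + (2 * c * d n) ^ 2 / 2 + (2 * c * d n) ^ 3 / 6))"
        by (simp add: q_def r_def d_def R_def)
      have "q (n - 1) = r' n * exp (2 * c * d' n)"
        using elim by (simp add: q_def r'_def d'_def of_nat_diff)
      then have "(real n - 2) / q (n - 1) = W * exp (- (2 * c * d' n))"
        by (simp only: W_def exp_minus inverse_eq_divide) simp
      also have "exp (- (2 * c * d' n)) = R (- 2 * c * d' n) + (1 + (- 2 * c * d' n) + (- 2 * c * d' n) ^ 2 / 2 + (- 2 * c * d' n) ^ 3 / 6)"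
        by (simp add: R_def)
      finally have 2: "(real n - 2) / q (n - 1) = W * (R (- 2 * c * d' n) + (1 + (- 2 * c * d' n) + (- 2 * c * d' n) ^ 2 / 2 + (- 2 * c * d' n) ^ 3 / 6))" .
      show ?case unfolding 1 2 W_def[symmetric]
        by (simp add: algebra_simps power2_eq_square power3_eq_cube add_divide_distrib)
    qed
  qed
  finally show ?thesis .
qed

text \<open>Monotonicity starts at 1, since the first two values are 1 and \<theta>, and \<theta>
  may be below 1. The induction survives this because the recurrence multiplies the older value by
  \<open>real n\<close>, which is 0 there.\<close>

lemma exp_path_coeff_pos_mono:
  assumes "\<theta> > 0"
  shows "exp_path_coeff \<theta> n > 0 \<and> exp_path_coeff \<theta> (Suc n) > 0 \<and> (n > 0 \<longrightarrow> exp_path_coeff \<theta> n \<le> exp_path_coeff \<theta> (Suc n))"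
proof (induction n)
  case 0 then show ?case using assms by simp
next
  case (Suc n)
  let ?e = "exp_path_coeff \<theta>"
  have "real n * ?e n \<le> real n * ?e (Suc n)" using Suc by (cases n) auto
  then have "real (Suc (Suc n)) * ?e (Suc (Suc n)) \<ge> (real n + 2 + \<theta>) * ?e (Suc n)"
    using exp_path_coeff_recurrence[of n \<theta>] by (simp add: algebra_simps)
  also have "(real n + 2 + \<theta>) * ?e (Suc n) \<ge> real (Suc (Suc n)) * ?e (Suc n)"
    using Suc assms by (intro mult_right_mono) auto
  finally have "?e (Suc n) \<le> ?e (Suc (Suc n))" by simp
  then show ?case using Suc by auto
qed

text \<open>The ratios \<open>\<rho>\<close> of consecutive coefficients satisfy a Riccati recurrence which contracts
  by the factor \<open>1 - c / sqrt n\<close>; this beats the residual \<open>1 / n\<^sup>2\<close> of the model ratios \<open>q\<close>.\<close>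

lemma riccati_contraction:
  fixes \<rho> q :: "nat \<Rightarrow> real"
  assumes c: "c > 0"
    and \<rho>: "\<And>n. n \<ge> 3 \<Longrightarrow> real n * \<rho> n = 2 * real n - 2 + \<theta> - (real n - 2) / \<rho> (n - 1)"
    and \<rho>1: "\<And>n. n \<ge> 2 \<Longrightarrow> \<rho> n \<ge> 1"
    and q: "(\<lambda>n. real n * q n - (2 * real n - 2 + \<theta>) + (real n - 2) / q (n - 1)) \<in> O(\<lambda>n. 1 / real n)"
    and q1: "\<forall>\<^sub>F n in at_top. q n \<ge> 1" "\<forall>\<^sub>F n in at_top. 1 / q (n - 1) \<le> 1 - c / sqrt (real n)"
  shows "(\<lambda>n. \<rho> n - q n) \<in> O(\<lambda>n. real n powr (-3/2))"
proof -
  obtain K where K: "K > 0" "\<forall>\<^sub>F n in at_top. norm (real n * q n - (2 * real n - 2 + \<theta>) + (real n - 2) / q (n - 1)) \<le> K * norm (1 / real n)"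
    using q by (elim landau_o.bigE)
  \<comment> \<open>Passing from n - 1 to n changes n^(-3/2) only by a relative amount of order 1 /
    n, so half of the contraction c / sqrt n survives.\<close>
  have dec: "\<forall>\<^sub>F n in at_top. (1 - c / sqrt (real n)) * real (n - 1) powr (-3/2) \<le> (1 - c / (2 * sqrt (real n))) * real n powr (-3/2)"
    using c by real_asymp
  have small: "\<forall>\<^sub>F n in at_top. c / sqrt (real n) \<le> 1" using c by real_asymp
  from K(2) q1 dec small eventually_ge_at_top[of 3]
  have "\<forall>\<^sub>F n in at_top. \<bar>real n * q n - (2 * real n - 2 + \<theta>) + (real n - 2) / q (n - 1)\<bar> \<le> K / real n
     \<and> q n \<ge> 1 \<and> 1 / q (n - 1) \<le> 1 - c / sqrt (real n) \<and>
     (1 - c / sqrt (real n)) * real (n - 1) powr (-3/2) \<le> (1 - c / (2 * sqrt (real n))) * real n powr (-3/2)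
     \<and> c / sqrt (real n) \<le> 1 \<and> n \<ge> 3"
    by eventually_elim simp
  then obtain N where N: "\<And>n. n \<ge> N \<Longrightarrow> \<bar>real n * q n - (2 * real n - 2 + \<theta>) + (real n - 2) / q (n - 1)\<bar> \<le> K / real n
     \<and> q n \<ge> 1 \<and> 1 / q (n - 1) \<le> 1 - c / sqrt (real n) \<and>
     (1 - c / sqrt (real n)) * real (n - 1) powr (-3/2) \<le> (1 - c / (2 * sqrt (real n))) * real n powr (-3/2)
     \<and> c / sqrt (real n) \<le> 1 \<and> n \<ge> 3"
    by (auto simp: eventually_at_top_linorder)
  have step_bound: "\<bar>\<rho> n - q n\<bar> \<le> (1 - c / sqrt (real n)) * \<bar>\<rho> (n - 1) - q (n - 1)\<bar> + K / real n ^ 2" if "n > N" for n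
  proof -
    note Nn = N[of n, OF less_imp_le[OF that]]
    have n3: "n \<ge> 3" using Nn by blast
    have qm: "q (n - 1) \<ge> 1" using N[of "n - 1"] that by simp
    have rm: "\<rho> (n - 1) \<ge> 1" using \<rho>1[of "n - 1"] n3 by simp
    define D where "D = real n * q n - (2 * real n - 2 + \<theta>) + (real n - 2) / q (n - 1)"
    have "real n * (\<rho> n - q n) = (real n - 2) * (1 / q (n - 1) - 1 / \<rho> (n - 1)) - D"
      using \<rho>[OF n3] by (simp add: D_def algebra_simps)
    also have "1 / q (n - 1) - 1 / \<rho> (n - 1) = (1 / q (n - 1)) * (1 / \<rho> (n - 1)) * (\<rho> (n - 1) - q (n - 1))"
      using qm rm by (simp add: field_simps)
    finally have "real n * \<bar>\<rho> n - q n\<bar> = \<bar>(real n - 2) * ((1 / q (n - 1)) * (1 / \<rho> (n - 1)) * (\<rho> (n - 1) - q (n - 1))) - D\<bar>"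
      by (metis abs_mult abs_of_nat)
    also have "\<dots> \<le> \<bar>(real n - 2) * ((1 / q (n - 1)) * (1 / \<rho> (n - 1)) * (\<rho> (n - 1) - q (n - 1)))\<bar> + \<bar>D\<bar>"
      by (rule abs_triangle_ineq4)
    also have "\<bar>(real n - 2) * ((1 / q (n - 1)) * (1 / \<rho> (n - 1)) * (\<rho> (n - 1) - q (n - 1)))\<bar>
       = (real n - 2) * ((1 / q (n - 1)) * (1 / \<rho> (n - 1)) * \<bar>\<rho> (n - 1) - q (n - 1)\<bar>)"
      using n3 qm rm by (simp add: abs_mult)
    \<comment> \<open>Only the factor \<open>1 / q (n - 1)\<close> contracts;
      \<open>1 / \<rho> (n - 1)\<close> is merely bounded by 1.\<close>
    also have "\<dots> \<le> real n * ((1 - c / sqrt (real n)) * 1 * \<bar>\<rho> (n - 1) - q (n - 1)\<bar>)"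
      using n3 qm rm Nn by (intro mult_mono mult_nonneg_nonneg) (auto simp: divide_le_eq_1)
    also have "\<bar>D\<bar> \<le> K / real n" using Nn by (simp add: D_def)
    finally have "real n * \<bar>\<rho> n - q n\<bar> \<le> real n * ((1 - c / sqrt (real n)) * \<bar>\<rho> (n - 1) - q (n - 1)\<bar> + K / real n ^ 2)"
      using n3 by (simp add: algebra_simps power2_eq_square)
    then show ?thesis using n3 by (simp add: mult_le_cancel_left)
  qed
  \<comment> \<open>The first entry lets the surviving contraction, worth L c / (2 n^2), absorb the
    residual K / n^2; the second starts the induction.\<close>
  define L where "L = max (2 * K / c) (\<bar>\<rho> N - q N\<bar> / real N powr (-3/2))"
  have bound: "\<bar>\<rho> n - q n\<bar> \<le> L * real n powr (-3/2)" if "n \<ge> N" for n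
    using that
  proof (induction rule: dec_induct)
    case base
    have "real N powr (-3/2) > 0" using N[of N] by auto
    moreover have "\<bar>\<rho> N - q N\<bar> / real N powr (-3/2) \<le> L" by (simp add: L_def)
    ultimately show ?case by (simp add: divide_le_eq)
  next
    case (step n)
    note Nn = N[of "Suc n"]
    have L0: "L \<ge> 0" "2 * K / c \<le> L" using K(1) c by (auto simp: L_def le_max_iff_disj)
    have p: "real (Suc n) powr (-3/2) / sqrt (real (Suc n)) = 1 / real (Suc n) ^ 2"
    proof -
      have "real (Suc n) powr (-3/2) / real (Suc n) powr (1/2) = real (Suc n) powr (- real 2)"
        by (simp only: powr_diff[symmetric]) simp
      also have "\<dots> = 1 / real (Suc n) ^ 2"
        by (simp only: powr_minus powr_realpow of_nat_0_less_iff zero_less_Suc inverse_eq_divide)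
      finally show ?thesis by (simp only: powr_half_sqrt of_nat_0_le_iff)
    qed
    have 1: "\<bar>\<rho> (Suc n) - q (Suc n)\<bar> \<le> (1 - c / sqrt (real (Suc n))) * \<bar>\<rho> n - q n\<bar> + K / real (Suc n) ^ 2"
      using step_bound[of "Suc n"] step.hyps by simp
    have "(1 - c / sqrt (real (Suc n))) * \<bar>\<rho> n - q n\<bar> \<le> (1 - c / sqrt (real (Suc n))) * (L * real n powr (-3/2))"
      using step.IH Nn step(1) by (intro mult_left_mono) auto
    also have "\<dots> = L * ((1 - c / sqrt (real (Suc n))) * real (Suc n - 1) powr (-3/2))" by simp
    also have "\<dots> \<le> L * ((1 - c / (2 * sqrt (real (Suc n)))) * real (Suc n) powr (-3/2))"
      using Nn step(1) L0 by (intro mult_left_mono) auto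
    also have "\<dots> = L * real (Suc n) powr (-3/2) - L * c / 2 * (real (Suc n) powr (-3/2) / sqrt (real (Suc n)))"
      by (simp add: algebra_simps)
    also have "\<dots> = L * real (Suc n) powr (-3/2) - L * c / 2 * (1 / real (Suc n) ^ 2)" by (simp only: p)
    finally have "(1 - c / sqrt (real (Suc n))) * \<bar>\<rho> n - q n\<bar> \<le> L * real (Suc n) powr (-3/2) - L * c / 2 * (1 / real (Suc n) ^ 2)" .
    moreover have "L * c / 2 * (1 / real (Suc n) ^ 2) \<ge> K * (1 / real (Suc n) ^ 2)"
      using L0(2) c by (intro mult_right_mono) (auto simp: field_simps)
    ultimately show ?case using 1 by simp
  qed
  show ?thesis
    by (intro bigoI[of _ L] eventually_mono[OF eventually_ge_at_top[of N]]) (use bound in auto)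
qed

lemma abs_ln_diff_le:
  fixes x y :: real
  assumes "x \<ge> 1" "y \<ge> 1"
  shows "\<bar>ln x - ln y\<bar> \<le> \<bar>x - y\<bar>"
proof -
  have *: "ln a - ln b \<le> a - b" if "b \<le> a" "b \<ge> 1" for a b :: real
  proof -
    have "ln a - ln b = ln (a / b)" using that by (simp add: ln_div)
    also have "\<dots> \<le> a / b - 1" using that by (intro ln_le_minus_one) auto
    also have "\<dots> = (a - b) / b" using that by (simp add: field_simps)
    also have "\<dots> \<le> a - b" using that by (simp add: divide_le_eq mult_le_cancel_left1)
    finally show ?thesis .
  qed
  show ?thesis
  proof (cases "x \<le> y")
    case True
    then have "ln x \<le> ln y" using assms by simp
    then show ?thesis using *[of x y] True assms by simp
  next
    case False
    then have "ln y \<le> ln x" using assms by simp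
    then show ?thesis using *[of y x] False assms by simp
  qed
qed

text \<open>The increments of \<open>u\<close> are differences of logarithms of true and model
  ratios. Both ratios are eventually at least 1, where ln is 1-Lipschitz, so the contraction
  estimate makes the increments summable. The argument gives no access to the value of
  \<open>l\<close>.\<close>

lemma exp_path_coeff_asymp:
  assumes "\<theta> > 0"
  obtains l where
    "(\<lambda>n. ln (exp_path_coeff \<theta> n) - (2 * sqrt (\<theta> * real n) - 3 / 4 * ln (real n)) - l) \<in> O(\<lambda>n. real n powr (-1/2))"
proof -
  define e where "e = exp_path_coeff \<theta>"
  define c where "c = sqrt \<theta>"
  have c: "c > 0" "c\<^sup>2 = \<theta>" using assms by (auto simp: c_def)
  define q where "q = (\<lambda>n::nat. (real n / (real n - 1)) powr (-3/4) * exp (2 * c * (sqrt (real n) - sqrt (real n - 1))))"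
  define \<rho> where "\<rho> = (\<lambda>n. e n / e (n - 1))"
  have epos: "e n > 0" for n using exp_path_coeff_pos_mono[OF assms] by (simp add: e_def)
  have \<rho>1: "\<rho> n \<ge> 1" if "n \<ge> 2" for n
    using exp_path_coeff_pos_mono[OF assms, of "n - 1"] that by (simp add: \<rho>_def e_def)
  have \<rho>: "real n * \<rho> n = 2 * real n - 2 + \<theta> - (real n - 2) / \<rho> (n - 1)" if "n \<ge> 3" for n
  proof -
    define m where "m = n - 2"
    have m: "n = Suc (Suc m)" using that by (simp add: m_def)
    have "real n * e n = (2 * real n - 2 + \<theta>) * e (n - 1) - (real n - 2) * e (n - 2)"
      using exp_path_coeff_recurrence[of m \<theta>] by (simp add: m e_def algebra_simps)
    then have "real n * e n / e (n - 1) = (2 * real n - 2 + \<theta>) - (real n - 2) * e (n - 2) / e (n - 1)"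
      using epos[of "n - 1"] by (simp add: diff_divide_distrib)
    then show ?thesis by (simp add: \<rho>_def m)
  qed
  \<comment> \<open>\<open>1 / q (n - 1)\<close> is about 1 - c / sqrt n; halving the constant makes
    this an inequality that holds eventually.\<close>
  have q1: "\<forall>\<^sub>F n in at_top. q n \<ge> 1" "\<forall>\<^sub>F n in at_top. 1 / q (n - 1) \<le> 1 - (c / 2) / sqrt (real n)"
  proof -
    show "\<forall>\<^sub>F n in at_top. q n \<ge> 1" unfolding q_def using c(1) by real_asymp
    have "\<forall>\<^sub>F n in at_top. 1 / (((real n - 1) / (real n - 2)) powr (-3/4) * exp (2 * c * (sqrt (real n - 1) - sqrt (real n - 2)))) \<le> 1 - (c / 2) / sqrt (real n)"
      using c(1) by real_asymp
    then show "\<forall>\<^sub>F n in at_top. 1 / q (n - 1) \<le> 1 - (c / 2) / sqrt (real n)"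
      using eventually_ge_at_top[of 1] by eventually_elim (simp add: q_def of_nat_diff)
  qed
  have "(\<lambda>n. \<rho> n - q n) \<in> O(\<lambda>n. real n powr (-3/2))"
    by (rule riccati_contraction[of "c / 2", OF _ \<rho> \<rho>1 _ q1])
      (use c model_riccati_residual[of c] in \<open>auto simp: q_def\<close>)
  then have diff: "(\<lambda>n. \<rho> (Suc n) - q (Suc n)) \<in> O(\<lambda>n. real (Suc n) powr (-3/2))"
    by (rule landau_o.big.compose) (rule filterlim_Suc)
  define u where "u = (\<lambda>n. ln (e n) - (2 * sqrt (\<theta> * real n) - 3 / 4 * ln (real n)))"
  have "(\<lambda>n. u (Suc n) - u n) \<in> O(\<lambda>n. \<rho> (Suc n) - q (Suc n))"
  proof (rule bigoI[of _ 1])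
    have "\<forall>\<^sub>F n in at_top. q (Suc n) \<ge> 1"
      using q1(1) by (rule eventually_compose_filterlim) (rule filterlim_Suc)
    then show "\<forall>\<^sub>F n in at_top. norm (u (Suc n) - u n) \<le> 1 * norm (\<rho> (Suc n) - q (Suc n))"
      using eventually_ge_at_top[of 1]
    proof eventually_elim
      case (elim n)
      have "ln (\<rho> (Suc n)) = ln (e (Suc n)) - ln (e n)"
        using epos[of n] epos[of "Suc n"] by (simp add: \<rho>_def ln_div)
      moreover have "ln (q (Suc n)) = 2 * sqrt (\<theta> * real (Suc n)) - 2 * sqrt (\<theta> * real n) - 3 / 4 * (ln (real (Suc n)) - ln (real n))"
      proof -
        have [simp]: "real (Suc n) - 1 = real n" by simp
        show ?thesis using elim(2) by (simp add: q_def ln_mult ln_powr ln_div c_def real_sqrt_mult right_diff_distrib del: of_nat_Suc)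
      qed
      ultimately have "u (Suc n) - u n = ln (\<rho> (Suc n)) - ln (q (Suc n))" by (simp add: u_def algebra_simps)
      then show ?case using abs_ln_diff_le[OF \<rho>1[of "Suc n"] elim(1)] elim(2) by simp
    qed
  qed
  also note diff
  also have "(\<lambda>n. real (Suc n) powr (-3/2)) \<in> O(\<lambda>n. real n powr (-3/2))" by real_asymp
  finally obtain l where "(\<lambda>n. u n - l) \<in> O(\<lambda>n. real n powr (-1/2))"
    by (rule increments_powr_imp_LIMSEQ)
  then show ?thesis by (intro that[of l]) (simp add: u_def e_def)
qed

section \<open>Convolution with a binomial series\<close>

text \<open>The index \<open>n - d * j\<close> of a convolution can be small however large n is, so
  an eventual bound is not enough; the finitely many early indices are paid for in the
  constant.\<close>

lemma bigo_nat_all: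
  fixes f :: "nat \<Rightarrow> real"
  assumes "f \<in> O(g)" "\<And>n. n \<ge> 1 \<Longrightarrow> g n > 0"
  obtains K where "K > 0" "\<And>n. n \<ge> 1 \<Longrightarrow> \<bar>f n\<bar> \<le> K * g n"
proof -
  obtain c where c: "c > 0" "\<forall>\<^sub>F n in at_top. norm (f n) \<le> c * norm (g n)"
    using assms(1) by (elim landau_o.bigE)
  then obtain N where N: "\<And>n. n \<ge> N \<Longrightarrow> \<bar>f n\<bar> \<le> c * \<bar>g n\<bar>"
    by (auto simp: eventually_at_top_linorder)
  define K where "K = c + (\<Sum>n<N. \<bar>f n\<bar> / \<bar>g n\<bar>)"
  have cK: "c \<le> K" by (simp add: K_def sum_nonneg)
  show ?thesis
  proof (rule that[of K])
    show "K > 0" using c(1) cK by simp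
    fix n :: nat assume n: "n \<ge> 1"
    show "\<bar>f n\<bar> \<le> K * g n"
    proof (cases "n \<ge> N")
      case True
      have "\<bar>f n\<bar> \<le> c * g n" using N[OF True] assms(2)[OF n] by simp
      also have "\<dots> \<le> K * g n" using cK assms(2)[OF n] by (intro mult_right_mono) auto
      finally show ?thesis .
    next
      case False
      have "\<bar>f n\<bar> / \<bar>g n\<bar> \<le> (\<Sum>n<N. \<bar>f n\<bar> / \<bar>g n\<bar>)"
        using False by (intro member_le_sum) auto
      then have "\<bar>f n\<bar> / g n \<le> K" using c(1) assms(2)[OF n] by (simp add: K_def)
      then show ?thesis using assms(2)[OF n] by (simp add: divide_le_eq)
    qed
  qed
qed

section \<open>Binomial series and elementary inequalities\<close>

lemma neg_binomial_coeff_pos: "b > 0 \<Longrightarrow> neg_binomial_coeff b n > 0"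
  by (simp add: neg_binomial_coeff_def pochhammer_pos)

lemma neg_binomial_series:
  assumes "\<bar>x\<bar> < 1"
  shows "(\<lambda>n. neg_binomial_coeff b n * x ^ n) sums (1 - x) powr (- b)"
proof -
  have "(\<lambda>n. ((- b) gchoose n) * (- x) ^ n) sums (1 + (- x)) powr (- b)"
    using assms by (intro gen_binomial_real) auto
  moreover have "((- b) gchoose n) * (- x) ^ n = neg_binomial_coeff b n * x ^ n" for n
  proof -
    have "((- b) gchoose n) * (- x) ^ n = ((- 1) ^ n * (- 1) ^ n) * (neg_binomial_coeff b n * x ^ n)"
      unfolding power_minus[of x n] gbinomial_pochhammer by (simp add: neg_binomial_coeff_def)
    also have "(- 1) ^ n * (- 1) ^ n = (1 :: real)" by (simp flip: power_mult_distrib)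
    finally show ?thesis by simp
  qed
  ultimately show ?thesis by simp
qed

text \<open>Turns the weight j^4 of the error bounds into a binomial series again. Raising
  \<open>b\<close> by 4 costs (1 - x)^(-4), of order n^2 when 1 - x has order 1 / sqrt n, and this
  is compensated by the weight being (j / sqrt n)^4.\<close>

lemma neg_binomial_coeff_shift:
  assumes "b > 0"
  shows "neg_binomial_coeff b j * real j ^ 4 \<le> (b * (b + 1) * (b + 2) * (b + 3)) * neg_binomial_coeff (b + 4) j"
proof -
  have *: "a * pochhammer (a + 1) j = (a + real j) * pochhammer a j" for a :: real
    by (metis pochhammer_rec pochhammer_Suc mult.commute)
  let ?P = "\<lambda>a. pochhammer a j"
  have p: "b * ?P (b + 1) = (b + real j) * ?P b" "(b + 1) * ?P (b + 2) = (b + 1 + real j) * ?P (b + 1)"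
    "(b + 2) * ?P (b + 3) = (b + 2 + real j) * ?P (b + 2)" "(b + 3) * ?P (b + 4) = (b + 3 + real j) * ?P (b + 3)"
    using *[of b] *[of "b + 1"] *[of "b + 2"] *[of "b + 3"] by (simp_all add: add.assoc)
  have "(b * (b + 1) * (b + 2) * (b + 3)) * ?P (b + 4) = b * ((b + 1) * ((b + 2) * ((b + 3 + real j) * ?P (b + 3))))"
    by (simp only: mult.assoc p)
  also have "\<dots> = (b + 3 + real j) * (b * ((b + 1) * ((b + 2) * ?P (b + 3))))" by (simp only: mult_ac)
  also have "\<dots> = (b + 3 + real j) * ((b + 2 + real j) * (b * ((b + 1) * ?P (b + 2))))"
    by (simp only: p(3)) (simp only: mult_ac)
  also have "\<dots> = (b + 3 + real j) * ((b + 2 + real j) * ((b + 1 + real j) * (b * ?P (b + 1))))"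
    by (simp only: p(2)) (simp only: mult_ac)
  also have "\<dots> = ?P b * ((b + real j) * (b + 1 + real j) * (b + 2 + real j) * (b + 3 + real j))"
    by (simp only: p(1)) (simp only: mult_ac)
  finally have eq: "(b * (b + 1) * (b + 2) * (b + 3)) * pochhammer (b + 4) j
      = pochhammer b j * ((b + real j) * (b + 1 + real j) * (b + 2 + real j) * (b + 3 + real j))" .
  have "real j ^ 4 = real j * real j * real j * real j" by (simp add: power4_eq_xxxx)
  also have "\<dots> \<le> (b + real j) * (b + 1 + real j) * (b + 2 + real j) * (b + 3 + real j)"
    using assms by (intro mult_mono) auto
  finally have "pochhammer b j * real j ^ 4 \<le> (b * (b + 1) * (b + 2) * (b + 3)) * pochhammer (b + 4) j"
    unfolding eq using assms by (intro mult_left_mono) (auto intro: less_imp_le pochhammer_pos)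
  then show ?thesis by (simp add: neg_binomial_coeff_def divide_right_mono)
qed

text \<open>Used with y = d j / n, where it compares sqrt (n - d j) with sqrt n - d j / (2 sqrt
  n).\<close>

lemma one_minus_sqrt_bounds:
  fixes y :: real
  assumes "0 \<le> y" "y \<le> 1"
  shows "0 \<le> 1 - sqrt (1 - y) - y / 2" "1 - sqrt (1 - y) - y / 2 \<le> y\<^sup>2 / 2"
proof -
  have "sqrt (1 - y) \<le> 1 - y / 2"
    using assms by (intro real_le_lsqrt) (auto simp: power2_eq_square algebra_simps)
  then show "0 \<le> 1 - sqrt (1 - y) - y / 2" by simp
  have "(1 - y / 2 - y\<^sup>2 / 2)\<^sup>2 = (1 - y) - (1 - y) * (3 / 4 * y\<^sup>2 + y ^ 3 / 4)"
    by (simp add: power2_eq_square power3_eq_cube field_simps)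
  also have "\<dots> \<le> 1 - y" using assms by simp
  finally have "1 - y / 2 - y\<^sup>2 / 2 \<le> sqrt (1 - y)" by (rule real_le_rsqrt)
  then show "1 - sqrt (1 - y) - y / 2 \<le> y\<^sup>2 / 2" by simp
qed

lemma abs_exp_minus_one_le:
  fixes x :: real
  assumes "x \<le> B" "0 \<le> B"
  shows "\<bar>exp x - 1\<bar> \<le> \<bar>x\<bar> * exp B"
proof (cases "x \<ge> 0")
  case True
  have "1 - x \<le> exp (- x)" using exp_ge_add_one_self[of "- x"] by simp
  then have "exp x * (1 - x) \<le> exp x * exp (- x)" by (intro mult_left_mono) auto
  then have "exp x - 1 \<le> x * exp x" by (simp add: algebra_simps exp_minus)
  also have "\<dots> \<le> x * exp B" using True assms by (intro mult_left_mono) auto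
  finally show ?thesis using True by simp
next
  case False
  have "1 - exp x \<le> - x" using exp_ge_add_one_self[of x] by linarith
  also have "\<dots> \<le> \<bar>x\<bar> * exp B" using False assms mult_left_mono[of 1 "exp B" "\<bar>x\<bar>"] by simp
  finally show ?thesis using False by simp
qed

lemma one_plus_square_le_quartic:
  fixes u :: real
  assumes "0 \<le> u"
  shows "1 + u + u\<^sup>2 \<le> 3 * (1 + u ^ 4)"
proof (cases "u \<le> 1")
  case True
  then have "u\<^sup>2 \<le> 1" using assms by (simp add: power_le_one)
  moreover have "0 \<le> u ^ 4" using assms by simp
  ultimately have "1 + u + u\<^sup>2 \<le> 3" "3 \<le> 3 * (1 + u ^ 4)" using True by auto
  then show ?thesis by (rule order_trans)
next
  case False
  then have "u ^ 1 \<le> u ^ 4" "u\<^sup>2 \<le> u ^ 4" by (intro power_increasing; simp)+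
  moreover have "0 \<le> u ^ 4" by simp
  ultimately show ?thesis unfolding power_one_right distrib_left by linarith
qed

text \<open>The main term of 2 c sqrt (n - d j) - 2 c sqrt n is - d c j / sqrt n, whence the
  geometric sequence. The bound holds for all \<open>j\<close> at once, at the price of a polynomial
  weight. As long as 2 d j \<le> n, a quadratic weight in j / sqrt n would do; it comes from the
  second-order term of the square root. For larger \<open>j\<close> only a crude comparison is made,
  which loses a power of n. But there j / sqrt n exceeds sqrt n / (2 d), and its fourth power, times
  n^(-1/2), pays for a loss of (sqrt n)^3. The value 0 for d j > n lets the convolution be summed
  over all \<open>j\<close>.\<close>

lemma shifted_ratio_bound:
  fixes e :: "nat \<Rightarrow> real"
  assumes c: "c > 0" and d: "d \<ge> 1" and epos: "\<And>n. e n > 0"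
    and asymp: "(\<lambda>n. ln (e n) - (2 * c * sqrt (real n) - 3 / 4 * ln (real n)) - l) \<in> O(\<lambda>n. real n powr (-1/2))"
  obtains K where "K > 0" "\<And>n j. n \<ge> 1 \<Longrightarrow>
     \<bar>(if d * j \<le> n then e (n - d * j) / e n else 0) - exp (- (d * c) / sqrt n) ^ j\<bar>
       \<le> K * real n powr (-1/2) * (1 + (real j / sqrt n) ^ 4) * exp (- (d * c) / sqrt n) ^ j"
proof -
  obtain K where K: "K > 0" "\<And>n. n \<ge> 1 \<Longrightarrow> \<bar>ln (e n) - (2 * c * sqrt (real n) - 3 / 4 * ln (real n)) - l\<bar> \<le> K * real n powr (-1/2)"
    by (rule bigo_nat_all[OF asymp]) auto
  define \<epsilon> where "\<epsilon> n = ln (e n) - (2 * c * sqrt (real n) - 3 / 4 * ln (real n)) - l" for n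
  have \<epsilon>: "\<bar>\<epsilon> n\<bar> \<le> K * (1 / sqrt (real n))" if "n \<ge> 1" for n
    using K(2)[OF that] that by (simp add: \<epsilon>_def powr_minus powr_half_sqrt inverse_eq_divide)
  have \<epsilon>': "\<bar>\<epsilon> n\<bar> \<le> K" if "n \<ge> 1" for n
  proof -
    have "K * (1 / sqrt (real n)) \<le> K * 1" using K(1) that by (intro mult_left_mono) auto
    then show ?thesis using \<epsilon>[OF that] by simp
  qed
  have ln_e: "ln (e n) = l + (2 * c * sqrt (real n) - 3 / 4 * ln (real n)) + \<epsilon> n" for n
    by (simp add: \<epsilon>_def)
  define x where "x n = exp (- (d * c) / sqrt n)" for n :: nat
  have xj: "x n ^ j = exp (- (d * c * j) / sqrt n)" for n j
    by (simp add: x_def exp_of_nat_mult[symmetric] mult_ac)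
  have xpos: "x n ^ j > 0" for n j by (simp add: x_def)
  define t where "t n j = (if d * j \<le> n then e (n - d * j) / e n else 0)" for n j
  \<comment> \<open>An upper bound for the exponent \<Delta> below: 3/4 from the logarithm when y
    \<le> 1/2, \<open>2 * K\<close> from the two error terms. The square-root term \<open>D\<close>
    only decreases \<Delta>.\<close>
  define B where "B = 3 / 4 + 2 * K"
  define K1 where "K1 = 3 * (3 / 2 * d + 3 * K + c * real d ^ 2) * exp B"
  \<comment> \<open>\<open>e 0\<close> enters separately because the error bound starts at index 1.
    The \<open>max 1\<close> in \<open>K3\<close> makes it dominate the geometric term as
    well.\<close>
  define K2 where "K2 = max (e 0) (exp (l + K))"
  define K3 where "K3 = 16 * real d ^ 4 * max 1 (K2 / exp (l - K))"
  have near: "\<bar>t n j - x n ^ j\<bar> \<le> K1 * (1 / sqrt n) * (1 + (real j / sqrt n) ^ 4) * x n ^ j"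
    if n: "n \<ge> 1" and dj: "2 * (d * j) \<le> n" for n j
  proof -
    define k y where "k = n - d * j" and "y = real (d * j) / real n"
    have k: "k \<ge> 1" "2 * k \<ge> n" "d * j \<le> n" using n dj by (auto simp: k_def)
    have y: "0 \<le> y" "y \<le> 1 / 2"
      using n dj of_nat_mono[OF dj, where 'a = real] by (auto simp: y_def divide_le_eq mult_ac)
    have rk: "real k = real n * (1 - y)" using k(3) n by (simp add: k_def y_def of_nat_diff field_simps)
    define s where "s = sqrt (real n)"
    have s: "s \<ge> 1" "s * s = real n" using n by (auto simp: s_def)
    define D where "D = 2 * c * s * (1 - sqrt (1 - y) - y / 2)"
    define \<Delta> where "\<Delta> = - 3 / 4 * ln (1 - y) + \<epsilon> k - \<epsilon> n - D"
    have sk: "sqrt (real k) = s * sqrt (1 - y)" by (simp add: rk real_sqrt_mult s_def)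
    have lk: "ln (real k) = ln (real n) + ln (1 - y)" using y n by (simp add: rk ln_mult)
    have sy: "s * y = real (d * j) / s" using s by (simp add: y_def s(2)[symmetric] field_simps)
    have "ln (e k / e n) = ln (e k) - ln (e n)"
      using epos[of k] epos[of n] by (simp add: ln_div)
    also have "\<dots> = \<Delta> - c * (s * y)"
      unfolding ln_e by (simp add: \<Delta>_def D_def sk lk algebra_simps flip: s_def)
    also have "\<dots> = \<Delta> + - (d * c * j) / s" unfolding sy by (simp add: mult_ac)
    finally have "e k / e n = exp \<Delta> * x n ^ j"
      using epos[of k] epos[of n] unfolding xj s_def[symmetric]
      by (metis divide_pos_pos exp_add exp_ln)
    then have t: "t n j - x n ^ j = (exp \<Delta> - 1) * x n ^ j"
      using k(3) by (simp add: t_def k_def algebra_simps)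
    have Dl: "0 \<le> D" using one_minus_sqrt_bounds(1)[of y] y c s(1) by (simp add: D_def)
    have "D \<le> 2 * c * s * (y\<^sup>2 / 2)"
      unfolding D_def using one_minus_sqrt_bounds(2)[of y] y c s(1) by (intro mult_left_mono) auto
    also have "\<dots> = c * (s * y)\<^sup>2 / s" using s(1) by (simp add: power2_eq_square field_simps)
    also have "\<dots> = (c * real d ^ 2) * (real j / s)\<^sup>2 * (1 / s)"
      unfolding sy by (simp add: power2_eq_square)
    finally have Du: "D \<le> (c * real d ^ 2) * (real j / s)\<^sup>2 * (1 / s)" .
    have "y * (2 * y) \<le> y * 1" using y by (intro mult_left_mono) auto
    then have "1 / (1 - y) \<le> 1 + 2 * y" using y by (simp add: divide_le_eq algebra_simps)
    moreover have "- ln (1 - y) \<le> 1 / (1 - y) - 1"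
      using ln_le_minus_one[of "1 / (1 - y)"] y by (simp add: ln_div)
    ultimately have lny: "0 \<le> - ln (1 - y)" "- ln (1 - y) \<le> 2 * y" using y by auto
    have yj: "y = (d * (real j / s)) * (1 / s)" using s(1) by (simp add: y_def s(2)[symmetric])
    have \<epsilon>n: "\<bar>\<epsilon> n\<bar> \<le> K * (1 / s)" using \<epsilon>[OF n] by (simp add: s_def)
    have "1 / sqrt (real k) \<le> 2 * (1 / s)"
    proof -
      have "s / 2 \<le> sqrt (real k)"
        using k(2) n by (intro real_le_rsqrt) (simp add: power2_eq_square s(2))
      then have "1 / sqrt (real k) \<le> 1 / (s / 2)" using s(1) by (intro frac_le) auto
      then show ?thesis by simp
    qed
    then have \<epsilon>k: "\<bar>\<epsilon> k\<bar> \<le> K * (2 * (1 / s))"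
      using \<epsilon>[OF k(1)] K(1) by (meson mult_left_mono less_imp_le order_trans)
    have "\<Delta> \<le> B" using lny y \<epsilon>'[OF n] \<epsilon>'[OF k(1)] Dl by (simp add: \<Delta>_def B_def)
    then have "\<bar>exp \<Delta> - 1\<bar> \<le> \<bar>\<Delta>\<bar> * exp B" using K(1) by (intro abs_exp_minus_one_le) (auto simp: B_def)
    also have "\<bar>\<Delta>\<bar> \<le> (3 / 2 * d * (real j / s) + 3 * K + (c * real d ^ 2) * (real j / s)\<^sup>2) * (1 / s)"
    proof -
      have "\<bar>\<Delta>\<bar> \<le> 3 / 4 * (2 * y) + K * (2 * (1 / s)) + K * (1 / s) + (c * real d ^ 2) * (real j / s)\<^sup>2 * (1 / s)"
        using lny \<epsilon>n \<epsilon>k Dl Du unfolding \<Delta>_def by linarith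
      then show ?thesis unfolding yj by (simp add: algebra_simps)
    qed
    also have "3 / 2 * d * (real j / s) + 3 * K + (c * real d ^ 2) * (real j / s)\<^sup>2
        \<le> (3 / 2 * d + 3 * K + c * real d ^ 2) * (1 + real j / s + (real j / s)\<^sup>2)"
    proof -
      define w a g where "w = real j / s" and "a = 3 / 2 * real d" and "g = c * real d ^ 2"
      have w: "w \<ge> 0" "a \<ge> 0" "g \<ge> 0" using s(1) c by (simp_all add: w_def a_def g_def)
      then have "0 \<le> a * (1 + w\<^sup>2) + 3 * K * (w + w\<^sup>2) + g * (1 + w)"
        using K(1) by simp
      then show ?thesis unfolding w_def[symmetric] a_def[symmetric] g_def[symmetric] by (simp add: algebra_simps)
    qed
    also have "\<dots> \<le> (3 / 2 * d + 3 * K + c * real d ^ 2) * (3 * (1 + (real j / s) ^ 4))"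
      using s(1) K(1) c by (intro mult_left_mono one_plus_square_le_quartic) auto
    finally have "\<bar>exp \<Delta> - 1\<bar> \<le> (3 / 2 * d + 3 * K + c * real d ^ 2) * (3 * (1 + (real j / s) ^ 4)) * (1 / s) * exp B"
      using s(1) by (simp add: mult_right_mono divide_right_mono)
    also have "\<dots> = K1 * (1 / s) * (1 + (real j / s) ^ 4)" by (simp only: K1_def mult_ac)
    finally have "\<bar>exp \<Delta> - 1\<bar> * x n ^ j \<le> K1 * (1 / s) * (1 + (real j / s) ^ 4) * x n ^ j"
      using xpos[of n j] by (intro mult_right_mono) auto
    then show ?thesis unfolding t abs_mult s_def using xpos[of n j] by simp
  qed
  have far: "\<bar>t n j - x n ^ j\<bar> \<le> K3 * (1 / sqrt n) * (1 + (real j / sqrt n) ^ 4) * x n ^ j"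
    if n: "n \<ge> 1" and dj: "2 * (d * j) > n" for n j
  proof -
    define s where "s = sqrt (real n)"
    have s: "s \<ge> 1" "s ^ 2 = real n" using n by (auto simp: s_def)
    have crude: "e k \<le> K2 * exp (2 * c * sqrt (real k))" for k
    proof (cases "k = 0")
      case False
      then have "ln (e k) \<le> l + K + 2 * c * sqrt (real k)"
        using \<epsilon>'[of k] ln_ge_zero[of "real k"] False unfolding ln_e by linarith
      then have "e k \<le> exp (l + K) * exp (2 * c * sqrt (real k))"
        using epos[of k] by (metis exp_add exp_le_cancel_iff exp_ln)
      also have "\<dots> \<le> K2 * exp (2 * c * sqrt (real k))"
        by (intro mult_right_mono) (auto simp: K2_def)
      finally show ?thesis .
    qed (simp add: K2_def)
    have "ln (real n) = 2 * ln s" "ln (s ^ 3) = 3 * ln s" "0 \<le> ln s"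
      using s(1) by (simp_all add: s(2)[symmetric] ln_realpow)
    \<comment> \<open>The factor n^(3/4) is s^(3/2); it is rounded up generously to an integer
      power.\<close>
    then have "3 / 4 * ln (real n) \<le> ln (s ^ 3)" by simp
    then have "l - K + 2 * c * s - ln (s ^ 3) \<le> ln (e n)"
      using \<epsilon>'[OF n] unfolding ln_e s_def[symmetric] by auto
    then have "exp (l - K + 2 * c * s - ln (s ^ 3)) \<le> e n"
      using epos[of n] by (metis exp_le_cancel_iff exp_ln)
    then have en: "exp (l - K) * exp (2 * c * s) / s ^ 3 \<le> e n"
      using s(1) by (simp add: exp_diff exp_add)
    have "t n j \<le> K2 / exp (l - K) * s ^ 3 * x n ^ j"
    proof (cases "d * j \<le> n")
      case True
      define y where "y = real (d * j) / real n"
      have y: "0 \<le> y" "y \<le> 1"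
        using n of_nat_mono[OF True, where 'a = real] by (auto simp: y_def divide_le_eq)
      have rk: "real (n - d * j) = real n * (1 - y)" using True n by (simp add: y_def of_nat_diff field_simps)
      have "2 * c * sqrt (real (n - d * j)) = 2 * c * s * sqrt (1 - y)" by (simp add: rk real_sqrt_mult s_def)
      also have "\<dots> \<le> 2 * c * s * (1 - y / 2)"
        using one_minus_sqrt_bounds(1)[OF y] c s(1) by (intro mult_left_mono) auto
      also have "\<dots> = 2 * c * s + - (d * c * j) / s"
        using s(1) by (simp add: y_def s(2)[symmetric] power2_eq_square field_simps)
      finally have "exp (2 * c * sqrt (real (n - d * j))) \<le> exp (2 * c * s) * x n ^ j"
        unfolding xj s_def[symmetric] exp_add[symmetric] by simp
      then have "K2 * exp (2 * c * sqrt (real (n - d * j))) \<le> K2 * (exp (2 * c * s) * x n ^ j)"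
        using epos[of 0] by (intro mult_left_mono) (auto simp: K2_def le_max_iff_disj)
      then have "e (n - d * j) \<le> K2 * (exp (2 * c * s) * x n ^ j)" using crude order_trans by blast
      also have "\<dots> = (K2 / exp (l - K) * s ^ 3 * x n ^ j) * (exp (l - K) * exp (2 * c * s) / s ^ 3)"
        using s(1) by simp
      also have "\<dots> \<le> (K2 / exp (l - K) * s ^ 3 * x n ^ j) * e n"
        using epos[of 0] s(1) xpos[of n j] by (intro mult_left_mono en) (auto simp: K2_def le_max_iff_disj)
      finally show ?thesis using epos[of n] True by (simp add: t_def divide_le_eq)
    next
      case False
      then show ?thesis using epos[of 0] s(1) xpos[of n j] by (auto simp: t_def K2_def le_max_iff_disj)
    qed
    also have "\<dots> \<le> max 1 (K2 / exp (l - K)) * s ^ 3 * x n ^ j"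
      using s(1) xpos[of n j] by (intro mult_right_mono) auto
    finally have tu: "t n j \<le> max 1 (K2 / exp (l - K)) * s ^ 3 * x n ^ j" .
    have "1 \<le> s ^ 3" using s(1) by simp
    then have "1 * 1 * x n ^ j \<le> max 1 (K2 / exp (l - K)) * s ^ 3 * x n ^ j"
      using xpos[of n j] by (intro mult_right_mono mult_mono) auto
    moreover have "0 \<le> t n j" using epos[of n] epos[of "n - d * j"] by (simp add: t_def)
    ultimately have "\<bar>t n j - x n ^ j\<bar> \<le> max 1 (K2 / exp (l - K)) * s ^ 3 * x n ^ j"
      using tu xpos[of n j] by linarith
    also have "s ^ 3 \<le> 16 * real d ^ 4 * (1 / s) * (1 + (real j / s) ^ 4)"
    proof -
      have "real n < 2 * (real d * real j)" using dj by (metis of_nat_less_iff of_nat_mult of_nat_numeral)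
      then have "s \<le> 2 * (d * (real j / s))" using s by (simp add: field_simps power2_eq_square)
      then have "s ^ 4 \<le> (2 * (d * (real j / s))) ^ 4" using s(1) by (intro power_mono) auto
      also have "\<dots> = 16 * real d ^ 4 * (real j / s) ^ 4" by (simp add: power_mult_distrib power_divide)
      also have "\<dots> \<le> 16 * real d ^ 4 * (1 + (real j / s) ^ 4)" by (intro mult_left_mono) auto
      finally show ?thesis using s(1) by (simp add: field_simps power4_eq_xxxx power3_eq_cube)
    qed
    finally show ?thesis
      using xpos[of n j] by (simp add: K3_def s_def mult_right_mono mult_left_mono mult_ac)
  qed
  have K13: "K1 > 0" using K(1) c d by (simp add: K1_def add_pos_nonneg)
  show ?thesis
  proof (rule that[of "max K1 K3"])
    show "max K1 K3 > 0" using K13 by (simp add: less_max_iff_disj)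
    fix n j :: nat assume n: "n \<ge> 1"
    have "\<bar>t n j - x n ^ j\<bar> \<le> max K1 K3 * ((1 / sqrt n) * (1 + (real j / sqrt n) ^ 4) * x n ^ j)"
    proof (cases "2 * (d * j) \<le> n")
      case True
      have "K1 * ((1 / sqrt n) * (1 + (real j / sqrt n) ^ 4) * x n ^ j) \<le> max K1 K3 * ((1 / sqrt n) * (1 + (real j / sqrt n) ^ 4) * x n ^ j)"
        using xpos[of n j] by (intro mult_right_mono) auto
      then show ?thesis using near[OF n True] unfolding mult.assoc by linarith
    next
      case False
      have "K3 * ((1 / sqrt n) * (1 + (real j / sqrt n) ^ 4) * x n ^ j) \<le> max K1 K3 * ((1 / sqrt n) * (1 + (real j / sqrt n) ^ 4) * x n ^ j)"
        using xpos[of n j] by (intro mult_right_mono) auto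
      then show ?thesis using far[OF n] False unfolding mult.assoc not_le by fastforce
    qed
    moreover have "real n powr (-1/2) = 1 / sqrt n"
      using n by (simp add: powr_minus powr_half_sqrt inverse_eq_divide)
    ultimately show "\<bar>(if d * j \<le> n then e (n - d * j) / e n else 0) - exp (- (d * c) / sqrt n) ^ j\<bar>
       \<le> max K1 K3 * real n powr (-1/2) * (1 + (real j / sqrt n) ^ 4) * exp (- (d * c) / sqrt n) ^ j"
      by (simp only: t_def x_def mult.assoc)
  qed
qed

text \<open>Divided by \<open>e n\<close>, the convolution is close to the binomial series at x =
  exp (- d c / sqrt n), with an error controlled by the same series and its shift to b + 4. Since 1
  - x is about d c / sqrt n, the value is about (sqrt n / (d c)) powr b. Positive coefficients let
  the termwise errors be summed without loss.\<close>

lemma neg_binomial_convolution_asymp: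
  fixes e :: "nat \<Rightarrow> real"
  assumes c: "c > 0" and d: "d \<ge> 1" and b: "b > 0" and epos: "\<And>n. e n > 0"
    and asymp: "(\<lambda>n. ln (e n) - (2 * c * sqrt (real n) - 3 / 4 * ln (real n)) - l) \<in> O(\<lambda>n. real n powr (-1/2))"
  shows "(\<lambda>n. (\<Sum>j\<le>n div d. neg_binomial_coeff b j * e (n - d * j)) / (e n * (sqrt n / (d * c)) powr b) - 1)
     \<in> O(\<lambda>n. real n powr (-1/2))"
proof -
  obtain K where K: "K > 0" "\<And>n j. n \<ge> 1 \<Longrightarrow>
     \<bar>(if d * j \<le> n then e (n - d * j) / e n else 0) - exp (- (d * c) / sqrt n) ^ j\<bar>
       \<le> K * real n powr (-1/2) * (1 + (real j / sqrt n) ^ 4) * exp (- (d * c) / sqrt n) ^ j"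
    using shifted_ratio_bound[OF c d epos asymp] by metis
  define x where "x n = exp (- (d * c) / sqrt n)" for n :: nat
  define t where "t n j = (if d * j \<le> n then e (n - d * j) / e n else 0)" for n j
  define a where "a n = (\<Sum>j\<le>n div d. neg_binomial_coeff b j * e (n - d * j))" for n
  define M where "M = b * (b + 1) * (b + 2) * (b + 3)"
  have dc: "d * c > 0" using c d by simp
  have bound: "\<bar>a n / e n - (1 - x n) powr (- b)\<bar>
      \<le> K * real n powr (-1/2) * ((1 - x n) powr (- b) + M * (1 / sqrt n) ^ 4 * (1 - x n) powr (- (b + 4)))"
    if n: "n \<ge> 1" for n
  proof -
    have x: "0 < x n" "x n < 1" using dc n by (auto simp: x_def)
    have s1: "(\<lambda>j. neg_binomial_coeff b j * x n ^ j) sums (1 - x n) powr (- b)"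
      and s2: "(\<lambda>j. neg_binomial_coeff (b + 4) j * x n ^ j) sums (1 - x n) powr (- (b + 4))"
      using x neg_binomial_series[of "x n" b] neg_binomial_series[of "x n" "b + 4"] by auto
    have "(\<lambda>j. neg_binomial_coeff b j * t n j) sums (\<Sum>j\<in>{..n div d}. neg_binomial_coeff b j * t n j)"
      using d by (intro sums_finite) (auto simp: t_def not_le less_mult_imp_div_less div_less_iff_less_mult mult.commute)
    also have "(\<Sum>j\<in>{..n div d}. neg_binomial_coeff b j * t n j) = a n / e n"
      unfolding a_def sum_divide_distrib
      using d by (intro sum.cong refl) (auto simp: t_def less_eq_div_iff_mult_less_eq mult.commute)
    finally have s3: "(\<lambda>j. neg_binomial_coeff b j * t n j) sums (a n / e n)" .
    have diff: "(\<lambda>j. neg_binomial_coeff b j * t n j - neg_binomial_coeff b j * x n ^ j) sums (a n / e n - (1 - x n) powr (- b))"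
      by (rule sums_diff[OF s3 s1])
    define B where "B j = K * real n powr (-1/2) * (neg_binomial_coeff b j * x n ^ j + M * (1 / sqrt n) ^ 4 * (neg_binomial_coeff (b + 4) j * x n ^ j))" for j
    have sB: "B sums (K * real n powr (-1/2) * ((1 - x n) powr (- b) + M * (1 / sqrt n) ^ 4 * (1 - x n) powr (- (b + 4))))"
      unfolding B_def by (intro sums_mult sums_add s1 s2)
    have le: "\<bar>neg_binomial_coeff b j * t n j - neg_binomial_coeff b j * x n ^ j\<bar> \<le> B j" for j
    proof -
      define p where "p = neg_binomial_coeff b j"
      have p: "p > 0" using b by (simp add: p_def neg_binomial_coeff_pos)
      have "\<bar>p * t n j - p * x n ^ j\<bar> = p * \<bar>t n j - x n ^ j\<bar>"
        using p by (simp add: abs_mult flip: right_diff_distrib)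
      also have "\<dots> \<le> p * (K * real n powr (-1/2) * (1 + (real j / sqrt n) ^ 4) * x n ^ j)"
        using p K(2)[OF n, of j] by (intro mult_left_mono) (auto simp: t_def x_def)
      also have "\<dots> = K * real n powr (-1/2) * (p * x n ^ j + (p * real j ^ 4) * ((1 / sqrt n) ^ 4 * x n ^ j))"
        by (simp add: algebra_simps power_divide)
      also have "\<dots> \<le> K * real n powr (-1/2) * (p * x n ^ j + (M * neg_binomial_coeff (b + 4) j) * ((1 / sqrt n) ^ 4 * x n ^ j))"
        using K(1) x(1) neg_binomial_coeff_shift[OF b, of j]
        by (intro mult_left_mono add_left_mono mult_right_mono) (auto simp: M_def p_def)
      finally show ?thesis by (simp add: B_def p_def mult_ac)
    qed
    have "summable (\<lambda>j. \<bar>neg_binomial_coeff b j * t n j - neg_binomial_coeff b j * x n ^ j\<bar>)"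
      by (rule summable_comparison_test'[OF sums_summable[OF sB], of 0]) (use le in auto)
    then have "\<bar>\<Sum>j. neg_binomial_coeff b j * t n j - neg_binomial_coeff b j * x n ^ j\<bar> \<le> (\<Sum>j. \<bar>neg_binomial_coeff b j * t n j - neg_binomial_coeff b j * x n ^ j\<bar>)"
      by (rule summable_rabs)
    also have "\<dots> \<le> (\<Sum>j. B j)"
      using \<open>summable (\<lambda>j. \<bar>neg_binomial_coeff b j * t n j - neg_binomial_coeff b j * x n ^ j\<bar>)\<close> sums_summable[OF sB] le
      by (intro suminf_le) auto
    finally show ?thesis using sums_unique[OF diff] sums_unique[OF sB] by simp
  qed
  define y where "y n = (sqrt n / (d * c)) powr b" for n :: nat
  define g where "g n = (1 - x n) powr (- b) / y n" for n
  have gO: "(\<lambda>n. g n - 1) \<in> O(\<lambda>n. real n powr (-1/2))"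
  proof -
    \<comment> \<open>Isolates the one-variable fact (1 - exp (-u)) / u = 1 + O(u), applied at u = d
      c / sqrt n.\<close>
    define h :: "real \<Rightarrow> real" where "h u = ((1 - exp (- u)) / u) powr (- b) - 1" for u
    have "h \<in> O[at_right 0](\<lambda>u. u)" unfolding h_def using b by real_asymp
    moreover have "filterlim (\<lambda>n::nat. d * c / sqrt n) (at_right 0) at_top" using dc by real_asymp
    ultimately have "(\<lambda>n::nat. h (d * c / sqrt n)) \<in> O(\<lambda>n::nat. d * c / sqrt n)"
      by (rule landau_o.big.compose)
    also have "(\<lambda>n::nat. d * c / sqrt n) \<in> O(\<lambda>n. real n powr (-1/2))" using dc by real_asymp
    also have "(\<lambda>n::nat. h (d * c / sqrt n)) \<in> O(\<lambda>n. real n powr (-1/2)) \<longleftrightarrow> ?thesis"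
    proof (rule landau_o.big.in_cong)
      show "\<forall>\<^sub>F n in at_top. h (d * c / sqrt (real n)) = g n - 1"
        using eventually_ge_at_top[of 1]
      proof eventually_elim
        case (elim n)
        have "x n < 1" using dc elim by (simp add: x_def)
        have gen: "(p / v) powr (- b) = p powr (- b) * v powr b" if "p > 0" "v > 0" for p v :: real
          using that by (simp add: powr_divide powr_minus field_simps)
        have "((1 - x n) / (d * c / sqrt n)) powr (- b) = (1 - x n) powr (- b) * (d * c / sqrt n) powr b"
          by (rule gen) (use \<open>x n < 1\<close> dc elim in auto)
        also have "(d * c / sqrt n) powr b = 1 / y n"
          using dc elim by (simp add: y_def powr_divide)
        finally show ?case using dc elim by (simp add: h_def g_def x_def)
      qed
    qed
    finally show ?thesis .
  qed
  have g1: "g \<in> O(\<lambda>_. 1)"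
  proof -
    have "(\<lambda>n. (g n - 1) + 1) \<in> O(\<lambda>_. 1)"
    proof (rule sum_in_bigo)
      note gO
      also have "(\<lambda>n. real n powr (-1/2)) \<in> O(\<lambda>_. 1)" by real_asymp
      finally show "(\<lambda>n. g n - 1) \<in> O(\<lambda>_. 1)" .
    qed simp
    then show ?thesis by simp
  qed
  have x4: "(\<lambda>n. 1 + M * ((1 / sqrt n) ^ 4 * (1 - x n) powr (- 4))) \<in> O(\<lambda>_. 1)"
  proof -
    have "(\<lambda>u::real. u ^ 4 * (1 - exp (- u)) powr (- 4)) \<in> O[at_right 0](\<lambda>_. 1)" by real_asymp
    moreover have "filterlim (\<lambda>n::nat. d * c / sqrt n) (at_right 0) at_top" using dc by real_asymp
    ultimately have "(\<lambda>n::nat. (d * c / sqrt n) ^ 4 * (1 - exp (- (d * c / sqrt n))) powr (- 4)) \<in> O(\<lambda>_. 1)"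
      by (rule landau_o.big.compose)
    then have "(\<lambda>n::nat. (M / (d * c) ^ 4) * ((d * c / sqrt n) ^ 4 * (1 - exp (- (d * c / sqrt n))) powr (- 4))) \<in> O(\<lambda>_. 1)"
      by (subst landau_o.big.cmult_in_iff) (use b c d in \<open>auto simp: M_def\<close>)
    then have "(\<lambda>n::nat. 1 + (M / (d * c) ^ 4) * ((d * c / sqrt n) ^ 4 * (1 - exp (- (d * c / sqrt n))) powr (- 4))) \<in> O(\<lambda>_. 1)"
      by (intro sum_in_bigo) simp_all
    then show ?thesis using c d by (simp add: x_def power_divide)
  qed
  have "(\<lambda>n. a n / e n / y n - g n) \<in> O(\<lambda>n. real n powr (-1/2) * (g n * (1 + M * ((1 / sqrt n) ^ 4 * (1 - x n) powr (- 4)))))"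
  proof (rule bigoI[of _ K])
    show "\<forall>\<^sub>F n in at_top. norm (a n / e n / y n - g n)
       \<le> K * norm (real n powr (-1/2) * (g n * (1 + M * ((1 / sqrt n) ^ 4 * (1 - x n) powr (- 4)))))"
      using eventually_ge_at_top[of 1]
    proof eventually_elim
      case (elim n)
      have y: "y n > 0" using c d elim by (simp add: y_def)
      have x: "x n < 1" using dc elim by (simp add: x_def)
      have g: "g n \<ge> 0" using y by (simp add: g_def)
      have M: "M \<ge> 0" using b by (simp add: M_def)
      have "a n / e n / y n - g n = (a n / e n - (1 - x n) powr (- b)) / y n"
        by (simp add: g_def diff_divide_distrib)
      then have "\<bar>a n / e n / y n - g n\<bar> = \<bar>a n / e n - (1 - x n) powr (- b)\<bar> / y n"
        using y by (simp add: abs_divide)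
      also have "\<dots> \<le> K * real n powr (-1/2) * ((1 - x n) powr (- b) + M * (1 / sqrt n) ^ 4 * (1 - x n) powr (- (b + 4))) / y n"
        using y by (intro divide_right_mono bound elim) auto
      also have "(1 - x n) powr (- (b + 4)) = (1 - x n) powr (- b) * (1 - x n) powr (- 4)"
        by (simp flip: powr_add)
      also have "K * real n powr (-1/2) * ((1 - x n) powr (- b) + M * (1 / sqrt n) ^ 4 * ((1 - x n) powr (- b) * (1 - x n) powr (- 4))) / y n
         = K * (real n powr (-1/2) * (g n * (1 + M * ((1 / sqrt n) ^ 4 * (1 - x n) powr (- 4)))))"
        by (simp add: g_def algebra_simps add_divide_distrib)
      finally show ?case using g M by (simp add: abs_mult)
    qed
  qed
  also have "(\<lambda>n. real n powr (-1/2) * (g n * (1 + M * ((1 / sqrt n) ^ 4 * (1 - x n) powr (- 4))))) \<in> O(\<lambda>n. real n powr (-1/2) * (1 * 1))"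
    by (intro landau_o.big.mult g1 x4 landau_o.big_refl)
  finally have "(\<lambda>n. a n / e n / y n - g n) \<in> O(\<lambda>n. real n powr (-1/2))" by (simp only: mult_1_right)
  from sum_in_bigo(1)[OF this gO] show ?thesis by (simp add: a_def y_def)
qed

section \<open>The constant\<close>

text \<open>Summed over \<open>k\<close>, these are the coefficients of \<open>(1 - z) powr (-1/2) * exp (\<theta> z / (1 - z))\<close>. The exponent
  \<open>1/2\<close> is chosen because the coefficient of \<open>z ^ n\<close> then resembles the series of
  \<open>cosh (2 * sqrt (\<theta> n))\<close>, which gives access to the constant in the asymptotics.\<close>

definition half_laguerre_term :: "real \<Rightarrow> nat \<Rightarrow> nat \<Rightarrow> real" where
  "half_laguerre_term \<theta> n k =
     (if k \<le> n then pochhammer (real k + 1 / 2) (n - k) / fact (n - k) * \<theta> ^ k / fact k else 0)"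

text \<open>Coefficient form of (1 - z)^2 t_k' = \<theta> t_(k-1) + (1 - z) / 2 * t_k for t_k =
  \<theta>^k / k! * z^k * (1 - z)^(-k - 1/2), the k-th summand when the exponential is
  expanded.\<close>

lemma half_laguerre_term_recurrence:
  "real (Suc (Suc n)) * half_laguerre_term \<theta> (Suc (Suc n)) k
    - 2 * real (Suc n) * half_laguerre_term \<theta> (Suc n) k + real n * half_laguerre_term \<theta> n k
   = \<theta> * (if k = 0 then 0 else half_laguerre_term \<theta> (Suc n) (k - 1))
     + half_laguerre_term \<theta> (Suc n) k / 2 - half_laguerre_term \<theta> n k / 2"
proof -
  \<comment> \<open>The first case is generic; in the next two, some of the terms are cut off to
    0.\<close>
  consider "k \<le> n" | "k = Suc n" | "k = Suc (Suc n)" | "k > Suc (Suc n)" by linarith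
  then show ?thesis
  proof cases
    case 1
    define m where "m = n - k"
    have n: "n = m + k" using 1 by (simp add: m_def)
    define P F where "P = pochhammer (real k + 1 / 2) m / fact m" and "F = \<theta> ^ k / fact k"
    have t0: "half_laguerre_term \<theta> n k = P * F" by (simp add: half_laguerre_term_def n P_def F_def)
    have t1: "half_laguerre_term \<theta> (Suc n) k = P * F * (real k + 1 / 2 + real m) / (real m + 1)"
      by (simp add: half_laguerre_term_def n P_def F_def pochhammer_Suc Suc_diff_le add_ac mult_ac)
    have t2: "half_laguerre_term \<theta> (Suc (Suc n)) k
       = P * F * (real k + 1 / 2 + real m) * (real k + 3 / 2 + real m) / ((real m + 1) * (real m + 2))"
      by (simp add: half_laguerre_term_def n P_def F_def pochhammer_Suc Suc_diff_le add_ac mult_ac)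
    have t3: "\<theta> * (if k = 0 then 0 else half_laguerre_term \<theta> (Suc n) (k - 1))
       = real k * (real k - 1 / 2) * (P * F) * (real k + 1 / 2 + real m) / ((real m + 1) * (real m + 2))"
    proof (cases k)
      case (Suc i)
      have "pochhammer (real i + 1 / 2) (Suc (Suc m)) = (real i + 1 / 2) * (pochhammer (real k + 1 / 2) m * (real k + 1 / 2 + real m))"
        by (subst pochhammer_rec, subst pochhammer_Suc) (simp add: Suc add_ac)
      moreover have "Suc n - i = Suc (Suc m)" using n Suc by simp
      ultimately have t: "half_laguerre_term \<theta> (Suc n) (k - 1) = (real i + 1 / 2) * (pochhammer (real k + 1 / 2) m * (real k + 1 / 2 + real m)) / fact (Suc (Suc m)) * \<theta> ^ i / fact i"
        using n Suc by (simp add: half_laguerre_term_def)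
      have f: "fact (Suc (Suc m)) = ((real m + 1) * (real m + 2)) * fact m" "fact k = real k * fact i" "\<theta> ^ k = \<theta> * \<theta> ^ i"
        "real i + 1 / 2 = real k - 1 / 2" "(k = 0) = False" "real k \<noteq> 0"
        by (simp_all add: Suc algebra_simps)
      have gen: "x * (a * (p * v) / (w * h) * T / g) = y * a * (p / h * (x * T / (y * g))) * v / w"
        if "y \<noteq> 0" for x a p v w h T g y :: real using that by (simp add: mult_ac)
      show ?thesis unfolding t P_def F_def f(1-5) if_False by (rule gen) (rule f(6))
    qed simp
    have m: "real m + 1 \<noteq> 0" "real m + 2 \<noteq> 0" by (simp_all add: add_eq_0_iff)
    \<comment> \<open>All terms are rational multiples of the common factor \<open>G\<close>;
      multiplied by \<open>D\<close>, the claim is a polynomial identity.\<close>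
    define G r s D where "G = P * F" and "r = real m" and "s = real k" and "D = (r + 1) * (r + 2)"
    have D: "D \<noteq> 0" using m by (simp add: D_def r_def)
    have canc: "a / (r + 1) * D = a * (r + 2)" "a / D * D = a" for a
      using m D by (simp_all add: D_def r_def)
    define L R where "L = (r + s + 2) * (G * (s + 1 / 2 + r) * (s + 3 / 2 + r) / D)
       - (2 * (r + s + 1)) * (G * (s + 1 / 2 + r) / (r + 1)) + (r + s) * G"
      and "R = s * (s - 1 / 2) * G * (s + 1 / 2 + r) / D + 1 / 2 * (G * (s + 1 / 2 + r) / (r + 1)) - G / 2"
    have "L * D = (r + s + 2) * (G * (s + 1 / 2 + r) * (s + 3 / 2 + r))
       - (2 * (r + s + 1)) * (G * (s + 1 / 2 + r) * (r + 2)) + (r + s) * G * D"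
      unfolding L_def distrib_right[of _ _ D] left_diff_distrib[of _ _ D] mult.assoc[of _ _ D] canc ..
    also have "\<dots> = s * (s - 1 / 2) * G * (s + 1 / 2 + r) + 1 / 2 * (G * (s + 1 / 2 + r) * (r + 2)) - G / 2 * D"
      by (simp add: D_def field_simps)
    also have "\<dots> = R * D"
      unfolding R_def distrib_right[of _ _ D] left_diff_distrib[of _ _ D] mult.assoc[of "1 / 2" _ D] canc ..
    finally have "L = R" using D by simp
    then show ?thesis unfolding t0 t1 t2 t3 by (simp add: n L_def R_def D_def G_def r_def s_def add_ac)
  next
    case 2
    define F where "F = \<theta> ^ k / fact k"
    have "half_laguerre_term \<theta> (Suc (Suc n)) k = (real n + 3 / 2) * F" "half_laguerre_term \<theta> (Suc n) k = F"
      "half_laguerre_term \<theta> n k = 0" "half_laguerre_term \<theta> (Suc n) (k - 1) = (real n + 1 / 2) * (\<theta> ^ n / fact n)"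
      by (simp_all add: half_laguerre_term_def 2 F_def Suc_diff_le)
    moreover have "\<theta> * (\<theta> ^ n / fact n) = real (Suc n) * F" unfolding F_def 2 by (simp del: of_nat_Suc)
    then have "\<theta> * ((real n + 1 / 2) * (\<theta> ^ n / fact n)) = (real n + 1 / 2) * (real (Suc n) * F)" by (simp only: mult.left_commute[of \<theta>])
    ultimately show ?thesis by (simp add: 2) (simp add: field_simps)
  next
    case 3
    have "\<theta> * (\<theta> ^ Suc n / fact (Suc n)) = real (Suc (Suc n)) * (\<theta> ^ Suc (Suc n) / fact (Suc (Suc n)))"
      by (simp del: of_nat_Suc)
    then show ?thesis by (simp add: 3 half_laguerre_term_def del: of_nat_Suc fact_Suc power_Suc)
  qed (simp add: half_laguerre_term_def)
qed

text \<open>The Laguerre polynomial L_n^(-1/2) at -\<theta>.\<close>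

definition half_laguerre :: "real \<Rightarrow> nat \<Rightarrow> real" where
  "half_laguerre \<theta> n = (\<Sum>k\<le>n. half_laguerre_term \<theta> n k)"

lemma half_laguerre_recurrence:
  "real (Suc (Suc n)) * half_laguerre \<theta> (Suc (Suc n)) =
     (2 * real (Suc n) + \<theta> + 1 / 2) * half_laguerre \<theta> (Suc n) - (real n + 1 / 2) * half_laguerre \<theta> n"
proof -
  let ?t = "half_laguerre_term \<theta>" and ?A = "half_laguerre \<theta>"
  let ?S = "{..Suc (Suc n)}"
  have ext: "?A m = (\<Sum>k\<in>?S. ?t m k)" if "m \<le> Suc (Suc n)" for m
    unfolding half_laguerre_def
    by (rule sum.mono_neutral_left) (use that in \<open>auto simp: half_laguerre_term_def\<close>)
  have shift: "(\<Sum>k\<in>?S. if k = 0 then 0 else ?t (Suc n) (k - 1)) = ?A (Suc n)"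
    unfolding half_laguerre_def by (subst sum.atMost_Suc_shift) simp
  have "real (Suc (Suc n)) * ?A (Suc (Suc n)) - 2 * real (Suc n) * ?A (Suc n) + real n * ?A n
    = (\<Sum>k\<in>?S. real (Suc (Suc n)) * ?t (Suc (Suc n)) k - 2 * real (Suc n) * ?t (Suc n) k + real n * ?t n k)"
    by (simp only: ext le_refl le_SucI sum.distrib sum_subtractf sum_distrib_left)
  also have "\<dots> = (\<Sum>k\<in>?S. \<theta> * (if k = 0 then 0 else ?t (Suc n) (k - 1)) + ?t (Suc n) k / 2 - ?t n k / 2)"
    by (simp only: half_laguerre_term_recurrence)
  also have "\<dots> = \<theta> * ?A (Suc n) + ?A (Suc n) / 2 - ?A n / 2"
    unfolding sum.distrib sum_subtractf sum_distrib_left[symmetric] shift sum_divide_distrib[symmetric]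
    by (simp only: ext le_refl le_SucI)
  finally show ?thesis by (simp add: algebra_simps)
qed

lemma neg_binomial_ode:
  "(1 - fps_X) * fps_deriv (Abs_fps (neg_binomial_coeff b)) = fps_const b * Abs_fps (neg_binomial_coeff b)"
    (is "?L = ?R")
proof (rule fps_ext)
  fix n
  have L: "?L = fps_deriv (Abs_fps (neg_binomial_coeff b)) - fps_X * fps_deriv (Abs_fps (neg_binomial_coeff b))"
    by (simp add: algebra_simps)
  have "real (Suc n) * neg_binomial_coeff b (Suc n) = (b + real n) * neg_binomial_coeff b n"
    by (simp add: neg_binomial_coeff_def pochhammer_Suc)
  then show "fps_nth ?L n = fps_nth ?R n"
    unfolding L by (cases n) (simp_all add: algebra_simps)
qed

text \<open>Both sides satisfy the same three-term recurrence, the left one through the differential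
  equation of its generating function, and they agree at 0 and 1.\<close>

lemma half_laguerre_eq_convolution:
  "(\<Sum>j\<le>n. neg_binomial_coeff (1 / 2) j * exp_path_coeff \<theta> (n - j)) = half_laguerre \<theta> n"
proof -
  define E where "E = Abs_fps (exp_path_coeff \<theta>)"
  define Q where "Q = Abs_fps (neg_binomial_coeff (1 / 2))"
  define F where "F = Q * E"
  have Fn: "fps_nth F n = (\<Sum>j\<le>n. neg_binomial_coeff (1 / 2) j * exp_path_coeff \<theta> (n - j))" for n
    by (simp add: F_def Q_def E_def fps_mult_nth atLeast0AtMost)
  have "(1 - fps_X)\<^sup>2 * fps_deriv F = (1 - fps_X) * E * ((1 - fps_X) * fps_deriv Q) + Q * ((1 - fps_X)\<^sup>2 * fps_deriv E)"
    unfolding F_def by (simp add: algebra_simps power2_eq_square)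
  also have "\<dots> = (1 - fps_X) * E * (fps_const (1 / 2) * Q) + Q * (fps_const \<theta> * E)"
    unfolding E_def Q_def exp_path_ode neg_binomial_ode ..
  finally have "fps_deriv F - fps_const 2 * (fps_X * fps_deriv F) + fps_X * (fps_X * fps_deriv F)
      = fps_const (1 / 2) * F - fps_const (1 / 2) * (fps_X * F) + fps_const \<theta> * F"
    unfolding F_def by (simp add: algebra_simps power2_eq_square flip: numeral_fps_const)
  then have *: "fps_nth (fps_deriv F - fps_const 2 * (fps_X * fps_deriv F) + fps_X * (fps_X * fps_deriv F)) (Suc n)
      = fps_nth (fps_const (1 / 2) * F - fps_const (1 / 2) * (fps_X * F) + fps_const \<theta> * F) (Suc n)" for n
    by simp
  have rec: "real (Suc (Suc n)) * fps_nth F (Suc (Suc n)) =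
     (2 * real (Suc n) + \<theta> + 1 / 2) * fps_nth F (Suc n) - (real n + 1 / 2) * fps_nth F n" for n
  proof -
    have "fps_nth (fps_deriv F - fps_const 2 * (fps_X * fps_deriv F) + fps_X * (fps_X * fps_deriv F)) (Suc n)
      = real (Suc (Suc n)) * fps_nth F (Suc (Suc n)) - 2 * real (Suc n) * fps_nth F (Suc n) + real n * fps_nth F n"
      by (cases n) simp_all
    moreover have "fps_nth (fps_const (1 / 2) * F - fps_const (1 / 2) * (fps_X * F) + fps_const \<theta> * F) (Suc n)
      = fps_nth F (Suc n) / 2 - fps_nth F n / 2 + \<theta> * fps_nth F (Suc n)"
      by simp
    ultimately show ?thesis using *[of n] by (simp add: algebra_simps)
  qed
  have "fps_nth F n = half_laguerre \<theta> n \<and> fps_nth F (Suc n) = half_laguerre \<theta> (Suc n)"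
  proof (induction n)
    case 0
    then show ?case by (simp add: Fn half_laguerre_def half_laguerre_term_def neg_binomial_coeff_def)
  next
    case (Suc n)
    then have "real (Suc (Suc n)) * fps_nth F (Suc (Suc n)) = real (Suc (Suc n)) * half_laguerre \<theta> (Suc (Suc n))"
      unfolding rec half_laguerre_recurrence by simp
    then show ?case using Suc by simp
  qed
  then show ?thesis by (simp add: Fn)
qed

text \<open>At parameter 1/2 the Pochhammer symbol is
  \<open>fact (2 * k) / (4 ^ k * fact k)\<close>, which turns the summand into X^(2k) / (2k)! with X
  = 2 sqrt (\<theta> n). The product is n (n - 1) ... (n - k + 1) / n^k, the deviation from the
  exact cosh series.\<close>

lemma half_laguerre_eq_cosh_sum:
  assumes "n \<ge> 1"
  shows "half_laguerre \<theta> n = neg_binomial_coeff (1 / 2) n *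
    (\<Sum>k\<le>n. (\<Prod>i<k. 1 - real i / real n) * ((4 * \<theta> * real n) ^ k / fact (2 * k)))"
proof -
  have "half_laguerre_term \<theta> n k = neg_binomial_coeff (1 / 2) n * ((\<Prod>i<k. 1 - real i / real n) * ((4 * \<theta> * real n) ^ k / fact (2 * k)))"
    if "k \<le> n" for k
  proof -
    have 1: "pochhammer (1 / 2) n = pochhammer (1 / 2 :: real) k * pochhammer (real k + 1 / 2) (n - k)"
      using that by (simp add: pochhammer_product[of k n] add.commute)
    have 2: "pochhammer (1 / 2 :: real) k = fact (2 * k) / (4 ^ k * fact k)"
    proof -
      have "2 ^ (2 * k) = (4 :: real) ^ k" by (simp add: power_mult)
      then show ?thesis using fact_double[of k, where 'a = real] by (simp add: mult_ac)
    qed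
    have 3: "(\<Prod>i<k. 1 - real i / real n) * real n ^ k = fact n / fact (n - k)"
    proof -
      have "(\<Prod>i<k. 1 - real i / real n) * real n ^ k = (\<Prod>i<k. (1 - real i / real n) * real n)"
        by (simp add: prod.distrib)
      also have "\<dots> = (\<Prod>i<k. real (n - i))"
        using assms that by (intro prod.cong refl) (auto simp: field_simps of_nat_diff)
      also have "\<dots> = fact n / fact (n - k)"
        using that
      proof (induction k)
        case (Suc k)
        define r where "r = real (n - k)"
        have r: "r \<noteq> 0" using Suc.prems by (simp add: r_def)
        have f: "fact (n - k) = r * fact (n - Suc k)"
          unfolding r_def using Suc.prems by (metis Suc_diff_Suc Suc_le_lessD fact_Suc of_nat_fact of_nat_mult)
        have "(\<Prod>i<Suc k. real (n - i)) = fact n / fact (n - k) * r" using Suc by (simp add: r_def)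
        also have "\<dots> = fact n / fact (n - Suc k)" unfolding f using r by simp
        finally show ?case .
      qed simp
      finally show ?thesis .
    qed
    have "neg_binomial_coeff (1 / 2) n * ((\<Prod>i<k. 1 - real i / real n) * ((4 * \<theta> * real n) ^ k / fact (2 * k)))
      = pochhammer (1 / 2) n / fact n * ((\<Prod>i<k. 1 - real i / real n) * real n ^ k) * (4 ^ k * \<theta> ^ k) / fact (2 * k)"
      by (simp add: neg_binomial_coeff_def power_mult_distrib mult_ac)
    also have "\<dots> = half_laguerre_term \<theta> n k"
      unfolding 3 1 2 using that by (simp add: half_laguerre_term_def field_simps)
    finally show ?thesis by simp
  qed
  then show ?thesis unfolding half_laguerre_def by (simp add: sum_distrib_left)
qed

section \<open>Concentration of the cosh series and the averaged falling product\<close>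

lemma even_exp_series:
  fixes X :: real
  shows "(\<lambda>k. X ^ (2 * k) / fact (2 * k)) sums cosh X"
    and "(\<lambda>k. X ^ Suc (2 * k) / fact (Suc (2 * k))) sums sinh X"
proof -
  define f g where "f n = (if even n then X ^ n / fact n else 0)" and "g n = (if even n then 0 else X ^ n / fact n)" for n
  have "f = (\<lambda>n. if even n then X ^ n /\<^sub>R fact n else 0)" "g = (\<lambda>n. if even n then 0 else X ^ n /\<^sub>R fact n)"
    by (auto simp: f_def g_def divide_inverse mult.commute fun_eq_iff)
  then have "f sums cosh X" "g sums sinh X"
    using cosh_converges[of X] sinh_converges[of X] by simp_all
  moreover have "(\<lambda>k. f (2 * k)) sums cosh X \<longleftrightarrow> f sums cosh X"
    by (rule sums_mono_reindex) (auto simp: f_def intro!: strict_monoI elim!: evenE)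
  moreover have "(\<lambda>k. g (Suc (2 * k))) sums sinh X \<longleftrightarrow> g sums sinh X"
    by (rule sums_mono_reindex) (auto simp: g_def intro!: strict_monoI elim!: oddE)
  ultimately show "(\<lambda>k. X ^ (2 * k) / fact (2 * k)) sums cosh X"
    "(\<lambda>k. X ^ Suc (2 * k) / fact (Suc (2 * k))) sums sinh X"
    by (simp_all only: f_def g_def even_mult_iff even_Suc even_numeral simp_thms if_True if_False)
qed

text \<open>The weights are those of a Poisson variable of parameter X restricted to even values.
  Its factorial moments come from shifting the series; a shift by one lands on the odd half, hence
  sinh. What remains is X sinh X + 2 X^2 exp (-X), so the spread has order sqrt X.\<close>

lemma even_exp_series_variance:
  fixes X :: real
  assumes "X \<ge> 0"
  obtains V where "(\<lambda>k. (2 * real k - X)\<^sup>2 * (X ^ (2 * k) / fact (2 * k))) sums V" "V \<le> (4 + X) * cosh X"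
proof -
  define w where "w k = X ^ (2 * k) / fact (2 * k)" for k
  have w: "w sums cosh X" unfolding w_def by (rule even_exp_series)
  have "(\<lambda>k. 2 * real (Suc k) * (2 * real (Suc k) - 1) * w (Suc k)) sums (X\<^sup>2 * cosh X)"
  proof -
    have "2 * real (Suc k) * (2 * real (Suc k) - 1) * w (Suc k) = X\<^sup>2 * w k" for k
    proof -
      have f: "fact (2 * Suc k) = (2 * real (Suc k) * (2 * real (Suc k) - 1)) * fact (2 * k)"
        by (simp add: algebra_simps)
      have "2 * real (Suc k) * (2 * real (Suc k) - 1) \<noteq> 0" by simp
      then show ?thesis unfolding w_def f by (simp add: power2_eq_square del: of_nat_Suc)
    qed
    then show ?thesis using sums_mult[OF w, of "X\<^sup>2"] by simp
  qed
  then have 1: "(\<lambda>k. 2 * real k * (2 * real k - 1) * w k) sums (X\<^sup>2 * cosh X)"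
    by (subst (asm) sums_Suc_iff) simp
  have "(\<lambda>k. 2 * real (Suc k) * w (Suc k)) sums (X * sinh X)"
  proof -
    have "2 * real (Suc k) * w (Suc k) = X * (X ^ Suc (2 * k) / fact (Suc (2 * k)))" for k
    proof -
      have f: "fact (2 * Suc k) = 2 * real (Suc k) * fact (Suc (2 * k))"
        by (simp add: algebra_simps)
      show ?thesis unfolding w_def f by (simp del: of_nat_Suc fact_Suc)
    qed
    then show ?thesis using sums_mult[OF even_exp_series(2)[of X], of X] by simp
  qed
  then have 2: "(\<lambda>k. 2 * real k * w k) sums (X * sinh X)"
    by (subst (asm) sums_Suc_iff) simp
  have "(\<lambda>k. 2 * real k * (2 * real k - 1) * w k + (1 - 2 * X) * (2 * real k * w k) + X\<^sup>2 * w k)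
      sums (X\<^sup>2 * cosh X + (1 - 2 * X) * (X * sinh X) + X\<^sup>2 * cosh X)"
    by (intro sums_add sums_mult 1 2 w)
  moreover have "2 * real k * (2 * real k - 1) * w k + (1 - 2 * X) * (2 * real k * w k) + X\<^sup>2 * w k = (2 * real k - X)\<^sup>2 * w k" for k
    by (simp add: power2_eq_square algebra_simps)
  ultimately have V: "(\<lambda>k. (2 * real k - X)\<^sup>2 * w k) sums (X\<^sup>2 * cosh X + (1 - 2 * X) * (X * sinh X) + X\<^sup>2 * cosh X)" by simp
  have "X\<^sup>2 * cosh X + (1 - 2 * X) * (X * sinh X) + X\<^sup>2 * cosh X = 2 * (X\<^sup>2 * (cosh X - sinh X)) + X * sinh X"
    by (simp add: power2_eq_square algebra_simps)
  also have "cosh X - sinh X = exp (- X)" by (simp add: cosh_def sinh_def field_simps)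
  also have "2 * (X\<^sup>2 * exp (- X)) + X * sinh X \<le> 4 * cosh X + X * cosh X"
  proof (rule add_mono)
    have "1 + X + X\<^sup>2 / 2 \<le> exp X" using assms by (rule exp_lower_Taylor_quadratic)
    then have "X\<^sup>2 * exp (- X) \<le> 2" using assms by (simp add: exp_minus field_simps)
    then show "2 * (X\<^sup>2 * exp (- X)) \<le> 4 * cosh X" using cosh_real_ge_1[of X] by linarith
    show "X * sinh X \<le> X * cosh X" using assms by (intro mult_left_mono) (auto simp: sinh_less_cosh_real less_imp_le)
  qed
  finally show ?thesis using V by (intro that) (auto simp: w_def algebra_simps)
qed

lemma abs_exp_diff_le:
  fixes a b :: real
  assumes "a \<le> 0" "b \<le> 0"
  shows "\<bar>exp a - exp b\<bar> \<le> \<bar>a - b\<bar>"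
proof -
  have *: "exp v - exp u \<le> v - u" if "u \<le> v" "v \<le> 0" for u v :: real
  proof -
    have "exp v - exp u = exp v * (1 - exp (u - v))" by (simp add: algebra_simps flip: exp_add)
    also have "1 - exp (u - v) \<le> v - u" using exp_ge_add_one_self[of "u - v"] by linarith
    then have "exp v * (1 - exp (u - v)) \<le> 1 * (v - u)"
      using that by (intro mult_mono) auto
    finally show ?thesis by simp
  qed
  show ?thesis
    using *[of a b] *[of b a] assms by (cases "a \<le> b") auto
qed

text \<open>Sum - u - 2 u^2 \<le> ln (1 - u) \<le> - u over u = i / n. The linear parts add up to k
  (k - 1) / (2 n), so the product is roughly exp (- k^2 / (2 n)).\<close>

lemma falling_prod_ln_bounds:
  assumes "n \<ge> 1" "2 * k \<le> n"
  shows "0 < (\<Prod>i<k. 1 - real i / real n)"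
    and "ln (\<Prod>i<k. 1 - real i / real n) \<le> - (real k * (real k - 1) / (2 * real n))"
    and "- (real k * (real k - 1) / (2 * real n)) - 2 * real k ^ 3 / real n ^ 2 \<le> ln (\<Prod>i<k. 1 - real i / real n)"
proof -
  have pos: "0 < 1 - real i / real n" if "i < k" for i using that assms by simp
  show p: "0 < (\<Prod>i<k. 1 - real i / real n)" using pos by (intro prod_pos) auto
  have ln: "ln (\<Prod>i<k. 1 - real i / real n) = (\<Sum>i<k. ln (1 - real i / real n))"
  proof (rule ln_prod)
    fix i assume "i \<in> {..<k}"
    then have "0 < 1 - real i / real n" using pos by blast
    then show "1 - real i / real n \<noteq> 0" by linarith
  qed simp
  have gauss: "(\<Sum>i<k. - (real i / real n)) = - (real k * (real k - 1) / (2 * real n))"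
  proof -
    have "(\<Sum>i<k. - (real i / real n)) = - ((\<Sum>i<k. real i) / real n)"
      by (simp add: sum_negf sum_divide_distrib)
    also have "(\<Sum>i<k. real i) = real k * (real k - 1) / 2" by (induction k) (simp_all add: field_simps)
    finally show ?thesis by simp
  qed
  have "(\<Sum>i<k. ln (1 - real i / real n)) \<le> (\<Sum>i<k. - (real i / real n))"
    using ln_le_minus_one[OF pos] by (intro sum_mono) force
  then show "ln (\<Prod>i<k. 1 - real i / real n) \<le> - (real k * (real k - 1) / (2 * real n))"
    unfolding ln gauss .
  have "(\<Sum>i<k. - (real i / real n) - 2 * real k ^ 2 / real n ^ 2) \<le> (\<Sum>i<k. ln (1 - real i / real n))"
  proof (rule sum_mono)
    fix i assume "i \<in> {..<k}"
    then have i: "i < k" by simp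
    have u: "0 \<le> real i / real n" "real i / real n \<le> 1 / 2" "real i / real n \<le> real k / real n"
      using i assms by (auto simp: field_simps)
    have "- (real i / real n) - 2 * (real i / real n)\<^sup>2 \<le> ln (1 - real i / real n)"
      by (rule ln_one_minus_pos_lower_bound) (use u in auto)
    moreover have "(real i / real n)\<^sup>2 \<le> (real k / real n)\<^sup>2" using u by (intro power_mono) auto
    ultimately show "- (real i / real n) - 2 * real k ^ 2 / real n ^ 2 \<le> ln (1 - real i / real n)"
      by (simp add: power_divide)
  qed
  then show "- (real k * (real k - 1) / (2 * real n)) - 2 * real k ^ 3 / real n ^ 2 \<le> ln (\<Prod>i<k. 1 - real i / real n)"
    unfolding ln sum_subtractf gauss by (simp add: power2_eq_square power3_eq_cube)
qed

text \<open>Uniform in \<open>k\<close> and linear in the deviation, so that it can be averaged. For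
  k \<le> 2 c sqrt n the exponents are compared; beyond that both quantities lie in [0, 1], and the
  deviation already exceeds \<open>c\<close>.\<close>

lemma falling_prod_approx:
  fixes c :: real
  assumes c: "c > 0" and n: "n \<ge> 1" "16 * c\<^sup>2 \<le> real n"
  shows "\<bar>(\<Prod>i<k. 1 - real i / real n) - exp (- c\<^sup>2 / 2)\<bar>
     \<le> (2 * c + 16 * c ^ 3 + 1 / c) * (\<bar>real k / sqrt n - c\<bar> + 1 / sqrt n)"
proof -
  define P where "P = (\<Prod>i<k. 1 - real i / real n)"
  define s u where "s = sqrt (real n)" and "u = real k / s"
  have s: "s \<ge> 1" "real n = s\<^sup>2" using n by (auto simp: s_def)
  have u: "u \<ge> 0" "real k = u * s" using s(1) by (auto simp: u_def)
  \<comment> \<open>\<open>1 / c\<close> serves the far range. For u \<le> 2 c, the part c + 16 c^3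
    bounds the error u / 2 + 2 u^3, and 3 c / 2 bounds the slope (u + c) / 2.\<close>
  define C where "C = 2 * c + 16 * c ^ 3 + 1 / c"
  have Cc: "C \<ge> 1 / c" "C \<ge> 3 / 2 * c" "C \<ge> c + 16 * c ^ 3" using c by (simp_all add: C_def)
  show ?thesis
  proof (cases "u \<le> 2 * c")
    case True
    \<comment> \<open>The hypothesis \<open>16 * c\<^sup>2 \<le> real n\<close> is what brings all k
      \<le> 2 c sqrt n into the range of the logarithmic bounds.\<close>
    have "2 * real k \<le> real n"
    proof -
      have "4 * c \<le> s" unfolding s_def using n(2) c by (intro real_le_rsqrt) (simp add: power_mult_distrib)
      then have "2 * u * s \<le> s * s" using True s(1) by (intro mult_right_mono) auto
      then show ?thesis by (simp add: u(2) s(2) power2_eq_square)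
    qed
    then have k: "2 * k \<le> n" by linarith
    note b = falling_prod_ln_bounds[OF n(1) k, folded P_def]
    have k1: "real k * (real k - 1) / (2 * real n) = u\<^sup>2 / 2 - u / 2 * (1 / s)"
      using s(1) by (simp add: u(2) s(2) power2_eq_square field_simps)
    have k2: "2 * real k ^ 3 / real n ^ 2 = 2 * u ^ 3 * (1 / s)"
      using s(1) by (simp add: u(2) s(2) power2_eq_square power3_eq_cube)
    have "\<bar>ln P + u\<^sup>2 / 2\<bar> \<le> (u / 2 + 2 * u ^ 3) * (1 / s)"
    proof -
      have "0 \<le> u / 2 * (1 / s)" "0 \<le> 2 * u ^ 3 * (1 / s)" using u s by auto
      then show ?thesis using b(2,3) unfolding k1 k2 distrib_right by linarith
    qed
    also have "\<dots> \<le> (c + 16 * c ^ 3) * (1 / s)"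
    proof -
      have "u ^ 3 \<le> (2 * c) ^ 3" using True u by (intro power_mono) auto
      then have "u / 2 + 2 * u ^ 3 \<le> c + 16 * c ^ 3" using True by (simp add: power_mult_distrib)
      then show ?thesis using s(1) by (intro mult_right_mono) auto
    qed
    also have "\<dots> \<le> C * (1 / s)" using Cc s(1) by (intro mult_right_mono) auto
    finally have 1: "\<bar>ln P + u\<^sup>2 / 2\<bar> \<le> C * (1 / s)" .
    have e: "u\<^sup>2 / 2 - c\<^sup>2 / 2 = (u + c) / 2 * (u - c)" by (simp add: power2_eq_square algebra_simps)
    have "\<bar>u\<^sup>2 / 2 - c\<^sup>2 / 2\<bar> = (u + c) / 2 * \<bar>u - c\<bar>"
      unfolding e abs_mult using u(1) c by simp
    also have "\<dots> \<le> C * \<bar>u - c\<bar>" using True Cc by (intro mult_right_mono) auto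
    finally have 2: "\<bar>u\<^sup>2 / 2 - c\<^sup>2 / 2\<bar> \<le> C * \<bar>u - c\<bar>" .
    have "P \<le> 1" unfolding P_def using k by (intro prod_le_1) auto
    then have "\<bar>exp (ln P) - exp (- c\<^sup>2 / 2)\<bar> \<le> \<bar>ln P - (- c\<^sup>2 / 2)\<bar>"
      using b(1) by (intro abs_exp_diff_le) auto
    also have "\<dots> \<le> C * \<bar>u - c\<bar> + C * (1 / s)" using 1 2 by linarith
    finally show ?thesis using b(1) by (simp add: P_def C_def u_def s_def distrib_left)
  next
    case False
    have "0 \<le> P" "P \<le> 1"
    proof -
      show "0 \<le> P"
      proof (cases "k \<le> n")
        case True then show ?thesis unfolding P_def using n by (intro prod_nonneg) auto
      next
        case False
        then have "P = 0" unfolding P_def using n by (intro prod_zero) (auto intro!: bexI[of _ n])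
        then show ?thesis by simp
      qed
      show "P \<le> 1"
      proof (cases "k \<le> n")
        case True then show ?thesis unfolding P_def using n by (intro prod_le_1) auto
      next
        case False
        then have "P = 0" unfolding P_def using n by (intro prod_zero) (auto intro!: bexI[of _ n])
        then show ?thesis by simp
      qed
    qed
    moreover have "0 < exp (- c\<^sup>2 / 2)" "exp (- c\<^sup>2 / 2) \<le> 1" by auto
    ultimately have "\<bar>P - exp (- c\<^sup>2 / 2)\<bar> \<le> 1" by linarith
    also have "\<dots> \<le> 1 / c * (u - c)" using False c by (simp add: field_simps)
    also have "\<dots> \<le> C * (\<bar>u - c\<bar> + 1 / s)"
      using False c Cc s(1) by (intro mult_mono) auto
    finally show ?thesis by (simp add: P_def C_def u_def s_def)
  qed
qed

text \<open>Chebyshev's argument: under the cosh weights k deviates from c sqrt n by order n^(1/4),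
  hence k / sqrt n from c by order n^(-1/4), and the average of the product tends to its value exp
  (- c^2 / 2) at c.\<close>

lemma weighted_falling_prod_limit:
  fixes c :: real
  assumes c: "c > 0"
  shows "(\<lambda>n::nat. (\<Sum>k\<le>n. (\<Prod>i<k. 1 - real i / real n) * ((2 * c * sqrt n) ^ (2 * k) / fact (2 * k)))
     / cosh (2 * c * sqrt n)) \<longlonglongrightarrow> exp (- c\<^sup>2 / 2)"
proof -
  define P where "P n k = (\<Prod>i<k. 1 - real i / real n)" for n k :: nat
  define X where "X n = 2 * c * sqrt (real n)" for n :: nat
  define w where "w n k = X n ^ (2 * k) / fact (2 * k)" for n k :: nat
  define C where "C = 2 * c + 16 * c ^ 3 + 1 / c"
  define L where "L = exp (- c\<^sup>2 / 2)"
  define S where "S n = (\<Sum>k\<le>n. P n k * w n k)" for n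
  define B where "B n = C * (real n powr (-1/4) + real n powr (-3/4) / 4 * (4 + X n) + real n powr (-1/2))" for n :: nat
  have C: "C > 0" using c by (simp add: C_def add_pos_pos)
  have bound: "\<bar>S n / cosh (X n) - L\<bar> \<le> B n" if n: "n \<ge> 1" "16 * c\<^sup>2 \<le> real n" for n
  proof -
    have X0: "X n \<ge> 0" using c by (simp add: X_def)
    obtain V where V: "(\<lambda>k. (2 * real k - X n)\<^sup>2 * w n k) sums V" "V \<le> (4 + X n) * cosh (X n)"
      using even_exp_series_variance[OF X0] by (metis (no_types, lifting) w_def sums_cong)
    have w: "w n sums cosh (X n)" unfolding w_def by (rule even_exp_series)
    have w0: "w n k \<ge> 0" for k unfolding w_def by (simp add: power_mult)
    have "(\<lambda>k. P n k * w n k) sums (\<Sum>k\<in>{..n}. P n k * w n k)"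
    proof (rule sums_finite)
      fix k assume "k \<notin> {..n}"
      then have "P n k = 0" unfolding P_def using n(1) by (intro prod_zero) (auto intro!: bexI[of _ n])
      then show "P n k * w n k = 0" by simp
    qed simp
    then have S: "(\<lambda>k. P n k * w n k) sums S n" by (simp add: S_def)
    \<comment> \<open>The typical size of k / sqrt n - c. At this scale the linear deviation is at
      most \<open>r + r ^ 3 / 4 * (2 * real k - X n)\<^sup>2\<close>, so the second moment
      suffices.\<close>
    define r where "r = real n powr (-1/4)"
    have r: "r > 0" "1 / sqrt n = r\<^sup>2" "real n powr (-1/2) = r\<^sup>2" "real n powr (-3/4) = r ^ 3" "r\<^sup>2 * sqrt n = 1"
    proof -
      show "r > 0" using n by (simp add: r_def)
      show r2: "real n powr (-1/2) = r\<^sup>2" using n by (simp add: r_def power2_eq_square flip: powr_add)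
      then show "1 / sqrt n = r\<^sup>2" using n by (simp add: powr_minus powr_half_sqrt inverse_eq_divide)
      then show "r\<^sup>2 * sqrt n = 1" using n by (simp flip: \<open>1 / sqrt n = r\<^sup>2\<close>)
      show "real n powr (-3/4) = r ^ 3" using n by (simp add: r_def power3_eq_cube flip: powr_add)
    qed
    define D where "D k = C * (r * w n k + r ^ 3 / 4 * ((2 * real k - X n)\<^sup>2 * w n k) + r\<^sup>2 * w n k)" for k
    have D: "D sums (C * (r * cosh (X n) + r ^ 3 / 4 * V + r\<^sup>2 * cosh (X n)))"
      unfolding D_def by (intro sums_mult sums_add w V(1))
    have diff: "(\<lambda>k. P n k * w n k - L * w n k) sums (S n - L * cosh (X n))"
      by (intro sums_diff S sums_mult w)
    have le: "\<bar>P n k * w n k - L * w n k\<bar> \<le> D k" for k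
    proof -
      have e: "real k / sqrt n - c = (2 * real k - X n) * r\<^sup>2 / 2"
        unfolding r(2)[symmetric] using n by (simp add: X_def field_simps)
      have "\<bar>real k / sqrt n - c\<bar> = \<bar>2 * real k - X n\<bar> * r\<^sup>2 / 2"
        unfolding e abs_mult abs_divide by simp
      also have "\<dots> \<le> r + r ^ 3 / 4 * (2 * real k - X n)\<^sup>2"
      proof -
        define v where "v = \<bar>2 * real k - X n\<bar>"
        have "0 \<le> r * (1 - r * v / 2)\<^sup>2 + r * (r * v / 2)" using r(1) by (simp add: v_def)
        moreover have "r + r ^ 3 / 4 * v\<^sup>2 - v * r\<^sup>2 / 2 = r * (1 - r * v / 2)\<^sup>2 + r * (r * v / 2)"
          by (simp add: power2_eq_square power3_eq_cube field_simps)
        ultimately show ?thesis unfolding v_def by simp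
      qed
      finally have *: "\<bar>real k / sqrt n - c\<bar> \<le> r + r ^ 3 / 4 * (2 * real k - X n)\<^sup>2" .
      have "\<bar>P n k * w n k - L * w n k\<bar> = \<bar>P n k - L\<bar> * w n k"
        using w0[of k] by (simp add: abs_mult flip: left_diff_distrib)
      also have "\<dots> \<le> (C * (\<bar>real k / sqrt n - c\<bar> + 1 / sqrt n)) * w n k"
        unfolding P_def L_def C_def by (intro mult_right_mono falling_prod_approx c n w0)
      also have "\<dots> \<le> (C * ((r + r ^ 3 / 4 * (2 * real k - X n)\<^sup>2) + r\<^sup>2)) * w n k"
        using C * by (intro mult_right_mono mult_left_mono add_mono w0) (auto simp: r(2))
      also have "\<dots> = D k" by (simp add: D_def algebra_simps)
      finally show ?thesis .
    qed
    have summ: "summable (\<lambda>k. \<bar>P n k * w n k - L * w n k\<bar>)"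
      by (rule summable_comparison_test'[OF sums_summable[OF D], of 0]) (use le in auto)
    have "\<bar>S n - L * cosh (X n)\<bar> \<le> (\<Sum>k. \<bar>P n k * w n k - L * w n k\<bar>)"
      using summable_rabs[OF summ] sums_unique[OF diff] by simp
    also have "\<dots> \<le> C * (r * cosh (X n) + r ^ 3 / 4 * V + r\<^sup>2 * cosh (X n))"
      using suminf_le[OF le summ sums_summable[OF D]] sums_unique[OF D] by simp
    also have "\<dots> \<le> C * (r * cosh (X n) + r ^ 3 / 4 * ((4 + X n) * cosh (X n)) + r\<^sup>2 * cosh (X n))"
      using C r(1) V(2) by (intro mult_left_mono add_mono) auto
    also have "\<dots> = B n * cosh (X n)"
      unfolding B_def r(3,4) r_def[symmetric] by (simp add: algebra_simps)
    finally have "\<bar>S n - L * cosh (X n)\<bar> / cosh (X n) \<le> B n"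
      by (simp add: divide_le_eq)
    moreover have "S n / cosh (X n) - L = (S n - L * cosh (X n)) / cosh (X n)"
      by (simp add: diff_divide_distrib)
    ultimately show ?thesis by (simp add: abs_divide)
  qed
  have "B \<longlonglongrightarrow> 0" unfolding B_def X_def using c C by real_asymp
  moreover have "\<forall>\<^sub>F n in sequentially. norm (S n / cosh (X n) - L) \<le> B n"
  proof -
    have "\<forall>\<^sub>F n::nat in sequentially. 16 * c\<^sup>2 \<le> real n" by real_asymp
    then show ?thesis using eventually_ge_at_top[of 1] by eventually_elim (use bound in auto)
  qed
  ultimately have "(\<lambda>n. S n / cosh (X n) - L) \<longlonglongrightarrow> 0"
    by (rule Lim_null_comparison[rotated])
  then show ?thesis by (simp add: LIM_zero_iff S_def P_def w_def X_def L_def)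
qed

text \<open>The logarithmic increments are ln (1 + a / n) - a ln (1 + 1 / n), where the first-order
  terms cancel; this gives a rate. The limit itself comes from Euler's limit formula for Gamma. The
  rate is applied at \<theta>, the bare limit at 1/2.\<close>

lemma pochhammer_asymp:
  fixes a :: real
  assumes a: "a > 0"
  shows "(\<lambda>n. ln (pochhammer a n / (fact n * real n powr (a - 1))) + ln (Gamma a)) \<in> O(\<lambda>n. real n powr (-1/2))"
    and "(\<lambda>n. pochhammer a n / (fact n * real n powr (a - 1))) \<longlonglongrightarrow> 1 / Gamma a"
proof -
  define v where "v n = pochhammer a n / (fact n * real n powr (a - 1))" for n
  define u where "u n = ln (v n)" for n
  have G: "Gamma a > 0" using a by (rule Gamma_real_pos)
  have pp: "pochhammer a n > 0" for n using a by (rule pochhammer_pos)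
  have vpos: "v n > 0" if "n \<ge> 1" for n using that pp[of n] by (simp add: v_def)
  have lim: "v \<longlonglongrightarrow> 1 / Gamma a"
  proof -
    have "(\<lambda>n. 1 / Gamma_series' a n) \<longlonglongrightarrow> 1 / Gamma a"
      using G by (intro tendsto_divide tendsto_const Gamma_series'_LIMSEQ) auto
    moreover have "\<forall>\<^sub>F n in sequentially. 1 / Gamma_series' a n = v n"
      using eventually_ge_at_top[of 1]
    proof eventually_elim
      case (elim n)
      have "fact n = real n * fact (n - 1)" using elim by (simp add: fact_reduce)
      moreover have "exp (a * ln (real n)) = real n * real n powr (a - 1)"
        using elim by (simp add: powr_diff) (simp add: powr_def)
      ultimately show ?case using elim by (simp add: Gamma_series'_def v_def mult_ac)
    qed
    ultimately show ?thesis by (rule Lim_transform_eventually)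
  qed
  have lim0: "filterlim (\<lambda>n. 1 / real n) (at_right 0) at_top" by real_asymp
  have "(\<lambda>x::real. ln (1 + a * x) - a * x) \<in> O[at_right 0](\<lambda>x. x\<^sup>2)" using a by real_asymp
  from landau_o.big.compose[OF this lim0]
  have 1: "(\<lambda>n. ln (1 + a * (1 / real n)) - a * (1 / real n)) \<in> O(\<lambda>n. (1 / real n)\<^sup>2)" .
  have "(\<lambda>x::real. ln (1 + x) - x) \<in> O[at_right 0](\<lambda>x. x\<^sup>2)" by real_asymp
  from landau_o.big.compose[OF this lim0]
  have "(\<lambda>n. a * (ln (1 + 1 / real n) - 1 / real n)) \<in> O(\<lambda>n. (1 / real n)\<^sup>2)" using a by simp
  from sum_in_bigo(2)[OF 1 this]
  have "(\<lambda>n. (ln (1 + a * (1 / real n)) - a * (1 / real n)) - a * (ln (1 + 1 / real n) - 1 / real n)) \<in> O(\<lambda>n. (1 / real n)\<^sup>2)" .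
  also have "(\<lambda>n. (1 / real n)\<^sup>2) \<in> O(\<lambda>n. real n powr (-3/2))" by real_asymp
  also have "(\<lambda>n. (ln (1 + a * (1 / real n)) - a * (1 / real n)) - a * (ln (1 + 1 / real n) - 1 / real n)) \<in> O(\<lambda>n. real n powr (-3/2))
    \<longleftrightarrow> (\<lambda>n. u (Suc n) - u n) \<in> O(\<lambda>n. real n powr (-3/2))"
  proof (rule landau_o.big.in_cong)
    show "\<forall>\<^sub>F n in at_top. (ln (1 + a * (1 / real n)) - a * (1 / real n)) - a * (ln (1 + 1 / real n) - 1 / real n) = u (Suc n) - u n"
      using eventually_ge_at_top[of 1]
    proof eventually_elim
      case (elim n)
      have ln_v: "u m = ln (pochhammer a m) - ln (fact m) - (a - 1) * ln (real m)" if "m \<ge> 1" for m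
        using that pp[of m] by (simp add: u_def v_def ln_div ln_mult ln_powr)
      have 1: "ln (pochhammer a (Suc n)) = ln (pochhammer a n) + ln (a + real n)"
        using pp[of n] a by (simp add: pochhammer_Suc ln_mult)
      have 2: "ln (fact (Suc n)) = ln (real (Suc n)) + ln (fact n)"
        by (simp add: ln_mult del: of_nat_Suc)
      have "1 + a * (1 / real n) = (a + real n) / real n" "1 + 1 / real n = real (Suc n) / real n"
        using elim by (simp_all add: field_simps)
      then have 3: "ln (1 + a * (1 / real n)) = ln (a + real n) - ln (real n)" "ln (1 + 1 / real n) = ln (real (Suc n)) - ln (real n)"
        using elim a by (simp_all add: ln_div del: of_nat_Suc)
      show ?case using elim unfolding 3 by (simp add: ln_v 1 2 algebra_simps del: of_nat_Suc fact_Suc)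
    qed
  qed
  finally obtain l where l: "u \<longlonglongrightarrow> l" "(\<lambda>n. u n - l) \<in> O(\<lambda>n. real n powr (-1/2))"
    by (rule increments_powr_imp_LIMSEQ)
  have "u \<longlonglongrightarrow> ln (1 / Gamma a)" unfolding u_def using G by (intro tendsto_ln lim) auto
  then have "l = ln (1 / Gamma a)" using l(1) by (rule LIMSEQ_unique[rotated])
  then have "(\<lambda>n. ln (v n) + ln (Gamma a)) \<in> O(\<lambda>n. real n powr (-1/2))"
    using l(2) G by (simp add: ln_div u_def)
  then show "(\<lambda>n. ln (pochhammer a n / (fact n * real n powr (a - 1))) + ln (Gamma a)) \<in> O(\<lambda>n. real n powr (-1/2))"
    by (simp only: v_def)
  show "(\<lambda>n. pochhammer a n / (fact n * real n powr (a - 1))) \<longlonglongrightarrow> 1 / Gamma a"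
    using lim by (simp only: v_def[abs_def])
qed

section \<open>Calculus of relative errors of order n^(-1/2), and the value of the constant\<close>

lemma bigo_powr_minus_half_tendsto_0:
  fixes f :: "nat \<Rightarrow> real"
  assumes "f \<in> O(\<lambda>n. real n powr (-1/2))"
  shows "f \<longlonglongrightarrow> 0"
proof -
  have "f \<in> o(\<lambda>_. 1)" using assms by (rule landau_o.big_small_trans) real_asymp
  then show ?thesis by (rule smalloD_tendsto[where g = "\<lambda>_. 1", simplified])
qed

lemma exp_minus_one_bigo:
  fixes f :: "nat \<Rightarrow> real"
  assumes "f \<in> O(\<lambda>n. real n powr (-1/2))"
  shows "(\<lambda>n. exp (f n) - 1) \<in> O(\<lambda>n. real n powr (-1/2))"
proof -
  have "\<forall>\<^sub>F n in at_top. f n < 1"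
    using bigo_powr_minus_half_tendsto_0[OF assms] by (rule order_tendstoD) simp
  then have "\<forall>\<^sub>F n in at_top. norm (exp (f n) - 1) \<le> exp 1 * norm (f n)"
  proof eventually_elim
    case (elim n)
    then show ?case using abs_exp_minus_one_le[of "f n" 1] by (simp add: mult.commute)
  qed
  then have "(\<lambda>n. exp (f n) - 1) \<in> O(f)" by (rule bigoI)
  then show ?thesis using assms by (rule landau_o.big_trans)
qed

lemma mult_minus_one_bigo:
  fixes f g :: "nat \<Rightarrow> real"
  assumes "(\<lambda>n. f n - 1) \<in> O(\<lambda>n. real n powr (-1/2))" "(\<lambda>n. g n - 1) \<in> O(\<lambda>n. real n powr (-1/2))"
  shows "(\<lambda>n. f n * g n - 1) \<in> O(\<lambda>n. real n powr (-1/2))"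
proof -
  have "(\<lambda>n. (f n - 1) * (g n - 1)) \<in> O(\<lambda>n. real n powr (-1/2) * real n powr (-1/2))"
    by (intro landau_o.big.mult assms)
  also have "(\<lambda>n. real n powr (-1/2) * real n powr (-1/2)) \<in> O(\<lambda>n. real n powr (-1/2))" by real_asymp
  finally have "(\<lambda>n. (f n - 1) * (g n - 1) + (f n - 1) + (g n - 1)) \<in> O(\<lambda>n. real n powr (-1/2))"
    by (intro sum_in_bigo(1) assms)
  then show ?thesis by (simp add: algebra_simps)
qed

text \<open>\<open>half_laguerre\<close> is evaluated twice: as a convolution it is asymptotic to
  \<open>e n * y n\<close>, as a perturbed cosh series to \<open>p n * cosh (2 * c * sqrt n)\<close>
  times exp (- \<theta> / 2). The powers -3/4 + 1/4 and -1/2 of n cancel; cosh contributes the 2,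
  \<open>p n\<close> contributes Gamma (1/2) = sqrt pi, and \<open>y n\<close> the root of
  \<open>c\<close>.\<close>

lemma exp_path_coeff_constant:
  assumes \<theta>: "\<theta> > 0"
    and asymp: "(\<lambda>n. ln (exp_path_coeff \<theta> n) - (2 * sqrt \<theta> * sqrt (real n) - 3 / 4 * ln (real n)) - l) \<in> O(\<lambda>n. real n powr (-1/2))"
  shows "exp l = sqrt (sqrt \<theta>) * exp (- \<theta> / 2) / (2 * sqrt pi)"
proof -
  define c e where "c = sqrt \<theta>" and "e = exp_path_coeff \<theta>"
  have c: "c > 0" "c\<^sup>2 = \<theta>" using \<theta> by (auto simp: c_def)
  have epos: "e n > 0" for n using exp_path_coeff_pos_mono[OF \<theta>] by (simp add: e_def)
  define \<epsilon> where "\<epsilon> n = ln (e n) - (2 * c * sqrt (real n) - 3 / 4 * ln (real n)) - l" for n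
  have \<epsilon>O: "\<epsilon> \<in> O(\<lambda>n. real n powr (-1/2))" using asymp by (simp add: \<epsilon>_def[abs_def] c_def e_def)
  then have \<epsilon>: "\<epsilon> \<longlonglongrightarrow> 0" by (rule bigo_powr_minus_half_tendsto_0)
  define h p where "h = half_laguerre \<theta>" and "p = neg_binomial_coeff (1 / 2)"
  define y where "y n = (sqrt (real n) / c) powr (1 / 2)" for n
  have ppos: "p n > 0" for n by (simp add: p_def neg_binomial_coeff_pos)
  have "(\<lambda>n. h n / (e n * y n) - 1) \<in> O(\<lambda>n. real n powr (-1/2))"
    using neg_binomial_convolution_asymp[of c 1 "1 / 2" e l] c epos \<epsilon>O half_laguerre_eq_convolution[where \<theta> = \<theta>]
    by (simp add: h_def y_def e_def \<epsilon>_def[abs_def])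
  then have conv: "(\<lambda>n. h n / (e n * y n)) \<longlonglongrightarrow> 1"
    by (intro LIM_zero_cancel[of _ 1] bigo_powr_minus_half_tendsto_0)
  have "(\<lambda>n::nat. (\<Sum>k\<le>n. (\<Prod>i<k. 1 - real i / real n) * ((2 * c * sqrt n) ^ (2 * k) / fact (2 * k)))
     / cosh (2 * c * sqrt n)) \<longlonglongrightarrow> exp (- c\<^sup>2 / 2)"
    by (rule weighted_falling_prod_limit[OF c(1)])
  moreover have "\<forall>\<^sub>F n in sequentially. (\<Sum>k\<le>n. (\<Prod>i<k. 1 - real i / real n) * ((2 * c * sqrt n) ^ (2 * k) / fact (2 * k)))
     / cosh (2 * c * sqrt n) = h n / (p n * cosh (2 * c * sqrt n))"
    using eventually_ge_at_top[of 1]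
  proof eventually_elim
    case (elim n)
    have "(2 * c * sqrt n) ^ (2 * k) = (4 * \<theta> * real n) ^ k" for k
      using c(2) by (simp add: power_mult power_mult_distrib)
    then show ?case
      using half_laguerre_eq_cosh_sum[OF elim, of \<theta>] ppos[of n] by (simp add: h_def p_def)
  qed
  ultimately have "(\<lambda>n. h n / (p n * cosh (2 * c * sqrt n))) \<longlonglongrightarrow> exp (- c\<^sup>2 / 2)"
    by (rule Lim_transform_eventually)
  from tendsto_divide[OF this conv]
  have "(\<lambda>n. h n / (p n * cosh (2 * c * sqrt n)) / (h n / (e n * y n))) \<longlonglongrightarrow> exp (- \<theta> / 2)" by (simp add: c(2))
  moreover have "\<forall>\<^sub>F n in sequentially. h n / (p n * cosh (2 * c * sqrt n)) / (h n / (e n * y n))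
      = exp l * exp (\<epsilon> n) * (exp (2 * c * sqrt n) / cosh (2 * c * sqrt n)) * (1 / sqrt c) / (p n / (1 * real n powr (1 / 2 - 1)))"
  proof -
    \<comment> \<open>The limit 1 guarantees that \<open>h n\<close> is eventually nonzero and may
      be cancelled.\<close>
    have "\<forall>\<^sub>F n in sequentially. h n / (e n * y n) > 0"
      using conv by (rule order_tendstoD) simp
    then show ?thesis using eventually_ge_at_top[of 1]
    proof eventually_elim
      case (elim n)
      then have h0: "h n \<noteq> 0" by auto
      have en: "e n = exp l * exp (\<epsilon> n) * exp (2 * c * sqrt n) * real n powr (- 3 / 4)"
      proof -
        have "e n = exp (ln (e n))" using epos[of n] by simp
        also have "ln (e n) = l + \<epsilon> n + 2 * c * sqrt n + (- 3 / 4) * ln (real n)" by (simp add: \<epsilon>_def)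
        also have "exp \<dots> = exp l * exp (\<epsilon> n) * exp (2 * c * sqrt n) * real n powr (- 3 / 4)"
          unfolding exp_add using elim by (simp add: powr_def)
        finally show ?thesis .
      qed
      have yn: "y n = real n powr (1 / 4) * (1 / sqrt c)"
        using c(1) elim(2) by (simp add: y_def powr_divide powr_half_sqrt powr_powr flip: powr_half_sqrt)
      have pw: "real n powr (- 3 / 4) * real n powr (1 / 4) = real n powr (1 / 2 - 1)"
        by (simp flip: powr_add)
      have "h n / (p n * cosh (2 * c * sqrt n)) / (h n / (e n * y n)) = e n * y n / (p n * cosh (2 * c * sqrt n))"
        using h0 by simp
      also have "\<dots> = exp l * exp (\<epsilon> n) * (exp (2 * c * sqrt n) / cosh (2 * c * sqrt n)) * (1 / sqrt c) / (p n / (1 * real n powr (1 / 2 - 1)))"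
        unfolding pw[symmetric] en yn by (simp add: mult_ac)
      finally show ?case .
    qed
  qed
  ultimately have "(\<lambda>n. exp l * exp (\<epsilon> n) * (exp (2 * c * sqrt n) / cosh (2 * c * sqrt n)) * (1 / sqrt c) / (p n / (1 * real n powr (1 / 2 - 1)))) \<longlonglongrightarrow> exp (- \<theta> / 2)"
    by (rule Lim_transform_eventually)
  moreover have "(\<lambda>n. exp l * exp (\<epsilon> n) * (exp (2 * c * sqrt n) / cosh (2 * c * sqrt n)) * (1 / sqrt c) / (p n / (1 * real n powr (1 / 2 - 1))))
     \<longlonglongrightarrow> exp l * exp 0 * 2 * (1 / sqrt c) / (1 / Gamma (1 / 2))"
  proof -
    have 1: "(\<lambda>n. exp (2 * c * sqrt (real n)) / cosh (2 * c * sqrt (real n))) \<longlonglongrightarrow> 2"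
      unfolding cosh_field_def using c(1) by real_asymp
    have 2: "(\<lambda>n. p n / (1 * real n powr (1 / 2 - 1))) \<longlonglongrightarrow> 1 / Gamma (1 / 2)"
      using pochhammer_asymp(2)[of "1 / 2"] by (simp add: p_def neg_binomial_coeff_def)
    have 3: "(\<lambda>n. exp l * exp (\<epsilon> n)) \<longlonglongrightarrow> exp l * exp 0" by (intro tendsto_intros \<epsilon>)
    show ?thesis
      by (rule tendsto_divide[OF tendsto_mult[OF tendsto_mult[OF 3 1] tendsto_const] 2])
        (simp add: Gamma_one_half_real)
  qed
  ultimately have "exp (- \<theta> / 2) = exp l * exp 0 * 2 * (1 / sqrt c) / (1 / Gamma (1 / 2))"
    by (rule LIMSEQ_unique)
  then have "exp (- \<theta> / 2) = exp l * 2 * sqrt pi / sqrt c" by (simp add: Gamma_one_half_real)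
  then show ?thesis using c(1) by (simp add: c_def field_simps)
qed

section \<open>The expectation\<close>

lemma invol_coeff_eq_convolution:
  "invol_coeff \<theta> n = (\<Sum>j\<le>n div 2. neg_binomial_coeff (\<theta>\<^sup>2 / 2) j * exp_path_coeff \<theta> (n - 2 * j))"
proof -
  let ?f = "\<lambda>i. even_binomial_coeff (\<theta>\<^sup>2 / 2) i * exp_path_coeff \<theta> (n - i)"
  have "invol_coeff \<theta> n = sum ?f ((\<lambda>j. 2 * j) ` {..n div 2})"
    unfolding invol_coeff_def
  proof (rule sum.mono_neutral_right)
    show "\<forall>i\<in>{..n} - (\<lambda>j. 2 * j) ` {..n div 2}. ?f i = 0"
      by (auto simp: even_binomial_coeff_def image_iff elim!: evenE)
  qed auto
  also have "\<dots> = (\<Sum>j\<le>n div 2. neg_binomial_coeff (\<theta>\<^sup>2 / 2) j * exp_path_coeff \<theta> (n - 2 * j))"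
    by (subst sum.reindex) (auto simp: inj_on_def even_binomial_coeff_def)
  finally show ?thesis .
qed

theorem theorem2p1:
  fixes \<theta> :: real
  assumes "\<theta> > 0"
  defines "M \<equiv> (\<lambda>n::nat. \<theta> powr ((1 - \<theta>\<^sup>2) / 4) * Gamma \<theta>
              / (2 powr (\<theta>\<^sup>2 / 2 + 1) * exp (\<theta> / 2) * sqrt pi)
              * exp (2 * sqrt (\<theta> * real n)) * real n powr (\<theta>\<^sup>2 / 4 - \<theta> + 1 / 4))"
  shows "\<exists>r. r \<in> O(\<lambda>n. real n powr (-1/2)) \<and>
           (\<forall>\<^sub>F n in at_top. ewens_expectation \<theta> n (\<lambda>\<sigma>. real (invol n \<sigma>)) = M n * (1 + r n))"
proof -
  define c e where "c = sqrt \<theta>" and "e = exp_path_coeff \<theta>"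
  have c: "c > 0" "c\<^sup>2 = \<theta>" using assms(1) by (auto simp: c_def)
  have epos: "e n > 0" for n using exp_path_coeff_pos_mono[OF assms(1)] by (simp add: e_def)
  have G: "Gamma \<theta> > 0" using assms(1) by (rule Gamma_real_pos)
  obtain l where l: "(\<lambda>n. ln (e n) - (2 * sqrt (\<theta> * real n) - 3 / 4 * ln (real n)) - l) \<in> O(\<lambda>n. real n powr (-1/2))"
    using exp_path_coeff_asymp[OF assms(1)] by (auto simp: e_def)
  have asymp: "(\<lambda>n. ln (e n) - (2 * c * sqrt (real n) - 3 / 4 * ln (real n)) - l) \<in> O(\<lambda>n. real n powr (-1/2))"
    using l by (simp add: c_def real_sqrt_mult mult.assoc)
  have el: "exp l = sqrt c * exp (- \<theta> / 2) / (2 * sqrt pi)"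
    unfolding c_def by (rule exp_path_coeff_constant[OF assms(1)]) (use asymp in \<open>simp add: c_def e_def\<close>)
  define \<epsilon> where "\<epsilon> n = ln (e n) - (2 * c * sqrt (real n) - 3 / 4 * ln (real n)) - l" for n
  define \<gamma> where "\<gamma> n = ln (pochhammer \<theta> n / (fact n * real n powr (\<theta> - 1))) + ln (Gamma \<theta>)" for n
  define b where "b = \<theta>\<^sup>2 / 2"
  define y where "y n = (sqrt (real n) / (2 * c)) powr b" for n
  \<comment> \<open>Each of the three factors is an exact quotient of a quantity and its model, so
    \<open>M n * F n\<close> equals the expectation and \<open>F n - 1\<close> is the required
    \<open>r\<close>.\<close>
  define F where "F n = exp (\<epsilon> n) * (exp (- \<gamma> n) * (invol_coeff \<theta> n / (e n * y n)))" for n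
  have "(\<lambda>n. exp (\<epsilon> n) - 1) \<in> O(\<lambda>n. real n powr (-1/2))"
    unfolding \<epsilon>_def by (intro exp_minus_one_bigo asymp)
  moreover have "(\<lambda>n. exp (- \<gamma> n) - 1) \<in> O(\<lambda>n. real n powr (-1/2))"
    unfolding \<gamma>_def using pochhammer_asymp(1)[OF assms(1)] by (intro exp_minus_one_bigo) (simp only: landau_o.big.uminus_in_iff)
  moreover have "(\<lambda>n. invol_coeff \<theta> n / (e n * y n) - 1) \<in> O(\<lambda>n. real n powr (-1/2))"
    using neg_binomial_convolution_asymp[of c 2 b e l, OF c(1) _ _ epos asymp] assms(1)
    by (simp add: b_def y_def e_def invol_coeff_eq_convolution)
  ultimately have FO: "(\<lambda>n. F n - 1) \<in> O(\<lambda>n. real n powr (-1/2))"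
    unfolding F_def by (intro mult_minus_one_bigo)
  have "\<forall>\<^sub>F n in at_top. ewens_expectation \<theta> n (\<lambda>\<sigma>. real (invol n \<sigma>)) = M n * (1 + (F n - 1))"
    using eventually_ge_at_top[of 1]
  proof eventually_elim
    case (elim n)
    define N where "N = real n"
    have N: "N > 0" using elim by (simp add: N_def)
    have yn: "y n = N powr (\<theta>\<^sup>2 / 4) / (2 powr b * \<theta> powr (\<theta>\<^sup>2 / 4))"
    proof -
      have "sqrt (real n) powr b = N powr (\<theta>\<^sup>2 / 4)" "c powr b = \<theta> powr (\<theta>\<^sup>2 / 4)"
        using N assms(1) by (simp_all add: N_def c_def b_def powr_powr flip: powr_half_sqrt)
      then show ?thesis using c(1) by (simp add: y_def powr_divide powr_mult)
    qed
    have en: "e n = exp l * exp (\<epsilon> n) * exp (2 * sqrt (\<theta> * real n)) * N powr (- 3 / 4)"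
    proof -
      have "e n = exp (ln (e n))" using epos[of n] by simp
      also have "ln (e n) = l + \<epsilon> n + 2 * sqrt (\<theta> * real n) + (- 3 / 4) * ln N"
        by (simp add: \<epsilon>_def c_def N_def real_sqrt_mult)
      also have "exp \<dots> = exp l * exp (\<epsilon> n) * exp (2 * sqrt (\<theta> * real n)) * N powr (- 3 / 4)"
        unfolding exp_add using N by (simp add: powr_def)
      finally show ?thesis .
    qed
    have pn: "pochhammer \<theta> n > 0" using assms(1) by (rule pochhammer_pos)
    have gn: "exp (- \<gamma> n) = fact n * N powr (\<theta> - 1) / (pochhammer \<theta> n * Gamma \<theta>)"
    proof -
      have "exp (\<gamma> n) = pochhammer \<theta> n / (fact n * N powr (\<theta> - 1)) * Gamma \<theta>"
        unfolding \<gamma>_def exp_add N_def[symmetric] using pn G N by simp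
      then show ?thesis by (simp add: exp_minus)
    qed
    have Mn: "M n = Gamma \<theta> * N powr (1 - \<theta>) * exp l * exp (2 * sqrt (\<theta> * real n)) * N powr (- 3 / 4) * y n"
    proof -
      have "\<theta>\<^sup>2 / 4 - \<theta> + 1 / 4 = (1 - \<theta>) + - 3 / 4 + \<theta>\<^sup>2 / 4" by simp
      then have 1: "N powr (\<theta>\<^sup>2 / 4 - \<theta> + 1 / 4) = N powr (1 - \<theta>) * N powr (- 3 / 4) * N powr (\<theta>\<^sup>2 / 4)"
        by (simp only: powr_add)
      \<comment> \<open>The power of \<theta> in \<open>M\<close> gathers sqrt c from
        \<open>exp l\<close> and c powr (-b) from \<open>y n\<close>; the power of 2 gathers the 2
        of \<open>exp l\<close> and 2 powr (-b) from \<open>y n\<close>.\<close>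
      have "sqrt c = \<theta> powr (1 / 4)" using assms(1) by (simp add: c_def powr_powr flip: powr_half_sqrt)
      then have 2: "\<theta> powr ((1 - \<theta>\<^sup>2) / 4) = sqrt c / \<theta> powr (\<theta>\<^sup>2 / 4)"
        by (simp add: diff_divide_distrib powr_diff)
      have 3: "2 powr (\<theta>\<^sup>2 / 2 + 1) = 2 powr b * 2" by (simp add: b_def powr_add)
      have 4: "exp (- \<theta> / 2) = 1 / exp (\<theta> / 2)" by (simp add: exp_minus inverse_eq_divide)
      show ?thesis unfolding M_def N_def[symmetric] 1 2 3 yn el 4 by (simp add: field_simps)
    qed
    have "N powr (1 - \<theta>) * N powr (\<theta> - 1) = 1" using N by (simp flip: powr_add)
    then have "M n * F n = fact n * invol_coeff \<theta> n / pochhammer \<theta> n * ((exp l * exp (\<epsilon> n) * exp (2 * sqrt (\<theta> * real n)) * N powr (- 3 / 4)) / e n * (y n / y n))"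
      unfolding F_def gn Mn using G by simp
    also have "\<dots> = fact n * invol_coeff \<theta> n / pochhammer \<theta> n"
      unfolding en[symmetric] using epos[of n] N c(1) by (simp add: y_def N_def)
    finally show ?case by (simp add: ewens_expectation_invol_eq)
  qed
  with FO show ?thesis by blast
qed

end
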